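(* Let $d\geq 2$ be an integer and consider Bernoulli bond percolation with parameter $p$ on the hypercubic lattice $\mathbb{L}^d=(\mathbb{Z}^d,\mathbb{E})$, with two-point connectivity function $\tau_p(n)=P_p\big((0,\dots,0)\leftrightarrow (n,0,\dots,0)\big)$ and truncated two-point function $\tau^f_p(n)=P_p\big((0,\dots,0)\leftrightarrow (n,0,\dots,0),\ (0,\dots,0)\nleftrightarrow\infty\big)$. Then: (i) There exists $p'\in(0,1]$, depending on $d$, such that $\tau_p(n)>\tau_p(n+1)$ for all $n\in\mathbb{N}$ and all $p$ with $0<p<p'$. (ii) There exists $p''\in[0,1)$, depending on $d$, such that $\tau^f_p(n)>\tau^f_p(n+1)$ for all $n\in\mathbb{N}$ and all $p$ with $p''<p<1$.
   Context: $\mathbb{N}=\{1,2,3,\dots\}$. The graph $\mathbb{L}^d=(\mathbb{Z}^d,\mathbb{E})$ has vertex set $\mathbb{Z}^d$ and edge (bond) set $\mathbb{E}=\{\langle x,y\rangle : x,y\in\mathbb{Z}^d,\ |x-y|_1=1\}$, where $|\cdot|_1$ is the $\ell^1$ norm. For $p\in[0,1]$, each bond is open with probability $p$ and closed with probability $1-p$, independently of all other bonds. Formally, the model is the probability space $(\Omega,\mathcal{F},P_p)$ with $\Omega=\{0,1\}^{\mathbb{E}}$, $\mathcal{F}$ the $\sigma$-algebra generated by the cylinder sets, and $P_p=\prod_{e\in\mathbb{E}}\mu(e)$ the product of Bernoulli measures with parameter $p$ (value $1$ means open, value $0$ means closed). For $x,y\in\mathbb{Z}^d$, $(x\leftrightarrow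 y)$ is the set of configurations $\omega\in\Omega$ in which $x$ is connected to $y$ by a path of open bonds. The event $\big((0,\dots,0)\nleftrightarrow\infty\big)$ is the set of configurations in which the origin is connected by open paths to at most finitely many vertices. A comma between events denotes their intersection. *)

theory Defs
  imports "HOL-Probability.Probability"
begin

(* Z^d is represented by the integer sequences vanishing from index d on. *)
definition lattice_vertices :: "nat \<Rightarrow> (nat \<Rightarrow> int) set" where
  "lattice_vertices d = {x. \<forall>i\<ge>d. x i = 0}"

definition l1_norm :: "nat \<Rightarrow> (nat \<Rightarrow> int) \<Rightarrow> int" where
  "l1_norm d x = (\<Sum>i<d. \<bar>x i\<bar>)"

definition lattice_edges :: "nat \<Rightarrow> (nat \<Rightarrow> int) set set" where
  "lattice_edges d =
     {{x, y} | x y. x \<in> lattice_vertices d \<and> y \<in> lattice_vertices d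
                    \<and> l1_norm d (\<lambda>i. x i - y i) = 1}"

type_synonym configuration = "(nat \<Rightarrow> int) set \<Rightarrow> bool"

(* True means open, False means closed. *)
definition percolation :: "nat \<Rightarrow> real \<Rightarrow> configuration measure" where
  "percolation d p = (\<Pi>\<^sub>M e\<in>lattice_edges d. measure_pmf (bernoulli_pmf p))"

definition open_adjacency :: "nat \<Rightarrow> configuration \<Rightarrow> ((nat \<Rightarrow> int) \<times> (nat \<Rightarrow> int)) set" where
  "open_adjacency d \<omega> = {(x, y). {x, y} \<in> lattice_edges d \<and> \<omega> {x, y}}"

definition open_connected :: "nat \<Rightarrow> configuration \<Rightarrow> (nat \<Rightarrow> int) \<Rightarrow> (nat \<Rightarrow> int) \<Rightarrow> bool" where
  "open_connected d \<omega> x y \<longleftrightarrow> (x, y) \<in> (open_adjacency d \<omega>)\<^sup>*"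

definition origin :: "nat \<Rightarrow> int" where
  "origin = (\<lambda>i. 0)"

(* The point (n, 0, ..., 0). *)
definition axis_point :: "nat \<Rightarrow> nat \<Rightarrow> int" where
  "axis_point n = (\<lambda>i. 0)(0 := int n)"

definition connection_event ::
    "nat \<Rightarrow> real \<Rightarrow> (nat \<Rightarrow> int) \<Rightarrow> (nat \<Rightarrow> int) \<Rightarrow> configuration set" where
  "connection_event d p x y = {\<omega> \<in> space (percolation d p). open_connected d \<omega> x y}"

definition finite_cluster_event :: "nat \<Rightarrow> real \<Rightarrow> configuration set" where
  "finite_cluster_event d p =
     {\<omega> \<in> space (percolation d p).
        finite {y \<in> lattice_vertices d. open_connected d \<omega> origin y}}"

definition two_point :: "nat \<Rightarrow> real \<Rightarrow> nat \<Rightarrow> real" where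
  "two_point d p n = measure (percolation d p) (connection_event d p origin (axis_point n))"

definition truncated_two_point :: "nat \<Rightarrow> real \<Rightarrow> nat \<Rightarrow> real" where
  "truncated_two_point d p n =
     measure (percolation d p)
       (connection_event d p origin (axis_point n) \<inter> finite_cluster_event d p)"

end

(*
  Contracting the layers k and k + 1 (that is, deleting the edges inside layer k + 1 and those
  between the two layers) maps configurations to configurations and preserves the measure. If the
  origin is joined to (n + 1, 0, ..., 0) and the cluster is thin around layer k, the contracted
  configuration joins the origin to (n, 0, ..., 0), and one further edge, determined by the
  contracted configuration and independent of it, must be open (case (i)) or closed (case (ii)).
  So "layer k is contractible" has probability at most pi tau(n), where pi = p or pi = 1 - p is small.
  By Markov's inequality, at least half of the n + 1 layers are contractible with probability at most
  2 pi tau(n). If more than half are not, the cluster (case (i)), or its outer boundary together with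
  one cut set per bad layer (case (ii)), is a connected set of edges with so many edges in the
  unlikely state that a Peierls count bounds its probability by a small multiple of the
  straight-line lower bound for tau(n). In case (ii) a boundary has at least 2 (d - 1) closed edges
  in every layer, and each bad layer costs at least one more; boundaries are connected by Timar's
  parity argument.
*)

theory Submission
  imports Defs
begin

text \<open>What contraction gains is the factor pi. It needs a deleted edge that can be named from
  the contracted configuration alone, since deleted edges are independent of that configuration. In
  case (i) this is the edge by which the cluster leaves the half-space up to layer k: contraction
  does not change that half-space, so a unique cluster vertex in layer k can be read off afterwards.
  In case (ii) it is an edge of layer k + 1 next to the topmost vertex that the contracted cluster
  has in layer k. A Peierls count loses a constant factor per edge, hence a constant to a power
  proportional to n. A bounded surplus of unlikely edges over the straight line cannot repay this:
  the surplus has to grow linearly in n. A single bad layer guarantees at most one more edge, so a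
  positive fraction of bad layers is needed, and this forces the average over all layers.\<close>

section \<open>Connectivity in induced subgraphs and covering walks\<close>

lemma rtrancl_exit:
  assumes "(a, b) \<in> R\<^sup>*" "a \<in> X" "b \<notin> X"
  obtains y z where "(a, y) \<in> R\<^sup>*" "(y, z) \<in> R" "y \<in> X" "z \<notin> X"
proof -
  have "b \<notin> X \<longrightarrow> (\<exists>y z. (a, y) \<in> R\<^sup>* \<and> (y, z) \<in> R \<and> y \<in> X \<and> z \<notin> X)"
    using assms(1)
  proof (induction rule: rtrancl_induct)
    case base
    then show ?case using assms(2) by simp
  next
    case (step y z)
    then show ?case by blast
  qed
  then show thesis using that assms(3) by blast
qed

abbreviation restr :: "('a \<Rightarrow> 'a \<Rightarrow> bool) \<Rightarrow> 'a set \<Rightarrow> ('a \<times> 'a) set" where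
  "restr R S \<equiv> {(x, y). x \<in> S \<and> y \<in> S \<and> R x y}"

lemma restr_mono: "S \<subseteq> T \<Longrightarrow> (a, b) \<in> (restr R S)\<^sup>* \<Longrightarrow> (a, b) \<in> (restr R T)\<^sup>*"
  by (rule subsetD[OF rtrancl_mono]) auto

lemma restr_sym:
  assumes "\<And>x y. R x y \<Longrightarrow> R y x" "(a, b) \<in> (restr R S)\<^sup>*"
  shows "(b, a) \<in> (restr R S)\<^sup>*"
proof -
  have "sym (restr R S)"
    using assms(1) by (auto simp: sym_def)
  then show ?thesis
    using assms(2) by (meson sym_rtrancl symD)
qed

text \<open>Going back and forth along the edges of a spanning tree.\<close>

lemma covering_walk:
  assumes "finite S" "r \<in> S" and reach: "\<And>e. e \<in> S \<Longrightarrow> (r, e) \<in> (restr R S)\<^sup>*"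
    and sym: "\<And>x y. R x y \<Longrightarrow> R y x"
  obtains w where "successively R w" "w \<noteq> []" "hd w = r" "set w = S" "length w + 1 = 2 * card S"
proof -
  have grow: "Suc t \<le> card S \<Longrightarrow> \<exists>w. successively R w \<and> w \<noteq> [] \<and> hd w = r \<and> set w \<subseteq> S \<and>
    card (set w) = Suc t \<and> length w + 1 = 2 * Suc t" for t
  proof (induction t)
    case 0
    show ?case by (rule exI[of _ "[r]"]) (use assms in auto)
  next
    case (Suc t)
    then obtain w where w: "successively R w" "w \<noteq> []" "hd w = r" "set w \<subseteq> S"
      "card (set w) = Suc t" "length w + 1 = 2 * Suc t" by auto
    obtain e where e: "e \<in> S" "e \<notin> set w"
      using Suc.prems w(4,5) by (metis Suc_n_not_le_n subsetI subset_antisym)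
    have "r \<in> set w" using w by auto
    then obtain y x where yx: "(y, x) \<in> restr R S" "y \<in> set w" "x \<notin> set w"
      using rtrancl_exit[OF reach[OF e(1)] _ e(2)] by blast
    obtain as bs where s: "w = as @ y # bs"
      using yx(2) by (meson split_list)
    \<comment> \<open>The detour from \<open>y\<close> to the new vertex \<open>x\<close> and back
      adds two entries, so \<open>t + 1\<close> vertices are covered by \<open>2 * t + 1\<close>
      entries.\<close>
    let ?w = "as @ y # x # y # bs"
    have "set ?w = insert x (set w)" by (auto simp: s)
    moreover have "successively R ?w"
      using w(1) yx(1) sym unfolding s by (auto simp: successively_append_iff successively_Cons)
    moreover have "hd ?w = r" using w(3) unfolding s by (cases as) auto
    moreover have "length ?w = length w + 2" unfolding s by simp
    ultimately show ?case
      using w yx by (intro exI[of _ ?w]) auto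
  qed
  have "card S > 0" using assms(1,2) card_gt_0_iff by blast
  then obtain w where w: "successively R w" "w \<noteq> []" "hd w = r" "set w \<subseteq> S"
      "card (set w) = card S" "length w + 1 = 2 * card S"
    using grow[of "card S - 1"] by auto
  have "set w = S" using w(4,5) assms(1) by (simp add: card_subset_eq)
  then show thesis using that w by blast
qed

lemma card_walks:
  assumes fin: "\<And>e. e \<in> E \<Longrightarrow> finite {e' \<in> E. R e e'}"
    and card: "\<And>e. e \<in> E \<Longrightarrow> card {e' \<in> E. R e e'} \<le> D" and "r \<in> E"
  shows "finite {w. length w = Suc l \<and> hd w = r \<and> set w \<subseteq> E \<and> successively R w} \<and>
    card {w. length w = Suc l \<and> hd w = r \<and> set w \<subseteq> E \<and> successively R w} \<le> D ^ l"
    (is "finite (?W l r) \<and> _")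
  using \<open>r \<in> E\<close>
proof (induction l arbitrary: r)
  case 0
  have "?W 0 r \<subseteq> {[r]}" by (auto simp: length_Suc_conv)
  then show ?case
    using card_mono[of "{[r]}" "?W 0 r"] finite_subset[of "?W 0 r" "{[r]}"] by auto
next
  case (Suc l)
  let ?N = "{e' \<in> E. R r e'}"
  have sub: "?W (Suc l) r \<subseteq> (\<Union>e\<in>?N. (#) r ` ?W l e)"
  proof
    fix w assume w: "w \<in> ?W (Suc l) r"
    then obtain v where v: "w = r # v" "length v = Suc l"
      by (auto simp: length_Suc_conv)
    then have ne: "v \<noteq> []" by auto
    then have "hd v \<in> E" using w v by auto
    moreover have "R r (hd v)" "successively R v"
      using w v ne by (auto simp: successively_Cons)
    ultimately show "w \<in> (\<Union>e\<in>?N. (#) r ` ?W l e)"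
      using w v by auto
  qed
  have IH: "finite (?W l e)" "card (?W l e) \<le> D ^ l" if "e \<in> ?N" for e
    using Suc.IH[of e] that by auto
  have fN: "finite ?N" using fin Suc.prems by blast
  then have fU: "finite (\<Union>e\<in>?N. (#) r ` ?W l e)" using IH by auto
  have "card (?W (Suc l) r) \<le> card (\<Union>e\<in>?N. (#) r ` ?W l e)"
    by (rule card_mono[OF fU sub])
  also have "\<dots> \<le> (\<Sum>e\<in>?N. card ((#) r ` ?W l e))"
    by (rule card_UN_le[OF fN])
  also have "\<dots> \<le> (\<Sum>e\<in>?N. D ^ l)"
    by (intro sum_mono order.trans[OF card_image_le IH(2)] IH(1))
  also have "\<dots> \<le> D * D ^ l"
    using card[OF Suc.prems] by simp
  finally show ?case using finite_subset[OF sub fU] by simp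
qed

text \<open>Repeating the last entry gives all covering walks one common length, so a single count
  of walks handles connected sets of every size up to a bound.\<close>

lemma pad_walk:
  assumes "successively R w" "w \<noteq> []" "hd w = r" "length w \<le> m" "\<And>e. e \<in> set w \<Longrightarrow> R e e"
  obtains w' where "successively R w'" "hd w' = r" "set w' = set w" "length w' = m"
proof
  let ?w = "w @ replicate (m - length w) (last w)"
  have rep: "successively R (replicate j (last w))" for j
  proof (induction j)
    case (Suc j)
    then show ?case using assms(2,5) by (cases j) (auto simp: successively_Cons)
  qed simp
  show "successively R ?w"
    using assms rep[of "m - length w"]
    by (cases "m - length w = 0") (auto simp: successively_append_iff hd_replicate)
  show "hd ?w = r" using assms by simp
  show "set ?w = set w" using assms(2) by auto
  show "length ?w = m" using assms(4) by simp
qed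

subsection \<open>The lattice\<close>

abbreviation adj :: "nat \<Rightarrow> (nat \<Rightarrow> int) \<Rightarrow> (nat \<Rightarrow> int) \<Rightarrow> bool" where
  "adj d x y \<equiv> {x, y} \<in> lattice_edges d"

text \<open>The argument is an integer because the large-p case follows the first axis to the
  negative side of the origin as well.\<close>

definition axis_pt :: "int \<Rightarrow> nat \<Rightarrow> int" where
  "axis_pt j = (\<lambda>i. 0)(0 := j)"

lemma axis_pt_0 [simp]: "axis_pt j 0 = j" and axis_pt_pos [simp]: "0 < i \<Longrightarrow> axis_pt j i = 0"
  by (simp_all add: axis_pt_def)

lemma vertices_upd_iff [simp]:
  "i < d \<Longrightarrow> x(i := t) \<in> lattice_vertices d \<longleftrightarrow> x \<in> lattice_vertices d"
  by (auto simp: lattice_vertices_def)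

lemma axis_in_vertices [simp]: "0 < d \<Longrightarrow> axis_pt j \<in> lattice_vertices d"
  by (auto simp: lattice_vertices_def)

lemma l1_norm_eq_1_iff:
  "l1_norm d z = 1 \<longleftrightarrow> (\<exists>i<d. \<bar>z i\<bar> = 1 \<and> (\<forall>j<d. j \<noteq> i \<longrightarrow> z j = 0))"
proof
  assume l: "l1_norm d z = 1"
  then obtain i where i: "i < d" "z i \<noteq> 0"
    unfolding l1_norm_def by (metis abs_zero lessThan_iff sum.neutral zero_neq_one)
  have eq: "l1_norm d z = \<bar>z i\<bar> + (\<Sum>j\<in>{..<d} - {i}. \<bar>z j\<bar>)"
    unfolding l1_norm_def using i by (subst sum.remove[of _ i]) auto
  moreover have "(\<Sum>j\<in>{..<d} - {i}. \<bar>z j\<bar>) \<ge> 0" by (simp add: sum_nonneg)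
  ultimately have 1: "\<bar>z i\<bar> = 1" "(\<Sum>j\<in>{..<d} - {i}. \<bar>z j\<bar>) = 0"
    using l i(2) by linarith+
  then have "\<forall>j\<in>{..<d} - {i}. \<bar>z j\<bar> = 0"
    by (subst (asm) sum_nonneg_eq_0_iff) auto
  then show "\<exists>i<d. \<bar>z i\<bar> = 1 \<and> (\<forall>j<d. j \<noteq> i \<longrightarrow> z j = 0)"
    using i(1) 1(1) by auto
next
  assume "\<exists>i<d. \<bar>z i\<bar> = 1 \<and> (\<forall>j<d. j \<noteq> i \<longrightarrow> z j = 0)"
  then obtain i where i: "i < d" "\<bar>z i\<bar> = 1" "\<And>j. j < d \<Longrightarrow> j \<noteq> i \<Longrightarrow> z j = 0" by auto
  have "l1_norm d z = \<bar>z i\<bar> + (\<Sum>j\<in>{..<d} - {i}. \<bar>z j\<bar>)"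
    unfolding l1_norm_def using i(1) by (subst sum.remove[of _ i]) auto
  also have "(\<Sum>j\<in>{..<d} - {i}. \<bar>z j\<bar>) = 0" using i(3) by (intro sum.neutral) auto
  finally show "l1_norm d z = 1" using i(2) by simp
qed

lemma adj_iff:
  "adj d x y \<longleftrightarrow> x \<in> lattice_vertices d \<and> (\<exists>i<d. \<exists>s\<in>{1, - 1}. y = x(i := x i + s))"
proof -
  have key: "x \<in> lattice_vertices d \<and> y \<in> lattice_vertices d \<and> l1_norm d (\<lambda>i. x i - y i) = 1 \<longleftrightarrow>
      x \<in> lattice_vertices d \<and> (\<exists>i<d. \<exists>s\<in>{1, - 1}. y = x(i := x i + s))" for x y
  proof
    assume a: "x \<in> lattice_vertices d \<and> y \<in> lattice_vertices d \<and> l1_norm d (\<lambda>i. x i - y i) = 1"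
    then obtain i where i: "i < d" "\<bar>x i - y i\<bar> = 1" "\<And>j. j < d \<Longrightarrow> j \<noteq> i \<Longrightarrow> x j - y j = 0"
      unfolding l1_norm_eq_1_iff by blast
    have "y = x(i := x i + (y i - x i))"
    proof
      fix j show "y j = (x(i := x i + (y i - x i))) j"
        using i(3)[of j] a by (cases "j < d") (auto simp: lattice_vertices_def)
    qed
    moreover have "y i - x i \<in> {1, - 1}" using i(2) by auto
    ultimately show "x \<in> lattice_vertices d \<and> (\<exists>i<d. \<exists>s\<in>{1, - 1}. y = x(i := x i + s))"
      using a i(1) by blast
  next
    assume "x \<in> lattice_vertices d \<and> (\<exists>i<d. \<exists>s\<in>{1, - 1}. y = x(i := x i + s))"
    then show "x \<in> lattice_vertices d \<and> y \<in> lattice_vertices d \<and> l1_norm d (\<lambda>i. x i - y i) = 1"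
      unfolding l1_norm_eq_1_iff by auto
  qed
  have sym: "l1_norm d (\<lambda>i. x i - y i) = l1_norm d (\<lambda>i. y i - x i)" for x y
    unfolding l1_norm_def by (simp add: abs_minus_commute)
  show ?thesis
    unfolding key[symmetric] lattice_edges_def by (auto simp: doubleton_eq_iff sym[of x y])
qed

lemma edgeE:
  assumes "e \<in> lattice_edges d"
  obtains x y where "e = {x, y}" "adj d x y" "x \<in> lattice_vertices d" "y \<in> lattice_vertices d"
proof -
  obtain x y where xy: "e = {x, y}" "x \<in> lattice_vertices d" "y \<in> lattice_vertices d"
    using assms unfolding lattice_edges_def by auto
  then show thesis using that[of x y] assms by simp
qed

lemma adj_sym: "adj d x y \<Longrightarrow> adj d y x"
  by (simp add: insert_commute)

lemma adj_vertices:
  assumes "adj d x y" shows "x \<in> lattice_vertices d" "y \<in> lattice_vertices d"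
  using assms unfolding adj_iff by auto

lemma adj_neq: "adj d x y \<Longrightarrow> x \<noteq> y"
  unfolding adj_iff by (auto simp: fun_eq_iff)

lemma adj_upd: "i < d \<Longrightarrow> x \<in> lattice_vertices d \<Longrightarrow> \<bar>s\<bar> = 1 \<Longrightarrow> adj d x (x(i := x i + s))"
  unfolding adj_iff by (auto simp: abs_if split: if_splits)

lemma adj_axis: "0 < d \<Longrightarrow> adj d (axis_pt j) (axis_pt (j + 1))"
proof -
  assume "0 < d"
  moreover have "axis_pt (j + 1) = (axis_pt j)(0 := axis_pt j 0 + 1)" by (auto simp: axis_pt_def)
  ultimately show ?thesis using adj_upd[of 0 d "axis_pt j" 1] by simp
qed

lemma adj_coord: "adj d x y \<Longrightarrow> \<bar>x j - y j\<bar> \<le> 1"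
  unfolding adj_iff by auto

text \<open>Weaker than sharing an endpoint: opposite edges of a unit square are near as well. With
  this relation any two edges of a unit square are related, which is what the parity argument for
  boundaries requires.\<close>

definition near :: "nat \<Rightarrow> (nat \<Rightarrow> int) set \<Rightarrow> (nat \<Rightarrow> int) set \<Rightarrow> bool" where
  "near d e e' \<longleftrightarrow> (\<exists>u\<in>e. \<exists>v\<in>e'. u = v \<or> adj d u v)"

lemma near_sym: "near d e e' \<Longrightarrow> near d e' e"
  unfolding near_def by (metis adj_sym)

lemma near_refl: "e \<in> lattice_edges d \<Longrightarrow> near d e e"
  unfolding near_def by (erule edgeE) auto

lemma near_shared: "u \<in> e \<Longrightarrow> u \<in> e' \<Longrightarrow> near d e e'"
  unfolding near_def by auto

lemma nbrs_le:
  "finite {y. adj d x y} \<and> card {y. adj d x y} \<le> 2 * d"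
proof -
  have sub: "{y. adj d x y} \<subseteq> (\<lambda>(i, s). x(i := x i + s)) ` ({..<d} \<times> {1, - 1})"
    unfolding adj_iff by force
  have "card ((\<lambda>(i, s). x(i := x i + s)) ` ({..<d} \<times> {1, - 1::int})) \<le> card ({..<d} \<times> {1, - 1::int})"
    by (rule card_image_le) auto
  also have "\<dots> = 2 * d" by (simp add: card_cartesian_product)
  finally show ?thesis
    using card_mono[OF _ sub] finite_subset[OF sub] by force
qed

text \<open>Two choices of an endpoint \<open>u\<close> of the edge, at most
  \<open>2 * d + 1\<close> choices of \<open>v\<close> equal or adjacent to \<open>u\<close>, and at
  most \<open>2 * d\<close> edges at \<open>v\<close>.\<close>

definition near_degree :: "nat \<Rightarrow> nat" where
  "near_degree d = 2 * ((2 * d + 1) * (2 * d))"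

lemma near_le:
  assumes "e \<in> lattice_edges d"
  shows "finite {e' \<in> lattice_edges d. near d e e'} \<and>
    card {e' \<in> lattice_edges d. near d e e'} \<le> near_degree d"
proof -
  obtain x y where e: "e = {x, y}" using edgeE[OF assms] by blast
  let ?C = "\<lambda>u. insert u {v. adj d u v}"
  let ?X = "\<lambda>u. \<Union>v\<in>?C u. (\<lambda>w. {v, w}) ` {w. adj d v w}"
  have fin: "finite (?X u)" for u using nbrs_le by auto
  have crd: "card (?X u) \<le> (2 * d + 1) * (2 * d)" for u
  proof -
    have "card (?X u) \<le> (\<Sum>v\<in>?C u. card ((\<lambda>w. {v, w}) ` {w. adj d v w}))"
      by (rule card_UN_le) (use nbrs_le in auto)
    also have "\<dots> \<le> (\<Sum>v\<in>?C u. 2 * d)"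
      by (intro sum_mono order.trans[OF card_image_le]) (use nbrs_le in auto)
    also have "\<dots> \<le> (2 * d + 1) * (2 * d)"
    proof -
      have "card (?C u) \<le> 2 * d + 1"
        using nbrs_le[of u d] by (metis Suc_eq_plus1 card_insert_if le_SucI not_less_eq_eq)
      then have "card (?C u) * (2 * d) \<le> (2 * d + 1) * (2 * d)" by (rule mult_le_mono1)
      then show ?thesis by simp
    qed
    finally show ?thesis .
  qed
  have sub: "{e' \<in> lattice_edges d. near d e e'} \<subseteq> ?X x \<union> ?X y"
  proof
    fix e' assume a: "e' \<in> {e' \<in> lattice_edges d. near d e e'}"
    then obtain u v where uv: "u \<in> e" "v \<in> e'" "u = v \<or> adj d u v"
      unfolding near_def by auto
    have "e' \<in> lattice_edges d" using a by simp
    then obtain a b where ab: "e' = {a, b}" "adj d a b" by (rule edgeE)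
    obtain w where w: "e' = {v, w}" "adj d v w"
      using ab uv(2) by (metis adj_sym insert_commute insert_iff singletonD)
    have "v \<in> ?C u" using uv(3) by auto
    then have "e' \<in> ?X u" using w by blast
    then show "e' \<in> ?X x \<union> ?X y" using uv(1) e by blast
  qed
  have "card (?X x \<union> ?X y) \<le> near_degree d"
    using card_Un_le[of "?X x" "?X y"] crd[of x] crd[of y] unfolding near_degree_def by linarith
  then show ?thesis
    using card_mono[OF _ sub] finite_subset[OF sub] fin by (meson finite_UnI order.trans)
qed

lemma countable_vertices: "countable (lattice_vertices d)"
proof -
  have "lattice_vertices d \<subseteq> range (\<lambda>xs i. if i < d then xs ! i else 0)"
  proof
    fix x assume "x \<in> lattice_vertices d"
    then have "x = (\<lambda>i. if i < d then map x [0..<d] ! i else 0)"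
      by (auto simp: lattice_vertices_def fun_eq_iff)
    then show "x \<in> range (\<lambda>xs i. if i < d then xs ! i else 0)" by blast
  qed
  moreover have "countable (range (\<lambda>(xs :: int list) i. if i < d then xs ! i else 0))"
    by simp
  ultimately show ?thesis using countable_subset by blast
qed

subsection \<open>Paths\<close>

lemma line_path:
  assumes "i < d" "X \<subseteq> lattice_vertices d" "s \<le> t" "\<And>u. s \<le> u \<Longrightarrow> u \<le> t \<Longrightarrow> x(i := u) \<in> X"
  shows "(x(i := s), x(i := t)) \<in> (restr (adj d) X)\<^sup>*"
  using assms(3,4)
proof (induction t rule: int_ge_induct)
  case (step t)
  have X: "x(i := t) \<in> X" "x(i := t + 1) \<in> X"
    using step.prems[of t] step.prems[of "t + 1"] step.hyps by linarith+
  then have "x(i := t) \<in> lattice_vertices d" using assms(2) by blast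
  from adj_upd[OF assms(1) this, of 1] X have "(x(i := t), x(i := t + 1)) \<in> restr (adj d) X"
    by simp
  moreover have "(x(i := s), x(i := t)) \<in> (restr (adj d) X)\<^sup>*"
    by (rule step.IH) (use step.prems in simp)
  ultimately show ?case by (rule rtrancl_into_rtrancl[rotated])
qed simp

text \<open>Coordinates are changed from \<open>x\<close> to \<open>y\<close> one at a time; all
  intermediate points stay in the box spanned by the two points.\<close>

lemma box_path:
  assumes "x \<in> lattice_vertices d" "y \<in> lattice_vertices d" "X \<subseteq> lattice_vertices d"
    and X: "\<And>z. z \<in> lattice_vertices d \<Longrightarrow> (\<And>i. min (x i) (y i) \<le> z i \<and> z i \<le> max (x i) (y i)) \<Longrightarrow> z \<in> X"
  shows "(x, y) \<in> (restr (adj d) X)\<^sup>*"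
proof -
  let ?z = "\<lambda>m i. if i < m then y i else x i"
  have V: "?z m \<in> lattice_vertices d" for m
    using assms(1,2) by (auto simp: lattice_vertices_def)
  have step: "(x, ?z m) \<in> (restr (adj d) X)\<^sup>*" if "m \<le> d" for m
    using that
  proof (induction m)
    case 0
    then show ?case by simp
  next
    case (Suc m)
    have seg: "(?z m)(m := u) \<in> X" if "min (x m) (y m) \<le> u" "u \<le> max (x m) (y m)" for u
    proof (rule X)
      show "(?z m)(m := u) \<in> lattice_vertices d" using V[of m] Suc.prems by simp
    qed (use that in auto)
    have eq: "?z m = (?z m)(m := x m)" "?z (Suc m) = (?z m)(m := y m)"
      by auto
    have "(?z m, ?z (Suc m)) \<in> (restr (adj d) X)\<^sup>*"
    proof (cases "x m \<le> y m")
      case True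
      then have "((?z m)(m := x m), (?z m)(m := y m)) \<in> (restr (adj d) X)\<^sup>*"
        using Suc.prems seg True by (intro line_path assms(3)) auto
      then show ?thesis using eq by metis
    next
      case False
      then have "((?z m)(m := y m), (?z m)(m := x m)) \<in> (restr (adj d) X)\<^sup>*"
        using Suc.prems seg by (intro line_path assms(3)) auto
      then have "((?z m)(m := x m), (?z m)(m := y m)) \<in> (restr (adj d) X)\<^sup>*"
        by (rule restr_sym[rotated]) (rule adj_sym)
      then show ?thesis using eq by metis
    qed
    moreover have "(x, ?z m) \<in> (restr (adj d) X)\<^sup>*" using Suc by simp
    ultimately show ?case by (rule rtrancl_trans[rotated])
  qed
  have "?z d = y" using assms(1,2) by (auto simp: lattice_vertices_def)
  then show ?thesis using step[of d] by simp
qed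

lemma lattice_connected:
  assumes "x \<in> lattice_vertices d" "y \<in> lattice_vertices d"
  shows "(x, y) \<in> (restr (adj d) (lattice_vertices d))\<^sup>*"
  using assms by (intro box_path) auto

definition outside_box :: "nat \<Rightarrow> int \<Rightarrow> (nat \<Rightarrow> int) set" where
  "outside_box d R = {x \<in> lattice_vertices d. \<exists>i<d. \<bar>x i\<bar> > R}"

text \<open>While one coordinate stays beyond \<open>R\<close>, all others can be moved freely. If a
  coordinate other than 0 is large, coordinate 0 is moved to \<open>R + 1\<close> and then the rest
  to 0. If only coordinate 0 is large, coordinate 1 is first moved to \<open>R + 1\<close>; this
  needs a second dimension.\<close>

lemma outside_connected:
  assumes d: "d \<ge> 2" and "0 \<le> R" and x: "x \<in> outside_box d R"
  shows "(axis_pt (R + 1), x) \<in> (restr (adj d) (outside_box d R))\<^sup>*"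
proof -
  have sub: "outside_box d R \<subseteq> lattice_vertices d" unfolding outside_box_def by auto
  have A: "(x, axis_pt (R + 1)) \<in> (restr (adj d) (outside_box d R))\<^sup>*"
    if x: "x \<in> lattice_vertices d" and i: "i < d" "i \<noteq> 0" "\<bar>x i\<bar> > R" for x i
  proof -
    have "(x, x(0 := R + 1)) \<in> (restr (adj d) (outside_box d R))\<^sup>*"
    proof (rule box_path)
      fix z assume z: "z \<in> lattice_vertices d"
        "\<And>j. min (x j) ((x(0 := R + 1)) j) \<le> z j \<and> z j \<le> max (x j) ((x(0 := R + 1)) j)"
      show "z \<in> outside_box d R" using z(1) z(2)[of i] i unfolding outside_box_def by auto
    qed (use x d sub in auto)
    moreover have "(x(0 := R + 1), axis_pt (R + 1)) \<in> (restr (adj d) (outside_box d R))\<^sup>*"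
    proof (rule box_path)
      fix z assume z: "z \<in> lattice_vertices d"
        "\<And>j. min ((x(0 := R + 1)) j) (axis_pt (R + 1) j) \<le> z j \<and> z j \<le> max ((x(0 := R + 1)) j) (axis_pt (R + 1) j)"
      have "z 0 = R + 1" using z(2)[of 0] by simp
      then show "z \<in> outside_box d R" using z(1) d \<open>0 \<le> R\<close> unfolding outside_box_def
        by (auto intro!: exI[of _ 0])
    qed (use x d sub in auto)
    ultimately show ?thesis by (rule rtrancl_trans)
  qed
  have xV: "x \<in> lattice_vertices d" using x sub by auto
  have "(x, axis_pt (R + 1)) \<in> (restr (adj d) (outside_box d R))\<^sup>*"
  proof (cases "\<exists>i<d. i \<noteq> 0 \<and> \<bar>x i\<bar> > R")
    case True
    then show ?thesis using A xV by blast
  next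
    case False
    then have x0: "\<bar>x 0\<bar> > R" using x unfolding outside_box_def by auto
    have "(x, x(1 := R + 1)) \<in> (restr (adj d) (outside_box d R))\<^sup>*"
    proof (rule box_path)
      fix z assume z: "z \<in> lattice_vertices d"
        "\<And>j. min (x j) ((x(1 := R + 1)) j) \<le> z j \<and> z j \<le> max (x j) ((x(1 := R + 1)) j)"
      show "z \<in> outside_box d R" using z(1) z(2)[of 0] x0 d unfolding outside_box_def
        by (auto intro!: exI[of _ 0])
    qed (use xV d sub in auto)
    moreover have "(x(1 := R + 1), axis_pt (R + 1)) \<in> (restr (adj d) (outside_box d R))\<^sup>*"
      using d \<open>0 \<le> R\<close> xV by (intro A[of _ 1]) auto
    ultimately show ?thesis by (rule rtrancl_trans)
  qed
  then show ?thesis by (rule restr_sym[rotated]) (rule adj_sym)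
qed

lemma finite_box: "finite (lattice_vertices d - outside_box d R)"
proof -
  have "lattice_vertices d - outside_box d R \<subseteq>
      (\<lambda>xs i. if i < d then xs ! i else 0) ` {xs. set xs \<subseteq> {- R..R} \<and> length xs = d}"
  proof
    fix x assume x: "x \<in> lattice_vertices d - outside_box d R"
    then have "x = (\<lambda>i. if i < d then map x [0..<d] ! i else 0)"
      by (auto simp: lattice_vertices_def fun_eq_iff)
    moreover have "set (map x [0..<d]) \<subseteq> {- R..R}"
      using x unfolding outside_box_def by (force simp: abs_le_iff not_less)
    ultimately show "x \<in> (\<lambda>xs i. if i < d then xs ! i else 0) ` {xs. set xs \<subseteq> {- R..R} \<and> length xs = d}"
      by (auto intro!: image_eqI[of _ _ "map x [0..<d]"])
  qed
  then show ?thesis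
    by (rule finite_subset) (auto intro!: finite_imageI finite_lists_length_eq)
qed

lemma finite_imp_bounded:
  assumes "finite A"
  obtains R where "0 \<le> R" "A \<inter> outside_box d R = {}"
proof
  let ?R = "\<Sum>x\<in>A. \<Sum>i<d. \<bar>x i\<bar>"
  show "0 \<le> ?R" by (intro sum_nonneg) auto
  have "\<bar>x i\<bar> \<le> ?R" if "x \<in> A" "i < d" for x i
  proof -
    have "\<bar>x i\<bar> \<le> (\<Sum>i<d. \<bar>x i\<bar>)" using that by (intro member_le_sum) auto
    also have "\<dots> \<le> ?R" using that assms
      by (intro member_le_sum[of x A "\<lambda>x. \<Sum>i<d. \<bar>x i\<bar>"]) (auto intro: sum_nonneg)
    finally show ?thesis .
  qed
  then show "A \<inter> outside_box d ?R = {}" unfolding outside_box_def by force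
qed

subsection \<open>Connectedness of boundaries\<close>

definition bd :: "nat \<Rightarrow> (nat \<Rightarrow> int) set \<Rightarrow> (nat \<Rightarrow> int) set set" where
  "bd d B = {e \<in> lattice_edges d. \<exists>x\<in>e. \<exists>y\<in>e. x \<in> B \<and> y \<notin> B}"

lemma bd_iff: "{x, y} \<in> bd d B \<longleftrightarrow> adj d x y \<and> (x \<in> B) \<noteq> (y \<in> B)"
  unfolding bd_def by auto

lemma bdE:
  assumes "e \<in> bd d B"
  obtains x y where "e = {x, y}" "adj d x y" "x \<in> B" "y \<notin> B"
proof -
  have "e \<in> lattice_edges d" using assms unfolding bd_def by simp
  then obtain x y where xy: "e = {x, y}" "adj d x y" by (rule edgeE)
  then have "(x \<in> B) \<noteq> (y \<in> B)" using assms bd_iff by auto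
  then show thesis using that[of x y] that[of y x] xy by (auto simp: insert_commute)
qed

text \<open>Integration mod 2: the witness is the parity of the number of points between 0 and
  \<open>t\<close> at which \<open>u\<close> holds. For every \<open>t\<close> at least one of the
  two sums is empty.\<close>

lemma int_primitive: "\<exists>v :: int \<Rightarrow> bool. \<forall>t. v (t + 1) \<noteq> v t \<longleftrightarrow> u t"
proof (intro exI allI)
  let ?a = "\<lambda>t. \<Sum>s\<in>{0..<t::int}. of_bool (u s) :: nat"
  let ?b = "\<lambda>t. \<Sum>s\<in>{t..<0::int}. of_bool (u s) :: nat"
  fix t :: int
  show "odd (?a (t + 1) + ?b (t + 1)) \<noteq> odd (?a t + ?b t) \<longleftrightarrow> u t"
  proof (cases "0 \<le> t")
    case True
    then have "{0..<t + 1} = insert t {0..<t}" "{t + 1..<0} = {}" "{t..<0} = {}" by auto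
    then show ?thesis by (auto simp del: sum_of_bool_eq)
  next
    case False
    then have "{t..<0} = insert t {t + 1..<0}" "{0..<t + 1} = {}" "{0..<t} = {}" by auto
    then show ?thesis by (auto simp del: sum_of_bool_eq)
  qed
qed

text \<open>Mod 2, every cocycle on the lattice is a coboundary. The potential is built one direction
  at a time: after correction in the directions below \<open>m\<close>, the values in direction \<open>m\<close> no
  longer depend on the coordinates below \<open>m\<close> and can be integrated along direction \<open>m\<close>.\<close>

lemma cocycle_potential:
  fixes h :: "(nat \<Rightarrow> int) \<Rightarrow> nat \<Rightarrow> bool"
  assumes closed: "\<And>x i j. i < d \<Longrightarrow> j < d \<Longrightarrow> i \<noteq> j \<Longrightarrow>
    (h x i \<noteq> h (x(j := x j + 1)) i) = (h x j \<noteq> h (x(i := x i + 1)) j)"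
  shows "\<exists>g :: (nat \<Rightarrow> int) \<Rightarrow> bool. \<forall>x. \<forall>i<d. (g (x(i := x i + 1)) \<noteq> g x) = h x i"
proof -
  have "m \<le> d \<Longrightarrow> \<exists>g :: (nat \<Rightarrow> int) \<Rightarrow> bool. \<forall>x. \<forall>i<m. (g (x(i := x i + 1)) \<noteq> g x) = h x i" for m
  proof (induction m)
    case 0
    then show ?case by simp
  next
    case (Suc m)
    have "\<exists>g :: (nat \<Rightarrow> int) \<Rightarrow> bool. \<forall>x. \<forall>i<m. (g (x(i := x i + 1)) \<noteq> g x) = h x i"
      by (rule Suc.IH[OF Suc_leD[OF Suc.prems]])
    then obtain g :: "(nat \<Rightarrow> int) \<Rightarrow> bool" where g: "\<And>x i. i < m \<Longrightarrow> (g (x(i := x i + 1)) \<noteq> g x) = h x i" by blast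
    have md: "m < d" using Suc.prems by simp
    \<comment> \<open>The error that \<open>g\<close> leaves in direction \<open>m\<close>.
      Closedness on the squares in directions \<open>i\<close> and \<open>m\<close>, together with
      correctness of \<open>g\<close> in direction \<open>i\<close>, makes it independent of the
      coordinates below \<open>m\<close>.\<close>
    define k where "k x = (h x m \<noteq> (g (x(m := x m + 1)) \<noteq> g x))" for x
    have k_inv: "k (x(i := x i + 1)) = k x" if "i < m" for x i
    proof -
      have tw: "x(i := x i + 1, m := x m + 1) = x(m := x m + 1, i := x i + 1)"
        using that by (auto simp: fun_eq_iff)
      have "(h x i \<noteq> h (x(m := x m + 1)) i) = (h x m \<noteq> h (x(i := x i + 1)) m)"
        using closed[of i m x] that md by simp
      moreover have "(g (x(i := x i + 1)) \<noteq> g x) = h x i" using g that by blast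
      moreover have "(g (x(m := x m + 1, i := x i + 1)) \<noteq> g (x(m := x m + 1))) = h (x(m := x m + 1)) i"
        using g[of i "x(m := x m + 1)"] that by simp
      moreover have "k (x(i := x i + 1)) =
          (h (x(i := x i + 1)) m \<noteq> (g (x(m := x m + 1, i := x i + 1)) \<noteq> g (x(i := x i + 1))))"
        using that tw unfolding k_def by simp
      ultimately show ?thesis unfolding k_def by argo
    qed
    \<comment> \<open>The primitive is chosen as a function of the integrand alone. Parallel lines
      with equal values of \<open>k\<close> thus receive the same primitive, so \<open>G\<close>
      does not disturb the directions already corrected.\<close>
    define I :: "(int \<Rightarrow> bool) \<Rightarrow> int \<Rightarrow> bool"
      where "I u = (SOME v. \<forall>t. v (t + 1) \<noteq> v t \<longleftrightarrow> u t)" for u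
    have I: "I u (t + 1) \<noteq> I u t \<longleftrightarrow> u t" for u t
      using someI_ex[OF int_primitive[of u]] unfolding I_def by blast
    define G where "G x = I (\<lambda>t. k (x(m := t))) (x m)" for x
    have G_m: "(G (x(m := x m + 1)) \<noteq> G x) = k x" for x
      using I[of "\<lambda>t. k (x(m := t))" "x m"] unfolding G_def by simp
    have G_i: "G (x(i := x i + 1)) = G x" if "i < m" for x i
    proof -
      have "k (x(i := x i + 1, m := t)) = k (x(m := t))" for t
        using k_inv[of i "x(m := t)"] that by (simp add: fun_upd_twist)
      then show ?thesis using that unfolding G_def by simp
    qed
    have "((g (x(i := x i + 1)) \<noteq> G (x(i := x i + 1))) \<noteq> (g x \<noteq> G x)) = h x i" if "i < Suc m" for x i
    proof (cases "i = m")
      case True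
      then show ?thesis using G_m[of x] unfolding k_def by blast
    next
      case False
      then show ?thesis using G_i[of i x] g[of i x] that by auto
    qed
    then show ?case by (intro exI[of _ "\<lambda>x. g x \<noteq> G x"]) blast
  qed
  then show ?thesis by blast
qed

text \<open>The argument of Timar: a subset of the boundary that is closed under nearness meets every
  unit square in an even number of edges, so it is the coboundary of a function that is constant on
  both sides.\<close>

theorem boundary_connected:
  assumes inside: "\<And>x y. x \<in> B \<Longrightarrow> y \<in> B \<Longrightarrow> (x, y) \<in> (restr (adj d) B)\<^sup>*"
    and outside: "\<And>x y. x \<in> lattice_vertices d - B \<Longrightarrow> y \<in> lattice_vertices d - B \<Longrightarrow>
      (x, y) \<in> (restr (adj d) (lattice_vertices d - B))\<^sup>*"
    and e: "e \<in> bd d B" "e' \<in> bd d B"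
  shows "(e, e') \<in> (restr (near d) (bd d B))\<^sup>*"
proof -
  define D where "D = {e'. e' \<in> bd d B \<and> (e, e') \<in> (restr (near d) (bd d B))\<^sup>*}"
  have D_near: "b \<in> D" if "a \<in> D" "b \<in> bd d B" "near d a b" for a b
  proof -
    have "(a, b) \<in> restr (near d) (bd d B)" using that unfolding D_def by simp
    moreover have "(e, a) \<in> (restr (near d) (bd d B))\<^sup>*" using that(1) unfolding D_def by simp
    ultimately have "(e, b) \<in> (restr (near d) (bd d B))\<^sup>*" by (rule rtrancl_into_rtrancl[rotated])
    then show ?thesis using that(2) unfolding D_def by simp
  qed
  define h where "h x i \<longleftrightarrow> {x, x(i := x i + 1)} \<in> D" for x and i :: nat
  have closed: "(h x i \<noteq> h (x(j := x j + 1)) i) = (h x j \<noteq> h (x(i := x i + 1)) j)"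
    if ij: "i < d" "j < d" "i \<noteq> j" for x i j
  proof -
    define xi xj y where "xi = x(i := x i + 1)" and "xj = x(j := x j + 1)"
      and "y = x(i := x i + 1, j := x j + 1)"
    have y: "xi(j := xi j + 1) = y" "xj(i := xj i + 1) = y"
      using ij unfolding xi_def xj_def y_def by (auto simp: fun_eq_iff)
    have h: "h x i = ({x, xi} \<in> D)" "h x j = ({x, xj} \<in> D)" "h xj i = ({xj, y} \<in> D)" "h xi j = ({xi, y} \<in> D)"
      unfolding h_def y by (simp_all only: xi_def xj_def)
    have "(({x, xi} \<in> D) \<noteq> ({xj, y} \<in> D)) = (({x, xj} \<in> D) \<noteq> ({xi, y} \<in> D))"
    proof (cases "x \<in> lattice_vertices d")
      case True
      then have V: "xi \<in> lattice_vertices d" "xj \<in> lattice_vertices d"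
        using ij unfolding xi_def xj_def by auto
      have adjs: "adj d x xi" "adj d x xj" "adj d xi y" "adj d xj y"
        using adj_upd[OF ij(1) True, of 1] adj_upd[OF ij(2) True, of 1]
          adj_upd[OF ij(2) V(1), of 1] adj_upd[OF ij(1) V(2), of 1]
        by (simp_all only: y xi_def[symmetric] xj_def[symmetric] abs_one simp_thms)
      \<comment> \<open>The four edges are pairwise near, so \<open>D\<close> contains either none
        of them or all boundary edges among them. Going once around the square, membership in
        \<open>B\<close> changes an even number of times.\<close>
      define Q where "Q = {{x, xi}, {x, xj}, {xi, y}, {xj, y}}"
      have near: "near d a b" if "a \<in> Q" "b \<in> Q" for a b
      proof -
        obtain u where u: "u \<in> a" "u = x \<or> u = y" using \<open>a \<in> Q\<close> unfolding Q_def by blast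
        obtain w where w: "w \<in> b" "w = xi \<or> w = xj" using \<open>b \<in> Q\<close> unfolding Q_def by blast
        have "adj d u w" using u(2) w(2) adjs adj_sym by metis
        then show ?thesis using u w unfolding near_def by blast
      qed
      show ?thesis
      proof (cases "\<exists>a\<in>Q. a \<in> D")
        case True
        then obtain a where "a \<in> Q" "a \<in> D" by blast
        then have "b \<in> D \<longleftrightarrow> b \<in> bd d B" if "b \<in> Q" for b
          using D_near near that unfolding D_def by blast
        then have "{x, xi} \<in> D \<longleftrightarrow> (x \<in> B) \<noteq> (xi \<in> B)" "{x, xj} \<in> D \<longleftrightarrow> (x \<in> B) \<noteq> (xj \<in> B)"
          "{xi, y} \<in> D \<longleftrightarrow> (xi \<in> B) \<noteq> (y \<in> B)" "{xj, y} \<in> D \<longleftrightarrow> (xj \<in> B) \<noteq> (y \<in> B)"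
          using adjs unfolding Q_def by (simp_all add: bd_iff)
        then show ?thesis by argo
      next
        case False
        then have "{x, xi} \<notin> D" "{x, xj} \<notin> D" "{xi, y} \<notin> D" "{xj, y} \<notin> D" unfolding Q_def by blast+
        then show ?thesis by simp
      qed
    next
      case False
      then have V: "xi \<notin> lattice_vertices d" "xj \<notin> lattice_vertices d"
        using ij unfolding xi_def xj_def by auto
      have "{a, b} \<notin> D" if "a \<notin> lattice_vertices d" for a b
        using that adj_vertices(1)[of a b d] unfolding D_def bd_def by blast
      then show ?thesis using False V by blast
    qed
    then show ?thesis unfolding xi_def[symmetric] xj_def[symmetric] h .
  qed
  have "\<exists>g :: (nat \<Rightarrow> int) \<Rightarrow> bool. \<forall>x. \<forall>i<d. (g (x(i := x i + 1)) \<noteq> g x) = h x i"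
    by (rule cocycle_potential) (rule closed)
  then obtain g :: "(nat \<Rightarrow> int) \<Rightarrow> bool"
    where g: "\<And>x i. i < d \<Longrightarrow> g (x(i := x i + 1)) \<noteq> g x \<longleftrightarrow> h x i" by blast
  have g_edge: "g x \<noteq> g y \<longleftrightarrow> {x, y} \<in> D" if xy: "adj d x y" for x y
  proof -
    obtain i s where st: "i < d" "s \<in> {1, - 1}" "y = x(i := x i + s)"
      using xy unfolding adj_iff by blast
    show ?thesis
    proof (cases "s = 1")
      case True
      then show ?thesis using g[OF st(1), of x] by (auto simp: h_def st(3))
    next
      case False
      then have "y(i := y i + 1) = x" using st by (auto simp: fun_eq_iff)
      then have "g x \<noteq> g y \<longleftrightarrow> {y, x} \<in> D" using g[OF st(1), of y] unfolding h_def by simp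
      then show ?thesis by (simp add: insert_commute)
    qed
  qed
  \<comment> \<open>No edge of \<open>D\<close> has both ends in \<open>B\<close> or both ends
    outside, so \<open>g\<close> is constant on each side. The edge \<open>e\<close> shows that the
    two constants differ, and then every boundary edge must belong to \<open>D\<close>.\<close>
  have const: "g x = g y" if "(x, y) \<in> (restr (adj d) X)\<^sup>*" "X = B \<or> X = lattice_vertices d - B" for x y X
    using that(1)
  proof (induction rule: rtrancl_induct)
    case (step y z)
    then have "adj d y z" "(y \<in> B) = (z \<in> B)" using that(2) by auto
    then have "{y, z} \<notin> D" unfolding D_def by (simp add: bd_iff)
    then show ?case using step.IH g_edge[OF \<open>adj d y z\<close>] by metis
  qed simp
  obtain p q where pq: "e = {p, q}" "adj d p q" "p \<in> B" "q \<notin> B" using e(1) by (rule bdE)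
  obtain p' q' where pq': "e' = {p', q'}" "adj d p' q'" "p' \<in> B" "q' \<notin> B" using e(2) by (rule bdE)
  have "e \<in> D" unfolding D_def using e by simp
  then have "g p \<noteq> g q" using g_edge[OF pq(2)] pq(1) by blast
  moreover have "g p = g p'" using const[OF inside[OF pq(3) pq'(3)]] by simp
  moreover have "q \<in> lattice_vertices d - B" "q' \<in> lattice_vertices d - B"
    using pq pq' adj_vertices(2)[OF pq(2)] adj_vertices(2)[OF pq'(2)] by simp_all
  then have "g q = g q'" by (intro const[OF outside]) simp_all
  ultimately have "g p' \<noteq> g q'" by metis
  then have "e' \<in> D" using g_edge[OF pq'(2)] pq'(1) by blast
  then show ?thesis unfolding D_def by simp
qed

section \<open>Boundaries of components of a complement\<close>

definition component :: "nat \<Rightarrow> (nat \<Rightarrow> int) set \<Rightarrow> (nat \<Rightarrow> int) \<Rightarrow> (nat \<Rightarrow> int) set" where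
  "component d A y = {v. (y, v) \<in> (restr (adj d) (lattice_vertices d - A))\<^sup>*}"

lemma component_self: "y \<in> component d A y"
  unfolding component_def by simp

lemma component_step:
  assumes "u \<in> component d A y" "adj d u v" "u \<notin> A" "v \<notin> A"
  shows "v \<in> component d A y"
proof -
  have "(u, v) \<in> restr (adj d) (lattice_vertices d - A)"
    using assms adj_vertices[OF assms(2)] by auto
  moreover have "(y, u) \<in> (restr (adj d) (lattice_vertices d - A))\<^sup>*"
    using assms(1) unfolding component_def by simp
  ultimately have "(y, v) \<in> (restr (adj d) (lattice_vertices d - A))\<^sup>*"
    by (rule rtrancl_into_rtrancl[rotated])
  then show ?thesis unfolding component_def by simp
qed

lemma component_sub:
  assumes "y \<in> lattice_vertices d - A"
  shows "component d A y \<subseteq> lattice_vertices d - A"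
proof
  fix v assume "v \<in> component d A y"
  then have "(y, v) \<in> (restr (adj d) (lattice_vertices d - A))\<^sup>*" unfolding component_def by simp
  then show "v \<in> lattice_vertices d - A"
    by (cases rule: rtranclE) (use assms in auto)
qed

lemma component_path:
  assumes "v \<in> component d A y" "(v, w) \<in> (restr (adj d) X)\<^sup>*" "X \<inter> A = {}"
  shows "w \<in> component d A y"
  using assms(2)
proof (induction rule: rtrancl_induct)
  case base
  then show ?case using assms by simp
next
  case (step u w)
  then show ?case using component_step[of u d A y w] assms(3) by blast
qed

text \<open>A step out of the component that avoided \<open>A\<close> would remain in the component,
  so every boundary edge joins it to \<open>A\<close>.\<close>

lemma component_bdE:
  assumes "y \<in> lattice_vertices d - A" "e \<in> bd d (component d A y)"
  obtains a b where "e = {a, b}" "adj d a b" "a \<in> A" "b \<in> component d A y" "b \<notin> A"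
proof -
  obtain b a where ba: "e = {b, a}" "adj d b a" "b \<in> component d A y" "a \<notin> component d A y"
    using assms(2) by (rule bdE)
  then have "b \<notin> A" using component_sub[OF assms(1)] by blast
  then have "a \<in> A" using component_step[of b d A y a] ba by blast
  then show thesis using that[of a b] ba \<open>b \<notin> A\<close> adj_sym by (simp add: insert_commute)
qed

text \<open>The complement of the component is connected too: from a vertex outside the component
  follow any lattice path towards \<open>a0\<close>. Until it meets \<open>A\<close> it cannot enter
  the component, and from \<open>A\<close> on it can be replaced by a path inside
  \<open>A\<close>.\<close>

lemma component_boundary_connected:
  assumes y: "y \<in> lattice_vertices d - A" and A: "A \<subseteq> lattice_vertices d" "a0 \<in> A"
    and conn: "\<And>a. a \<in> A \<Longrightarrow> (a0, a) \<in> (restr (adj d) A)\<^sup>*"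
    and e: "e \<in> bd d (component d A y)" "e' \<in> bd d (component d A y)"
  shows "(e, e') \<in> (restr (near d) (bd d (component d A y)))\<^sup>*"
proof (rule boundary_connected)
  let ?B = "component d A y"
  have AB: "A \<subseteq> lattice_vertices d - ?B" using component_sub[OF y] A by auto
  have toy: "(y, u) \<in> (restr (adj d) ?B)\<^sup>*" if "u \<in> ?B" for u
  proof -
    have "(y, u) \<in> (restr (adj d) (lattice_vertices d - A))\<^sup>*" using that unfolding component_def by simp
    then show ?thesis
    proof (induction rule: rtrancl_induct)
      case (step u v)
      then have "u \<in> ?B" unfolding component_def by simp
      moreover have "v \<in> ?B" using step \<open>u \<in> ?B\<close> component_step by auto
      ultimately have "(u, v) \<in> restr (adj d) ?B" using step by auto
      then show ?case using step.IH by (rule rtrancl_into_rtrancl[rotated])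
    qed simp
  qed
  show "(x, z) \<in> (restr (adj d) ?B)\<^sup>*" if "x \<in> ?B" "z \<in> ?B" for x z
    using restr_sym[OF adj_sym toy[OF that(1)]] toy[OF that(2)] by (rule rtrancl_trans)
  have toA: "(x, a0) \<in> (restr (adj d) (lattice_vertices d - ?B))\<^sup>*" if "x \<in> lattice_vertices d - ?B" for x
  proof -
    have "(x, a0) \<in> (restr (adj d) (lattice_vertices d))\<^sup>*"
      using that A by (intro lattice_connected) auto
    then show ?thesis using that
    proof (induction rule: converse_rtrancl_induct)
      case (step u v)
      show ?case
      proof (cases "u \<in> A")
        case True
        have "(u, a0) \<in> (restr (adj d) A)\<^sup>*"
          by (rule restr_sym[OF adj_sym conn[OF True]])
        then show ?thesis by (rule restr_mono[OF AB])
      next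
        case False
        have uv: "adj d v u" "v \<in> lattice_vertices d" using step.hyps(1) adj_sym by auto
        have "v \<notin> ?B"
        proof
          assume "v \<in> ?B"
          moreover then have "v \<notin> A" using component_sub[OF y] by blast
          ultimately show False using component_step[OF _ uv(1)] False step.prems by blast
        qed
        then have "(u, v) \<in> restr (adj d) (lattice_vertices d - ?B)"
          using step.prems step.hyps uv by auto
        moreover have "(v, a0) \<in> (restr (adj d) (lattice_vertices d - ?B))\<^sup>*"
          using step.IH \<open>v \<notin> ?B\<close> uv(2) by blast
        ultimately show ?thesis by (rule converse_rtrancl_into_rtrancl)
      qed
    qed simp
  qed
  show "(x, z) \<in> (restr (adj d) (lattice_vertices d - ?B))\<^sup>*"
    if "x \<in> lattice_vertices d - ?B" "z \<in> lattice_vertices d - ?B" for x z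
    using toA[OF that(1)] restr_sym[OF adj_sym toA[OF that(2)]] by (rule rtrancl_trans)
qed (fact e)+

subsection \<open>The percolation measure\<close>

lemma product_prob_space_bernoulli:
  "product_prob_space (\<lambda>_ :: 'i. measure_pmf (bernoulli_pmf p))"
  by (intro product_prob_spaceI measure_pmf.prob_space_axioms)

lemma prob_space_percolation: "prob_space (percolation d p)"
  unfolding percolation_def by (intro prob_space_PiM measure_pmf.prob_space_axioms)

lemma space_percolation: "space (percolation d p) = lattice_edges d \<rightarrow>\<^sub>E UNIV"
  unfolding percolation_def by (simp add: space_PiM)

lemma measurable_coord [measurable]:
  assumes "e \<in> lattice_edges d"
  shows "Measurable.pred (percolation d p) (\<lambda>\<omega>. \<omega> e)"
proof -
  have "(\<lambda>\<omega>. \<omega> e) \<in> measurable (percolation d p) (measure_pmf (bernoulli_pmf p))"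
    unfolding percolation_def by (rule measurable_component_singleton[OF assms])
  then show ?thesis by simp
qed

lemma sets_cylinder [measurable]:
  assumes "finite T" "T \<subseteq> lattice_edges d"
  shows "{\<omega> \<in> space (percolation d p). \<forall>e\<in>T. \<omega> e = c e} \<in> sets (percolation d p)"
proof -
  have "{\<omega> \<in> space (percolation d p). \<omega> e = c e} \<in> sets (percolation d p)" if "e \<in> T" for e
  proof -
    have [measurable]: "Measurable.pred (percolation d p) (\<lambda>\<omega>. \<omega> e)"
      using that assms(2) by (intro measurable_coord) auto
    show ?thesis by measurable
  qed
  then show ?thesis using assms(1) by (rule sets.sets_Collect_finite_All)
qed

lemma measure_cylinder:
  assumes "finite T" "T \<subseteq> lattice_edges d"
  shows "measure (percolation d p) {\<omega> \<in> space (percolation d p). \<forall>e\<in>T. \<omega> e = c e} =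
    (\<Prod>e\<in>T. pmf (bernoulli_pmf p) (c e))"
proof -
  interpret product_prob_space "\<lambda>_. measure_pmf (bernoulli_pmf p)" "lattice_edges d"
    by (rule product_prob_space_bernoulli)
  have "emeasure (percolation d p) {\<omega> \<in> space (percolation d p). \<forall>e\<in>T. \<omega> e \<in> {c e}} =
    (\<Prod>e\<in>T. emeasure (measure_pmf (bernoulli_pmf p)) {c e})"
    unfolding percolation_def by (rule emeasure_PiM_Collect) (use assms in auto)
  also have "\<dots> = ennreal (\<Prod>e\<in>T. pmf (bernoulli_pmf p) (c e))"
    by (simp add: emeasure_pmf_single prod_ennreal)
  finally show ?thesis by (simp add: measure_def prod_nonneg)
qed

lemma measure_cylinder_const:
  assumes "finite T" "T \<subseteq> lattice_edges d"
  shows "measure (percolation d p) {\<omega> \<in> space (percolation d p). \<forall>e\<in>T. \<omega> e = b} =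
    pmf (bernoulli_pmf p) b ^ card T"
  using measure_cylinder[OF assms, of p "\<lambda>_. b"] by simp

lemma empty_not_edge: "{} \<notin> lattice_edges d"
  unfolding lattice_edges_def by auto

lemma measurable_relabel:
  assumes "\<psi> ` lattice_edges d \<subseteq> lattice_edges d"
  shows "(\<lambda>\<omega>. \<lambda>e\<in>lattice_edges d. \<omega> (\<psi> e)) \<in> measurable (percolation d p) (percolation d p)"
  unfolding percolation_def
  by (intro measurable_restrict measurable_component_singleton) (use assms in auto)

text \<open>The relabelled configuration together with the state of one further edge is again a family
  of independent edges; the empty set serves as the index of that further edge.\<close>

lemma measure_relabel_indep:
  assumes \<psi>: "inj_on \<psi> (lattice_edges d)" "\<psi> ` lattice_edges d \<subseteq> lattice_edges d"
    and f: "f \<in> lattice_edges d - \<psi> ` lattice_edges d" and A: "A \<in> sets (percolation d p)"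
  shows "measure (percolation d p)
      {\<omega> \<in> space (percolation d p). (\<lambda>e\<in>lattice_edges d. \<omega> (\<psi> e)) \<in> A \<and> \<omega> f = b} =
    pmf (bernoulli_pmf p) b * measure (percolation d p) A"
proof -
  let ?E = "lattice_edges d" let ?K = "insert {} ?E"
  let ?B = "measure_pmf (bernoulli_pmf p)"
  let ?M = "\<lambda>_ :: (nat \<Rightarrow> int) set. ?B"
  let ?P = "percolation d p" let ?Q = "Pi\<^sub>M ?K ?M"
  define \<phi> where "\<phi> = \<psi>({} := f)"
  define W where "W = {\<omega> \<in> space ?Q. restrict \<omega> ?E \<in> A \<and> \<omega> {} = b}"
  interpret P: prob_space ?P by (rule prob_space_percolation)
  have r [measurable]: "(\<lambda>\<omega>. restrict \<omega> ?E) \<in> measurable ?Q ?P"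
    unfolding percolation_def by (rule measurable_restrict_subset) auto
  have c [measurable]: "Measurable.pred ?Q (\<lambda>\<omega>. \<omega> {})"
  proof -
    have "(\<lambda>\<omega>. \<omega> {}) \<in> measurable ?Q ?B" by (rule measurable_component_singleton) auto
    then show ?thesis by simp
  qed
  have W: "W \<in> sets ?Q" unfolding W_def using A by measurable
  \<comment> \<open>\<open>?Q\<close> is obtained from the percolation measure in two ways: by
    reindexing along \<open>\<phi>\<close>, and by adjoining one independent coin. Evaluating
    \<open>W\<close> both ways gives the two sides of the claim.\<close>
  have 1: "distr ?P ?Q (\<lambda>\<omega>. \<lambda>n\<in>?K. \<omega> (\<phi> n)) = ?Q"
    unfolding percolation_def
  proof (rule distr_PiM_reindex)
    have "inj_on \<phi> ?E" "\<phi> ` ?E = \<psi> ` ?E"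
      using \<psi>(1) empty_not_edge unfolding \<phi>_def by (auto simp: inj_on_def)
    then show "inj_on \<phi> ?K" using f empty_not_edge unfolding inj_on_insert by (auto simp: \<phi>_def)
    show "\<phi> \<in> ?K \<rightarrow> ?E" using \<psi>(2) f by (auto simp: \<phi>_def)
  qed (rule measure_pmf.prob_space_axioms)
  have 2: "distr (?B \<Otimes>\<^sub>M ?P) ?Q (\<lambda>(x, X). X({} := x)) = ?Q"
    unfolding percolation_def by (rule distr_pair_PiM_eq_PiM) (rule measure_pmf.prob_space_axioms)+
  have m1: "(\<lambda>\<omega>. \<lambda>n\<in>?K. \<omega> (\<phi> n)) \<in> measurable ?P ?Q"
    unfolding percolation_def
    by (intro measurable_restrict measurable_component_singleton) (use \<psi>(2) f in \<open>auto simp: \<phi>_def\<close>)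
  have m2: "(\<lambda>(x, X). X({} := x)) \<in> measurable (?B \<Otimes>\<^sub>M ?P) ?Q"
    unfolding percolation_def by measurable
  have "emeasure ?Q W = emeasure (distr ?P ?Q (\<lambda>\<omega>. \<lambda>n\<in>?K. \<omega> (\<phi> n))) W"
    using 1 by simp
  also have "\<dots> = emeasure ?P ((\<lambda>\<omega>. \<lambda>n\<in>?K. \<omega> (\<phi> n)) -` W \<inter> space ?P)"
    by (rule emeasure_distr[OF m1 W])
  also have "(\<lambda>\<omega>. \<lambda>n\<in>?K. \<omega> (\<phi> n)) -` W \<inter> space ?P =
      {\<omega> \<in> space ?P. (\<lambda>e\<in>?E. \<omega> (\<psi> e)) \<in> A \<and> \<omega> f = b}"
  proof -
    have "restrict (\<lambda>n\<in>?K. \<omega> (\<phi> n)) ?E = (\<lambda>e\<in>?E. \<omega> (\<psi> e))" "(\<lambda>n\<in>?K. \<omega> (\<phi> n)) {} = \<omega> f" for \<omega> :: configuration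
      using empty_not_edge by (auto simp: \<phi>_def fun_eq_iff restrict_def)
    moreover have "(\<lambda>n\<in>?K. \<omega> (\<phi> n)) \<in> space ?Q" for \<omega> :: configuration
      by (simp add: space_PiM)
    ultimately show ?thesis unfolding W_def by auto
  qed
  finally have e1: "emeasure ?Q W = emeasure ?P {\<omega> \<in> space ?P. (\<lambda>e\<in>?E. \<omega> (\<psi> e)) \<in> A \<and> \<omega> f = b}" .
  have "emeasure ?Q W = emeasure (distr (?B \<Otimes>\<^sub>M ?P) ?Q (\<lambda>(x, X). X({} := x))) W"
    using 2 by simp
  also have "\<dots> = emeasure (?B \<Otimes>\<^sub>M ?P) ((\<lambda>(x, X). X({} := x)) -` W \<inter> space (?B \<Otimes>\<^sub>M ?P))"
    by (rule emeasure_distr[OF m2 W])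
  also have "(\<lambda>(x, X). X({} := x)) -` W \<inter> space (?B \<Otimes>\<^sub>M ?P) = {b} \<times> A"
  proof -
    have "X({} := x) \<in> W \<longleftrightarrow> x = b \<and> X \<in> A" if "X \<in> space ?P" for x X
    proof -
      have "restrict (X({} := x)) ?E = X"
        using that empty_not_edge unfolding space_percolation by (auto simp: fun_eq_iff PiE_def extensional_def)
      moreover have "X({} := x) \<in> space ?Q"
        using that unfolding space_percolation by (auto simp: space_PiM PiE_def extensional_def)
      ultimately show ?thesis unfolding W_def by auto
    qed
    then show ?thesis using sets.sets_into_space[OF A] by (auto simp: space_pair_measure)
  qed
  also have "emeasure (?B \<Otimes>\<^sub>M ?P) ({b} \<times> A) = emeasure ?B {b} * emeasure ?P A"
    using A by (intro P.emeasure_pair_measure_Times) auto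
  finally have "emeasure ?P {\<omega> \<in> space ?P. (\<lambda>e\<in>?E. \<omega> (\<psi> e)) \<in> A \<and> \<omega> f = b} = emeasure ?B {b} * emeasure ?P A"
    using e1 by simp
  then show ?thesis
    by (simp add: measure_def enn2real_mult emeasure_pmf_single)
qed

text \<open>The extra edge \<open>f z\<close> varies with the relabelled configuration, but only
  through the index \<open>z\<close> of the piece \<open>T z\<close> that contains it. On each piece
  the edge is fixed and independent, and the disjoint pieces add up to at most
  \<open>U\<close>.\<close>

lemma measure_contraction_le:
  fixes Z :: "'z set" and b :: bool
  assumes \<psi>: "inj_on \<psi> (lattice_edges d)" "\<psi> ` lattice_edges d \<subseteq> lattice_edges d"
    and f: "\<And>z. z \<in> Z \<Longrightarrow> f z \<in> lattice_edges d - \<psi> ` lattice_edges d"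
    and Z: "countable Z" "disjoint_family_on T Z" "\<And>z. z \<in> Z \<Longrightarrow> T z \<in> sets (percolation d p)"
    and U: "U \<in> sets (percolation d p)" "(\<Union>z\<in>Z. T z) \<subseteq> U"
  defines "S \<equiv> {\<omega> \<in> space (percolation d p).
    \<exists>z\<in>Z. (\<lambda>e\<in>lattice_edges d. \<omega> (\<psi> e)) \<in> T z \<and> \<omega> (f z) = b}"
  shows "S \<in> sets (percolation d p) \<and>
    measure (percolation d p) S \<le> pmf (bernoulli_pmf p) b * measure (percolation d p) U"
proof -
  let ?P = "percolation d p"
  interpret P: prob_space ?P by (rule prob_space_percolation)
  define S' where "S' z = {\<omega> \<in> space ?P. (\<lambda>e\<in>lattice_edges d. \<omega> (\<psi> e)) \<in> T z \<and> \<omega> (f z) = b}" for z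
  have S: "S = (\<Union>z\<in>Z. S' z)" unfolding S_def S'_def by auto
  have S': "S' z \<in> sets ?P" if z: "z \<in> Z" for z
  proof -
    have "(\<lambda>\<omega>. \<lambda>e\<in>lattice_edges d. \<omega> (\<psi> e)) -` T z \<inter> space ?P \<in> sets ?P"
      using measurable_relabel[OF \<psi>(2)] Z(3)[OF z] by (rule measurable_sets)
    moreover have "{\<omega> \<in> space ?P. \<forall>e\<in>{f z}. \<omega> e = b} \<in> sets ?P"
      using f[OF z] by (intro sets_cylinder) auto
    moreover have "S' z = ((\<lambda>\<omega>. \<lambda>e\<in>lattice_edges d. \<omega> (\<psi> e)) -` T z \<inter> space ?P) \<inter>
        {\<omega> \<in> space ?P. \<forall>e\<in>{f z}. \<omega> e = b}"
      unfolding S'_def by auto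
    ultimately show ?thesis by simp
  qed
  have eq: "emeasure ?P (S' z) = ennreal (pmf (bernoulli_pmf p) b) * emeasure ?P (T z)" if z: "z \<in> Z" for z
    using measure_relabel_indep[OF \<psi> f[OF z] Z(3)[OF z]] unfolding S'_def
    by (simp add: P.emeasure_eq_measure ennreal_mult)
  have SS: "S \<in> sets ?P" unfolding S by (rule sets.countable_UN'[OF Z(1)]) (use S' in auto)
  have "disjoint_family_on S' Z"
    using Z(2) unfolding disjoint_family_on_def S'_def by blast
  then have "emeasure ?P S = (\<integral>\<^sup>+ z. emeasure ?P (S' z) \<partial>count_space Z)"
    unfolding S using S' Z(1) by (intro emeasure_UN_countable) auto
  also have "\<dots> = (\<integral>\<^sup>+ z. ennreal (pmf (bernoulli_pmf p) b) * emeasure ?P (T z) \<partial>count_space Z)"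
    by (intro nn_integral_cong) (simp add: eq)
  also have "\<dots> = ennreal (pmf (bernoulli_pmf p) b) * (\<integral>\<^sup>+ z. emeasure ?P (T z) \<partial>count_space Z)"
    by (rule nn_integral_cmult) simp
  also have "(\<integral>\<^sup>+ z. emeasure ?P (T z) \<partial>count_space Z) = emeasure ?P (\<Union>z\<in>Z. T z)"
    using Z by (intro emeasure_UN_countable[symmetric]) auto
  also have "\<dots> \<le> emeasure ?P U"
    using U by (intro emeasure_mono)
  finally have "emeasure ?P S \<le> ennreal (pmf (bernoulli_pmf p) b) * emeasure ?P U"
    by (simp add: mult_left_mono)
  then have "measure ?P S \<le> pmf (bernoulli_pmf p) b * measure ?P U"
    by (simp add: P.emeasure_eq_measure flip: ennreal_mult)
  with SS show ?thesis by blast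
qed

subsection \<open>Counting connected sets of edges\<close>

abbreviation root_edge :: "(nat \<Rightarrow> int) set" where
  "root_edge \<equiv> {axis_pt 0, axis_pt 1}"

text \<open>The set is anchored at \<open>root_edge\<close> so that there are finitely many
  candidates. Edges in the likely state are allowed, because connectedness may need them, but only
  in bounded proportion to the \<open>c\<close> edges that make the event improbable.\<close>

definition edge_animal :: "nat \<Rightarrow> bool \<Rightarrow> nat \<Rightarrow> configuration \<Rightarrow> bool" where
  "edge_animal d b c \<omega> \<longleftrightarrow> (\<exists>S. finite S \<and> S \<subseteq> lattice_edges d \<and> root_edge \<in> S \<and>
     (\<forall>e\<in>S. (root_edge, e) \<in> (restr (near d) S)\<^sup>*) \<and> card S \<le> 4 * c \<and> c \<le> card {e \<in> S. \<omega> e = b})"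

text \<open>A set of at most \<open>4 * c\<close> edges has a covering walk with fewer than
  \<open>8 * c\<close> entries: at most \<open>near_degree d\<close> choices for each step, and at
  most \<open>2 ^ (8 * c)\<close> choices for the subset of edges in state \<open>b\<close>.\<close>

definition animal_const :: "nat \<Rightarrow> real" where
  "animal_const d = (2 * real (near_degree d)) ^ 8"

lemma animal_const_ge_1: "d \<ge> 1 \<Longrightarrow> animal_const d \<ge> 1"
  unfolding animal_const_def near_degree_def
proof (rule one_le_power)
  assume "d \<ge> 1"
  then have "1 \<le> (2 * d + 1) * (2 * d)" by (simp add: Suc_leI)
  then have "real 1 \<le> real (2 * (2 * ((2 * d + 1) * (2 * d))))" by (subst of_nat_le_iff) linarith
  then show "1 \<le> 2 * real (2 * ((2 * d + 1) * (2 * d)))" by simp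
qed

text \<open>Union bound over pairs of a padded walk and a set of exactly \<open>c\<close> of its
  edges, each contributing a cylinder. The union serves as a measurable superset, so that
  measurability of the animal event itself is never at issue.\<close>

lemma edge_animal_prob:
  assumes "c \<ge> 1" "d \<ge> 1"
  obtains U where "U \<in> sets (percolation d p)"
    "{\<omega> \<in> space (percolation d p). edge_animal d b c \<omega>} \<subseteq> U"
    "measure (percolation d p) U \<le> (animal_const d * pmf (bernoulli_pmf p) b) ^ c"
proof -
  let ?P = "percolation d p" and ?\<pi> = "pmf (bernoulli_pmf p) b" and ?D = "near_degree d"
  interpret P: prob_space ?P by (rule prob_space_percolation)
  have r: "root_edge \<in> lattice_edges d" using adj_axis[of d 0] assms(2) by simp
  define W where "W = {w. length w = Suc (8 * c - 1) \<and> hd w = root_edge \<and>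
    set w \<subseteq> lattice_edges d \<and> successively (near d) w}"
  have W: "finite W" "card W \<le> ?D ^ (8 * c - 1)"
    using card_walks[of "lattice_edges d" "near d" ?D root_edge "8 * c - 1"] near_le r
    unfolding W_def by auto
  define Y where "Y w = {T. T \<subseteq> set w \<and> card T = c}" for w :: "(nat \<Rightarrow> int) set list"
  define I where "I = (SIGMA w:W. Y w)"
  define C where "C T = {\<omega> \<in> space ?P. \<forall>e\<in>T. \<omega> e = b}" for T
  have Y: "finite (Y w)" "card (Y w) \<le> 2 ^ (8 * c)" if "w \<in> W" for w
  proof -
    have sub: "Y w \<subseteq> Pow (set w)" unfolding Y_def by auto
    then show "finite (Y w)" by (rule finite_subset) simp
    have "card (Y w) \<le> 2 ^ card (set w)"
      using card_mono[OF _ sub] by (simp add: card_Pow)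
    also have "\<dots> \<le> 2 ^ (8 * c)"
      using that card_length[of w] assms(1) unfolding W_def by (intro power_increasing) auto
    finally show "card (Y w) \<le> 2 ^ (8 * c)" .
  qed
  have I: "finite I" "card I \<le> ?D ^ (8 * c - 1) * 2 ^ (8 * c)"
  proof -
    show "finite I" unfolding I_def using W(1) Y(1) by auto
    have "card I = (\<Sum>w\<in>W. card (Y w))" unfolding I_def using W(1) Y(1) by (intro card_SigmaI) auto
    also have "\<dots> \<le> card W * 2 ^ (8 * c)" using sum_bounded_above[of W "\<lambda>w. card (Y w)"] Y(2) by simp
    also have "\<dots> \<le> ?D ^ (8 * c - 1) * 2 ^ (8 * c)" using W(2) by (rule mult_le_mono1)
    finally show "card I \<le> ?D ^ (8 * c - 1) * 2 ^ (8 * c)" .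
  qed
  have TE: "T \<subseteq> lattice_edges d" "finite T" "card T = c" if "(w, T) \<in> I" for w T
    using that unfolding I_def W_def Y_def by (auto intro: finite_subset[of T "set w"])
  have CT: "C T \<in> sets ?P" "measure ?P (C T) = ?\<pi> ^ c" if "(w, T) \<in> I" for w T
    using TE[OF that] sets_cylinder[of T d p "\<lambda>_. b"] measure_cylinder_const[of T d p b] unfolding C_def by auto
  define U where "U = (\<Union>i\<in>I. C (snd i))"
  have U: "U \<in> sets ?P"
    unfolding U_def using I(1) CT(1) by (intro sets.finite_UN) auto
  have D1: "1 \<le> ?D" using assms(2) unfolding near_degree_def by simp
  have "measure ?P U \<le> (\<Sum>i\<in>I. measure ?P (C (snd i)))"
    unfolding U_def using I(1) CT(1) by (intro measure_UNION_le) auto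
  also have "\<dots> = (\<Sum>i\<in>I. ?\<pi> ^ c)"
    using CT(2) by (intro sum.cong) auto
  also have "\<dots> = card I * ?\<pi> ^ c" by simp
  also have "\<dots> \<le> real (?D ^ (8 * c) * 2 ^ (8 * c)) * ?\<pi> ^ c"
  proof (intro mult_right_mono)
    have "?D ^ (8 * c - 1) \<le> ?D ^ (8 * c)" using D1 by (intro power_increasing) auto
    then have "card I \<le> ?D ^ (8 * c) * 2 ^ (8 * c)"
      using I(2) by (meson mult_le_mono1 order.trans)
    then show "real (card I) \<le> real (?D ^ (8 * c) * 2 ^ (8 * c))" by (rule of_nat_mono)
  qed simp
  also have "\<dots> = (2 * real ?D) ^ (8 * c) * ?\<pi> ^ c"
    by (simp add: power_mult_distrib)
  also have "\<dots> = (animal_const d * ?\<pi>) ^ c"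
    unfolding animal_const_def by (simp only: power_mult power_mult_distrib[of "(2 * real ?D) ^ 8"])
  finally have mU: "measure ?P U \<le> (animal_const d * ?\<pi>) ^ c" .
  have "{\<omega> \<in> space ?P. edge_animal d b c \<omega>} \<subseteq> U"
  proof
    fix \<omega> assume "\<omega> \<in> {\<omega> \<in> space ?P. edge_animal d b c \<omega>}"
    then obtain S where \<omega>: "\<omega> \<in> space ?P" and S: "finite S" "S \<subseteq> lattice_edges d" "root_edge \<in> S"
      "\<forall>e\<in>S. (root_edge, e) \<in> (restr (near d) S)\<^sup>*" "card S \<le> 4 * c" "c \<le> card {e \<in> S. \<omega> e = b}"
      unfolding edge_animal_def by auto
    obtain v where v: "successively (near d) v" "v \<noteq> []" "hd v = root_edge" "set v = S"
        "length v + 1 = 2 * card S"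
      by (rule covering_walk[of S root_edge "near d"]) (use S near_sym in blast)+
    have "length v \<le> 8 * c" using v(5) S(5) by linarith
    then obtain w where w: "successively (near d) w" "hd w = root_edge" "set w = S" "length w = 8 * c"
      by (rule pad_walk[OF v(1-3)]) (use v(4) S(2) near_refl in blast)+
    have "w \<in> W" using w S(2) assms(1) unfolding W_def by auto
    obtain T where T: "T \<subseteq> {e \<in> S. \<omega> e = b}" "card T = c"
      using S(6) by (meson obtain_subset_with_card_n)
    have "(w, T) \<in> I" using \<open>w \<in> W\<close> T w(3) unfolding I_def Y_def by auto
    moreover have "\<omega> \<in> C T" using T \<omega> unfolding C_def by auto
    ultimately show "\<omega> \<in> U" unfolding U_def by force
  qed
  then show thesis using that U mU by blast
qed

text \<open>The size of the animal is only bounded from below. Summing over all sizes gives a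
  geometric series of ratio at most 1/2, which costs the factor 2.\<close>

lemma large_edge_animal_prob:
  assumes "N \<ge> 1" "d \<ge> 1" and small: "animal_const d * pmf (bernoulli_pmf p) b \<le> 1 / 2"
  obtains U where "U \<in> sets (percolation d p)"
    "\<And>\<omega> c. \<omega> \<in> space (percolation d p) \<Longrightarrow> c \<ge> N \<Longrightarrow> edge_animal d b c \<omega> \<Longrightarrow> \<omega> \<in> U"
    "measure (percolation d p) U \<le> 2 * (animal_const d * pmf (bernoulli_pmf p) b) ^ N"
proof -
  let ?P = "percolation d p" and ?x = "animal_const d * pmf (bernoulli_pmf p) b"
  interpret P: prob_space ?P by (rule prob_space_percolation)
  have x: "0 \<le> ?x" unfolding animal_const_def by simp
  have "\<exists>U. U \<in> sets ?P \<and> {\<omega> \<in> space ?P. edge_animal d b (N + c) \<omega>} \<subseteq> U \<and> measure ?P U \<le> ?x ^ (N + c)" for c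
    by (rule edge_animal_prob[where c = "N + c" and d = d and p = p and b = b]) (use assms(1,2) in auto)
  then have "\<exists>U. \<forall>c. U c \<in> sets ?P \<and> {\<omega> \<in> space ?P. edge_animal d b (N + c) \<omega>} \<subseteq> U c \<and>
      measure ?P (U c) \<le> ?x ^ (N + c)"
    by (intro choice) blast
  then obtain U where U: "\<And>c. U c \<in> sets ?P" "\<And>c. {\<omega> \<in> space ?P. edge_animal d b (N + c) \<omega>} \<subseteq> U c"
      "\<And>c. measure ?P (U c) \<le> ?x ^ (N + c)" by blast
  have geo: "(\<lambda>c. ?x ^ (N + c)) sums (?x ^ N * (1 / (1 - ?x)))"
    unfolding power_add using small x by (intro sums_mult geometric_sums) simp
  have sm: "summable (\<lambda>c. measure ?P (U c))"
    by (rule summable_comparison_test[OF _ sums_summable[OF geo]]) (use U(3) in auto)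
  have "measure ?P (\<Union>c. U c) \<le> (\<Sum>c. measure ?P (U c))"
    using U(1) sm by (intro P.finite_measure_subadditive_countably) auto
  also have "\<dots> \<le> (\<Sum>c. ?x ^ (N + c))"
    by (rule suminf_le[OF U(3) sm sums_summable[OF geo]])
  also have "\<dots> = ?x ^ N * (1 / (1 - ?x))" using geo by (rule sums_unique[symmetric])
  also have "\<dots> \<le> ?x ^ N * 2"
  proof (rule mult_left_mono)
    show "1 / (1 - ?x) \<le> 2" using small by (simp add: field_simps)
    show "0 \<le> ?x ^ N" using x by (rule zero_le_power)
  qed
  finally have "measure ?P (\<Union>c. U c) \<le> 2 * ?x ^ N" by simp
  moreover have "(\<Union>c. U c) \<in> sets ?P" using U(1) by auto
  moreover have "\<omega> \<in> (\<Union>c. U c)" if "\<omega> \<in> space ?P" "c \<ge> N" "edge_animal d b c \<omega>" for \<omega> c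
    using U(2)[of "c - N"] that by auto
  ultimately show thesis using that by blast
qed

text \<open>Integrate the number of \<open>k\<close> with \<omega> in \<open>D k\<close>: on
  \<open>T - U\<close> twice this number is at least \<open>n + 1\<close>, while its expectation is
  at most \<open>(n + 1) * a\<close>. The factors \<open>n + 1\<close> cancel, so averaging over
  many layers costs only a factor 2.\<close>

lemma (in prob_space) markov_counting:
  fixes D :: "nat \<Rightarrow> 'a set"
  assumes "T \<in> events" "U \<in> events" and D: "\<And>k. k \<le> n \<Longrightarrow> D k \<in> events" "\<And>k. k \<le> n \<Longrightarrow> prob (D k) \<le> a"
    and cover: "\<And>\<omega>. \<omega> \<in> T \<Longrightarrow> \<omega> \<in> U \<or> n + 1 \<le> 2 * card {k. k \<le> n \<and> \<omega> \<in> D k}"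
  shows "prob T \<le> 2 * a + prob U"
proof -
  have TU: "T - U \<in> events" using assms by auto
  have "(real n + 1) * prob (T - U) = (\<integral>\<omega>. (real n + 1) * indicat_real (T - U) \<omega> \<partial>M)"
    using TU by simp
  also have "\<dots> \<le> (\<integral>\<omega>. 2 * (\<Sum>k\<le>n. indicat_real (D k) \<omega>) \<partial>M)"
  proof (rule integral_mono)
    show "integrable M (\<lambda>\<omega>. (real n + 1) * indicat_real (T - U) \<omega>)"
      using TU by (intro integrable_mult_right integrable_real_indicator) (auto simp: emeasure_eq_measure)
    show "integrable M (\<lambda>\<omega>. 2 * (\<Sum>k\<le>n. indicat_real (D k) \<omega>))" 
      using D(1) by (intro integrable_mult_right Bochner_Integration.integrable_sum integrable_real_indicator)
        (auto simp: emeasure_eq_measure)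
    fix \<omega>
    have "(\<Sum>k\<le>n. indicat_real (D k) \<omega>) = card {k. k \<le> n \<and> \<omega> \<in> D k}"
    proof -
      have "(\<Sum>k\<le>n. indicat_real (D k) \<omega>) = (\<Sum>k\<in>{k. k \<le> n \<and> \<omega> \<in> D k}. 1)"
        by (rule sum.mono_neutral_cong_right) (auto simp: indicator_def)
      then show ?thesis by simp
    qed
    then show "(real n + 1) * indicat_real (T - U) \<omega> \<le> 2 * (\<Sum>k\<le>n. indicat_real (D k) \<omega>)"
      using cover[of \<omega>] by (auto simp: indicator_def)
  qed
  also have "\<dots> = 2 * (\<Sum>k\<le>n. \<integral>\<omega>. indicat_real (D k) \<omega> \<partial>M)"
    using D(1) by (subst integral_mult_right_zero, subst Bochner_Integration.integral_sum)
      (auto intro!: integrable_real_indicator simp: emeasure_eq_measure)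
  also have "\<dots> = 2 * (\<Sum>k\<le>n. prob (D k))"
    using D(1) by simp
  also have "\<dots> \<le> 2 * (\<Sum>k\<le>n. a)"
    using D(2) by (intro mult_left_mono sum_mono) auto
  also have "\<dots> = (real n + 1) * (2 * a)" by simp
  finally have "(real n + 1) * prob (T - U) \<le> (real n + 1) * (2 * a)" .
  then have "prob (T - U) \<le> 2 * a" by (rule mult_left_le_imp_le) simp
  moreover have "prob T \<le> prob ((T - U) \<union> U)" using assms TU by (intro finite_measure_mono) auto
  moreover have "\<dots> \<le> prob (T - U) + prob U" using assms TU by (intro measure_Un_le) auto
  ultimately show ?thesis by linarith
qed

subsection \<open>Clusters and their measurability\<close>

lemma sets_rtrancl:
  assumes V: "countable V" "\<And>\<omega>. \<omega> \<in> space M \<Longrightarrow> R \<omega> \<subseteq> V \<times> V"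
    and R: "\<And>x y. {\<omega> \<in> space M. (x, y) \<in> R \<omega>} \<in> sets M"
  shows "{\<omega> \<in> space M. (x, y) \<in> (R \<omega>)\<^sup>*} \<in> sets M"
proof -
  have pow: "{\<omega> \<in> space M. (x, y) \<in> R \<omega> ^^ n} \<in> sets M" for n y
  proof (induction n arbitrary: y)
    case 0
    then show ?case by simp
  next
    case (Suc n)
    have "{\<omega> \<in> space M. (x, y) \<in> R \<omega> ^^ Suc n} =
        (\<Union>z\<in>V. {\<omega> \<in> space M. (x, z) \<in> R \<omega> ^^ n} \<inter> {\<omega> \<in> space M. (z, y) \<in> R \<omega>})"
      using V(2) by (auto simp: relcomp_unfold)
    also have "\<dots> \<in> sets M" using V(1) Suc.IH R by (intro sets.countable_UN') auto
    finally show ?case .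
  qed
  have "{\<omega> \<in> space M. (x, y) \<in> (R \<omega>)\<^sup>*} = (\<Union>n. {\<omega> \<in> space M. (x, y) \<in> R \<omega> ^^ n})"
    by (auto simp: rtrancl_is_UN_relpow)
  also have "\<dots> \<in> sets M" using pow by blast
  finally show ?thesis .
qed

lemma open_adj_iff: "(x, y) \<in> open_adjacency d \<omega> \<longleftrightarrow> adj d x y \<and> \<omega> {x, y}"
  unfolding open_adjacency_def by simp

lemma open_adj_sub: "open_adjacency d \<omega> \<subseteq> lattice_vertices d \<times> lattice_vertices d"
  using adj_vertices unfolding open_adjacency_def by blast

text \<open>Contraction of layer \<open>k\<close> does not touch this half-space, so what it
  connects to the origin can be recovered from the contracted configuration.\<close>

definition left_adjacency :: "nat \<Rightarrow> int \<Rightarrow> configuration \<Rightarrow> ((nat \<Rightarrow> int) \<times> (nat \<Rightarrow> int)) set" where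
  "left_adjacency d k \<omega> = {(x, y) \<in> open_adjacency d \<omega>. x 0 \<le> k \<and> y 0 \<le> k}"

lemma sets_open_adj: "{\<omega> \<in> space (percolation d p). (x, y) \<in> open_adjacency d \<omega>} \<in> sets (percolation d p)"
proof (cases "adj d x y")
  case True
  have [measurable]: "Measurable.pred (percolation d p) (\<lambda>\<omega>. \<omega> {x, y})"
    by (rule measurable_coord[OF True])
  have "{\<omega> \<in> space (percolation d p). (x, y) \<in> open_adjacency d \<omega>} = {\<omega> \<in> space (percolation d p). \<omega> {x, y}}"
    using True by (simp add: open_adj_iff)
  also have "\<dots> \<in> sets (percolation d p)" by measurable
  finally show ?thesis .
qed (simp add: open_adj_iff)

lemma sets_connected:
  "{\<omega> \<in> space (percolation d p). (x, y) \<in> (open_adjacency d \<omega>)\<^sup>*} \<in> sets (percolation d p)"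
  by (rule sets_rtrancl[OF countable_vertices open_adj_sub sets_open_adj])

lemma sets_left_connected:
  "{\<omega> \<in> space (percolation d p). (x, y) \<in> (left_adjacency d k \<omega>)\<^sup>*} \<in> sets (percolation d p)"
proof (rule sets_rtrancl[OF countable_vertices])
  show "left_adjacency d k \<omega> \<subseteq> lattice_vertices d \<times> lattice_vertices d" for \<omega>
    using open_adj_sub unfolding left_adjacency_def by blast
  show "{\<omega> \<in> space (percolation d p). (x, y) \<in> left_adjacency d k \<omega>} \<in> sets (percolation d p)" for x y
    using sets_open_adj[of d p x y] by (cases "x 0 \<le> k \<and> y 0 \<le> k") (auto simp: left_adjacency_def)
qed

definition cluster :: "nat \<Rightarrow> configuration \<Rightarrow> (nat \<Rightarrow> int) set" where
  "cluster d \<omega> = {y. (axis_pt 0, y) \<in> (open_adjacency d \<omega>)\<^sup>*}"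

lemma axis_0_cluster: "axis_pt 0 \<in> cluster d \<omega>"
  unfolding cluster_def by simp

lemma cluster_step: "x \<in> cluster d \<omega> \<Longrightarrow> adj d x y \<Longrightarrow> \<omega> {x, y} \<Longrightarrow> y \<in> cluster d \<omega>"
proof -
  assume "x \<in> cluster d \<omega>" "adj d x y" "\<omega> {x, y}"
  then have "(axis_pt 0, x) \<in> (open_adjacency d \<omega>)\<^sup>*" "(x, y) \<in> open_adjacency d \<omega>"
    by (simp_all add: cluster_def open_adj_iff)
  then have "(axis_pt 0, y) \<in> (open_adjacency d \<omega>)\<^sup>*" by (rule rtrancl_into_rtrancl)
  then show ?thesis by (simp add: cluster_def)
qed

lemma cluster_induct [consumes 1, case_names base step]:
  assumes "y \<in> cluster d \<omega>" "Q (axis_pt 0)"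
    "\<And>y z. y \<in> cluster d \<omega> \<Longrightarrow> adj d y z \<Longrightarrow> \<omega> {y, z} \<Longrightarrow> z \<in> cluster d \<omega> \<Longrightarrow> Q y \<Longrightarrow> Q z"
  shows "Q y"
proof -
  have "(axis_pt 0, y) \<in> (open_adjacency d \<omega>)\<^sup>*" using assms(1) by (simp add: cluster_def)
  then show ?thesis
  proof (induction rule: rtrancl_induct)
    case base
    then show ?case by (rule assms(2))
  next
    case (step y z)
    then have y: "y \<in> cluster d \<omega>" and yz: "adj d y z" "\<omega> {y, z}"
      by (simp_all add: cluster_def open_adj_iff)
    show ?case using y yz cluster_step[OF y yz] step.IH by (rule assms(3))
  qed
qed

lemma cluster_sub: "0 < d \<Longrightarrow> cluster d \<omega> \<subseteq> lattice_vertices d"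
proof
  fix y assume "0 < d" "y \<in> cluster d \<omega>"
  from this(2) show "y \<in> lattice_vertices d"
  proof (induction rule: cluster_induct)
    case base
    show ?case by (rule axis_in_vertices[OF \<open>0 < d\<close>])
  next
    case (step y z)
    show ?case by (rule adj_vertices(2)[OF step.hyps(2)])
  qed
qed

lemma cluster_exit:
  assumes "w \<in> cluster d \<omega>" "axis_pt 0 \<in> X" "w \<notin> X"
  obtains y z where "y \<in> X" "z \<notin> X" "y \<in> cluster d \<omega>" "z \<in> cluster d \<omega>" "adj d y z" "\<omega> {y, z}"
proof -
  have "(axis_pt 0, w) \<in> (open_adjacency d \<omega>)\<^sup>*" using assms(1) by (simp add: cluster_def)
  then obtain y z where "(axis_pt 0, y) \<in> (open_adjacency d \<omega>)\<^sup>*" "(y, z) \<in> open_adjacency d \<omega>" "y \<in> X" "z \<notin> X"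
    using assms(2,3) by (rule rtrancl_exit)
  then show thesis using that[of y z] cluster_step[of y d \<omega> z] by (simp add: cluster_def open_adj_iff)
qed

lemma cluster_connected:
  assumes "y \<in> cluster d \<omega>" shows "(axis_pt 0, y) \<in> (restr (adj d) (cluster d \<omega>))\<^sup>*"
  using assms
proof (induction rule: cluster_induct)
  case (step y z)
  then have "(y, z) \<in> restr (adj d) (cluster d \<omega>)" by simp
  with step.IH show ?case by (rule rtrancl_into_rtrancl)
qed simp

lemma cluster_layer:
  assumes "y \<in> cluster d \<omega>" "0 \<le> j" "j \<le> y 0"
  obtains w where "w \<in> cluster d \<omega>" "w 0 = j"
proof -
  have "\<forall>j. 0 \<le> j \<and> j \<le> y 0 \<longrightarrow> (\<exists>w\<in>cluster d \<omega>. w 0 = j)"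
    using assms(1)
  proof (induction rule: cluster_induct)
    case base
    have "axis_pt 0 0 = 0" by simp
    then show ?case using axis_0_cluster by (metis order_antisym)
  next
    case (step y z)
    show ?case
    proof (intro allI impI)
      fix j assume j: "0 \<le> j \<and> j \<le> z 0"
      show "\<exists>w\<in>cluster d \<omega>. w 0 = j"
      proof (cases "j \<le> y 0")
        case False
        then have "j = z 0" using adj_coord[OF step.hyps(2), of 0] j by auto
        then show ?thesis using step.hyps(4) by auto
      qed (use step.IH j in auto)
    qed
  qed
  then show thesis using that assms by blast
qed

lemma origin_eq: "origin = axis_pt 0" and axis_point_eq: "axis_point n = axis_pt (int n)"
  by (auto simp: origin_def axis_point_def axis_pt_def)

lemma connection_event_iff:
  "connection_event d p origin (axis_point n) = {\<omega> \<in> space (percolation d p). axis_pt (int n) \<in> cluster d \<omega>}"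
  unfolding connection_event_def open_connected_def cluster_def origin_eq axis_point_eq by simp

lemma sets_connection_event: "connection_event d p origin (axis_point n) \<in> sets (percolation d p)"
  unfolding connection_event_iff cluster_def using sets_connected[of d p "axis_pt 0" "axis_pt (int n)"] by simp

lemma finite_cluster_event_iff:
  "0 < d \<Longrightarrow> finite_cluster_event d p = {\<omega> \<in> space (percolation d p). finite (cluster d \<omega>)}"
proof -
  assume "0 < d"
  have "{y \<in> lattice_vertices d. open_connected d \<omega> origin y} = cluster d \<omega>" for \<omega>
    using cluster_sub[OF \<open>0 < d\<close>, of \<omega>] unfolding open_connected_def cluster_def origin_eq by auto
  then show ?thesis unfolding finite_cluster_event_def by simp
qed

lemma sets_cluster_eq:
  assumes "0 < d"
  shows "{\<omega> \<in> space (percolation d p). cluster d \<omega> = A} \<in> sets (percolation d p)"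
proof (cases "A \<subseteq> lattice_vertices d")
  case True
  have "{\<omega> \<in> space (percolation d p). cluster d \<omega> = A} = space (percolation d p) -
    (\<Union>y\<in>lattice_vertices d. {\<omega> \<in> space (percolation d p). ((axis_pt 0, y) \<in> (open_adjacency d \<omega>)\<^sup>*) = (y \<notin> A)})"
    using True cluster_sub[OF assms] unfolding cluster_def by blast
  also have "\<dots> \<in> sets (percolation d p)"
  proof (intro sets.compl_sets sets.countable_UN'[OF countable_vertices] image_subsetI)
    show "{\<omega> \<in> space (percolation d p). ((axis_pt 0, y) \<in> (open_adjacency d \<omega>)\<^sup>*) = (y \<notin> A)} \<in> sets (percolation d p)" for y
      using sets.compl_sets[OF sets_connected[of d p "axis_pt 0" y]] sets_connected[of d p "axis_pt 0" y]
      by (cases "y \<in> A") (auto simp: set_diff_eq)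
  qed
  finally show ?thesis .
next
  case False
  then have "{\<omega> \<in> space (percolation d p). cluster d \<omega> = A} = {}" using cluster_sub[OF assms] by blast
  then show ?thesis by (simp only: sets.empty_sets)
qed

lemma sets_finite_cluster_event:
  assumes "0 < d"
  shows "finite_cluster_event d p \<in> sets (percolation d p)"
proof -
  have "finite_cluster_event d p = (\<Union>A\<in>{A. finite A \<and> A \<subseteq> lattice_vertices d}.
      {\<omega> \<in> space (percolation d p). cluster d \<omega> = A})"
    using cluster_sub[OF assms] unfolding finite_cluster_event_iff[OF assms] by auto
  also have "\<dots> \<in> sets (percolation d p)"
    using countable_Collect_finite_subset[OF countable_vertices] sets_cluster_eq[OF assms]
    by (intro sets.countable_UN') auto
  finally show ?thesis .
qed

subsection \<open>Contracting a layer\<close>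

definition up :: "(nat \<Rightarrow> int) \<Rightarrow> nat \<Rightarrow> int" where
  "up x = x(0 := x 0 + 1)"

definition down :: "(nat \<Rightarrow> int) \<Rightarrow> nat \<Rightarrow> int" where
  "down x = x(0 := x 0 - 1)"

definition collapse :: "int \<Rightarrow> (nat \<Rightarrow> int) \<Rightarrow> nat \<Rightarrow> int" where
  "collapse k x = (if x 0 \<le> k then x else down x)"

text \<open>The map goes from edges of the contracted lattice back to their originals, so that
  contraction is a relabelling by an injection. A vertical edge between layers k and k + 1 comes
  from the one between k + 1 and k + 2.\<close>

definition expand :: "int \<Rightarrow> (nat \<Rightarrow> int) set \<Rightarrow> (nat \<Rightarrow> int) set" where
  "expand k e = (if \<forall>v\<in>e. v 0 \<le> k then e else up ` e)"

definition contract :: "nat \<Rightarrow> int \<Rightarrow> configuration \<Rightarrow> configuration" where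
  "contract d k \<omega> = (\<lambda>e\<in>lattice_edges d. \<omega> (expand k e))"

lemma up_0 [simp]: "up x 0 = x 0 + 1" and down_0 [simp]: "down x 0 = x 0 - 1"
  by (simp_all add: up_def down_def)

lemma up_down [simp]: "up (down x) = x" and down_up [simp]: "down (up x) = x"
  by (simp_all add: up_def down_def)

lemma up_inject [simp]: "up x = up y \<longleftrightarrow> x = y"
  by (metis down_up)

lemma down_axis [simp]: "down (axis_pt j) = axis_pt (j - 1)"
  by (auto simp: down_def axis_pt_def)

lemma adj_up:
  assumes "0 < d" "adj d x y" shows "adj d (up x) (up y)"
proof -
  obtain i s where i: "i < d" "s \<in> {1, - 1}" "y = x(i := x i + s)" using assms(2) unfolding adj_iff by blast
  then have "up y = (up x)(i := up x i + s)" by (auto simp: up_def fun_eq_iff)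
  moreover have "up x \<in> lattice_vertices d" using assms adj_vertices(1)[OF assms(2)] by (simp add: up_def)
  ultimately show ?thesis using i(1,2) unfolding adj_iff by blast
qed

lemma adj_down:
  assumes "0 < d" "adj d x y" shows "adj d (down x) (down y)"
proof -
  obtain i s where i: "i < d" "s \<in> {1, - 1}" "y = x(i := x i + s)" using assms(2) unfolding adj_iff by blast
  then have "down y = (down x)(i := down x i + s)" by (auto simp: down_def fun_eq_iff)
  moreover have "down x \<in> lattice_vertices d" using assms adj_vertices(1)[OF assms(2)] by (simp add: down_def)
  ultimately show ?thesis using i(1,2) unfolding adj_iff by blast
qed

lemma adj_self_up: "0 < d \<Longrightarrow> x \<in> lattice_vertices d \<Longrightarrow> adj d x (up x)"
  using adj_upd[of 0 d x 1] by (simp add: up_def)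

lemma adj_next_layer: "adj d x y \<Longrightarrow> y 0 = x 0 + 1 \<Longrightarrow> y = up x"
  unfolding adj_iff up_def by (auto split: if_splits)

lemma expand_edge: "0 < d \<Longrightarrow> e \<in> lattice_edges d \<Longrightarrow> expand k e \<in> lattice_edges d"
proof -
  assume "0 < d" "e \<in> lattice_edges d"
  from this(2) obtain x y where "e = {x, y}" "adj d x y" by (rule edgeE)
  then show ?thesis using adj_up[OF \<open>0 < d\<close>] unfolding expand_def by simp
qed

lemma inj_expand: "inj_on (expand k) (lattice_edges d)"
proof (rule inj_onI)
  fix e e' assume "expand k e = expand k e'"
  moreover have "up ` a \<noteq> b" if "\<not> (\<forall>v\<in>a. v 0 \<le> k)" "\<forall>v\<in>b. v 0 \<le> k" for a b
    using that by force
  moreover have "inj up" by (auto simp: inj_on_def)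
  ultimately show "e = e'"
    unfolding expand_def by (metis inj_image_eq_iff)
qed

text \<open>An edge in the image either lies entirely at or below layer \<open>k\<close> or has been
  shifted and reaches layer \<open>k + 2\<close> at least; its highest layer is never
  \<open>k + 1\<close>.\<close>

lemma not_in_expand:
  assumes "\<forall>v\<in>f. v 0 \<le> k + 1" "\<exists>v\<in>f. v 0 = k + 1"
  shows "f \<notin> expand k ` lattice_edges d"
proof
  assume "f \<in> expand k ` lattice_edges d"
  then obtain e where e: "f = expand k e" by auto
  show False
    using assms unfolding e expand_def by (auto split: if_splits)
qed

text \<open>The only edges with one end on each side of the cut are vertical, and their ends
  collapse to the same vertex. All other edges outside layer \<open>k + 1\<close> survive with their
  state.\<close>

lemma contract_open:
  assumes "0 < d" "adj d y w" "\<not> (y 0 = k + 1 \<and> w 0 = k + 1)" "collapse k y \<noteq> collapse k w"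
  shows "adj d (collapse k y) (collapse k w) \<and> contract d k \<omega> {collapse k y, collapse k w} = \<omega> {y, w}"
proof -
  have diff: "\<bar>y 0 - w 0\<bar> \<le> 1" using adj_coord[OF assms(2)] .
  have "y 0 \<le> k \<longleftrightarrow> w 0 \<le> k"
  proof (rule ccontr)
    assume "(y 0 \<le> k) \<noteq> (w 0 \<le> k)"
    then consider "y 0 = k" "w 0 = k + 1" | "w 0 = k" "y 0 = k + 1" using diff by linarith
    then show False
    proof cases
      case 1
      then have "w = up y" using adj_next_layer[OF assms(2)] by simp
      then show False using assms(4) 1 unfolding collapse_def by simp
    next
      case 2
      then have "y = up w" using adj_next_layer[OF adj_sym[OF assms(2)]] by simp
      then show False using assms(4) 2 unfolding collapse_def by simp
    qed
  qed
  then consider "y 0 \<le> k" "w 0 \<le> k" | "y 0 > k" "w 0 > k" by linarith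
  then show ?thesis
  proof cases
    case 1
    then show ?thesis using assms(2) unfolding collapse_def contract_def expand_def by simp
  next
    case 2
    then have nk: "\<not> (\<forall>v\<in>{down y, down w}. v 0 \<le> k)" using assms(3) by auto
    have "expand k {down y, down w} = up ` {down y, down w}" unfolding expand_def by (rule if_not_P[OF nk])
    then have "expand k {down y, down w} = {y, w}" by simp
    then show ?thesis
      using 2 adj_down[OF assms(1,2)] unfolding collapse_def contract_def by simp
  qed
qed

lemma contract_lift:
  assumes "0 < d" "adj d a b" "contract d k \<omega> {a, b}"
  obtains y w where "adj d y w" "\<omega> {y, w}" "collapse k y = a" "collapse k w = b" "\<not> (y 0 = k + 1 \<and> w 0 = k + 1)"
proof (cases "a 0 \<le> k \<and> b 0 \<le> k")
  case True
  then show thesis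
    using that[of a b] assms unfolding contract_def expand_def collapse_def by simp
next
  case False
  then have "expand k {a, b} = {up a, up b}" unfolding expand_def by auto
  moreover have "a 0 \<ge> k" "b 0 \<ge> k" using False adj_coord[OF assms(2), of 0] by auto
  ultimately show thesis
    using that[of "up a" "up b"] False assms adj_up[OF assms(1,2)]
    unfolding contract_def collapse_def by auto
qed

lemma contract_space: "contract d k \<omega> \<in> space (percolation d p)"
  unfolding space_percolation contract_def by simp

lemma collapse_axis: "k \<le> j \<Longrightarrow> collapse k (axis_pt (j + 1)) = axis_pt j" "0 \<le> k \<Longrightarrow> collapse k (axis_pt 0) = axis_pt 0"
  unfolding collapse_def by auto

subsection \<open>Small \<open>p\<close>\<close>

lemma left_adj_iff:
  "(x, y) \<in> left_adjacency d k \<omega> \<longleftrightarrow> adj d x y \<and> \<omega> {x, y} \<and> x 0 \<le> k \<and> y 0 \<le> k"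
  unfolding left_adjacency_def by (auto simp: open_adj_iff)

lemma left_adj_contract: "left_adjacency d k (contract d k \<omega>) = left_adjacency d k \<omega>"
  by (auto simp: left_adj_iff contract_def expand_def)

lemma left_adj_cluster: "(axis_pt 0, y) \<in> (left_adjacency d k \<omega>)\<^sup>* \<Longrightarrow> y \<in> cluster d \<omega>"
proof -
  assume "(axis_pt 0, y) \<in> (left_adjacency d k \<omega>)\<^sup>*"
  moreover have "left_adjacency d k \<omega> \<subseteq> open_adjacency d \<omega>" unfolding left_adjacency_def by auto
  ultimately show ?thesis unfolding cluster_def using rtrancl_mono by blast
qed

text \<open>The cluster can pass from layer \<open>k\<close> to layer \<open>k + 1\<close> only
  through \<open>u\<close>, so the vertical edge at \<open>u\<close> is open. Since \<open>v\<close>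
  is the only cluster vertex in layer \<open>k + 1\<close>, no open cluster edge lies inside that
  layer, and the part to the right survives contraction. The last conclusion recovers
  \<open>u\<close>, and with it the extra edge, from the contracted configuration.\<close>

lemma contract_singleton_layers:
  assumes d: "0 < d" and k: "0 \<le> k" "k \<le> n" and x: "axis_pt (n + 1) \<in> cluster d \<omega>"
    and u: "\<And>y. y \<in> cluster d \<omega> \<Longrightarrow> y 0 = k \<Longrightarrow> y = u"
    and v: "\<And>y. y \<in> cluster d \<omega> \<Longrightarrow> y 0 = k + 1 \<Longrightarrow> y = v"
  shows "axis_pt n \<in> cluster d (contract d k \<omega>)" and "\<omega> {u, up u}" and "u 0 = k" "u \<in> lattice_vertices d"
    and "\<And>y. y 0 = k \<Longrightarrow> (axis_pt 0, y) \<in> (left_adjacency d k (contract d k \<omega>))\<^sup>* \<longleftrightarrow> y = u"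
proof -
  let ?L = "(left_adjacency d k \<omega>)\<^sup>*"
  \<comment> \<open>Open edges to the right of the cut without those inside layer
    \<open>k + 1\<close>: the ones that contraction keeps.\<close>
  define Rt where "Rt = {(x, y). adj d x y \<and> \<omega> {x, y} \<and> x 0 \<ge> k + 1 \<and> y 0 \<ge> k + 1 \<and>
    \<not> (x 0 = k + 1 \<and> y 0 = k + 1)}"
  \<comment> \<open>Either the path has never crossed, or \<open>u\<close> was reached from the left
    and the crossing edge is open. After a return to the left nothing needs to be remembered,
    because the next crossing leads to \<open>up u\<close> again.\<close>
  have key: "(y 0 \<le> k \<and> (axis_pt 0, y) \<in> ?L) \<or>
    ((axis_pt 0, u) \<in> ?L \<and> u 0 = k \<and> \<omega> {u, up u} \<and> (y 0 \<ge> k + 1 \<longrightarrow> (up u, y) \<in> Rt\<^sup>*))"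
    if "y \<in> cluster d \<omega>" for y
    using that
  proof (induction rule: cluster_induct)
    case base
    then show ?case using k by simp
  next
    case (step y w)
    have cross: "y = u \<and> w = up u" if "y 0 = k" "w 0 = k + 1"
      using u[OF step.hyps(1)] adj_next_layer[OF step.hyps(2)] that by simp
    have close: "\<bar>y 0 - w 0\<bar> \<le> 1" using adj_coord[OF step.hyps(2)] .
    from step.IH show ?case
    proof
      assume L: "y 0 \<le> k \<and> (axis_pt 0, y) \<in> ?L"
      show ?case
      proof (cases "w 0 \<le> k")
        case True
        then have "(y, w) \<in> left_adjacency d k \<omega>" using step.hyps L by (simp add: left_adj_iff)
        then have "(axis_pt 0, w) \<in> ?L" using L by (meson rtrancl_into_rtrancl)
        then show ?thesis using True by blast
      next
        case False
        then have "y 0 = k" "w 0 = k + 1" using close L by linarith+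
        then show ?thesis using cross L step.hyps(3) by auto
      qed
    next
      assume R: "(axis_pt 0, u) \<in> ?L \<and> u 0 = k \<and> \<omega> {u, up u} \<and> (y 0 \<ge> k + 1 \<longrightarrow> (up u, y) \<in> Rt\<^sup>*)"
      show ?case
      proof (cases "w 0 \<ge> k + 1 \<and> y 0 \<ge> k + 1")
        case True
        have "\<not> (y 0 = k + 1 \<and> w 0 = k + 1)"
          using v[OF step.hyps(1)] v[OF step.hyps(4)] adj_neq[OF step.hyps(2)] by blast
        then have "(y, w) \<in> Rt" using True step.hyps unfolding Rt_def by simp
        then have "(up u, w) \<in> Rt\<^sup>*" using R True by (meson rtrancl_into_rtrancl)
        then show ?thesis using R by blast
      next
        case False
        show ?thesis
        proof (cases "w 0 \<ge> k + 1")
          case True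
          then have "y 0 = k" "w 0 = k + 1" using False close by linarith+
          then have "w = up u" using cross by blast
          then show ?thesis using R by blast
        next
          case False
          then show ?thesis using R by blast
        qed
      qed
    qed
  qed
  from key[OF x] have R: "(axis_pt 0, u) \<in> ?L" "u 0 = k" "\<omega> {u, up u}" "(up u, axis_pt (n + 1)) \<in> Rt\<^sup>*"
    using k by auto
  show "\<omega> {u, up u}" "u 0 = k" by (fact R)+
  have uC: "u \<in> cluster d \<omega>" by (rule left_adj_cluster[OF R(1)])
  then show "u \<in> lattice_vertices d" using cluster_sub[OF d] by blast
  show "(axis_pt 0, y) \<in> (left_adjacency d k (contract d k \<omega>))\<^sup>* \<longleftrightarrow> y = u" if "y 0 = k" for y
    using R(1) u[OF left_adj_cluster[of y d k \<omega>] that] unfolding left_adj_contract by blast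
  have "(collapse k (up u), collapse k y) \<in> (open_adjacency d (contract d k \<omega>))\<^sup>*" if "(up u, y) \<in> Rt\<^sup>*" for y
    using that
  proof (induction rule: rtrancl_induct)
    case (step y w)
    then have yw: "adj d y w" "\<omega> {y, w}" "y 0 \<ge> k + 1" "w 0 \<ge> k + 1" "\<not> (y 0 = k + 1 \<and> w 0 = k + 1)"
      unfolding Rt_def by auto
    have "collapse k y \<noteq> collapse k w"
      using yw(3,4) adj_neq[OF yw(1)] unfolding collapse_def by (metis not_le up_down zless_iff_Suc_zadd zle_add1_eq_le linorder_not_less)
    then have "(collapse k y, collapse k w) \<in> open_adjacency d (contract d k \<omega>)"
      using contract_open[OF d yw(1,5), of \<omega>] yw(2) by (simp add: open_adj_iff)
    with step.IH show ?case by (rule rtrancl_into_rtrancl)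
  qed simp
  from this[OF R(4)] have "(u, axis_pt n) \<in> (open_adjacency d (contract d k \<omega>))\<^sup>*"
    using collapse_axis(1)[OF k(2)] R(2) by (simp add: collapse_def)
  moreover have "u \<in> cluster d (contract d k \<omega>)"
    by (rule left_adj_cluster[of u d k]) (simp add: left_adj_contract R(1))
  ultimately show "axis_pt n \<in> cluster d (contract d k \<omega>)"
    unfolding cluster_def by simp
qed

text \<open>A tree with \<open>t\<close> open edges covers at most \<open>t + 1\<close> vertices, so
  while these are fewer than \<open>card W\<close> some vertex of \<open>W\<close> is missed and the
  tree can grow. The edge \<open>root_edge\<close> is added separately since it may be
  closed.\<close>

lemma cluster_tree:
  assumes d: "0 < d" and W: "finite W" "W \<subseteq> cluster d \<omega>" and "t < card W"
  shows "\<exists>S. finite S \<and> S \<subseteq> lattice_edges d \<and> card S = t \<and> (\<forall>e\<in>S. \<omega> e) \<and>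
    (\<forall>e\<in>insert root_edge S. (root_edge, e) \<in> (restr (near d) (insert root_edge S))\<^sup>*) \<and>
    card (insert (axis_pt 0) (\<Union>S)) \<le> t + 1 \<and> finite (\<Union>S)"
  using \<open>t < card W\<close>
proof (induction t)
  case 0
  show ?case by (rule exI[of _ "{}"]) simp
next
  case (Suc t)
  then obtain S where S: "finite S" "S \<subseteq> lattice_edges d" "card S = t" "\<forall>e\<in>S. \<omega> e"
    "\<forall>e\<in>insert root_edge S. (root_edge, e) \<in> (restr (near d) (insert root_edge S))\<^sup>*"
    "card (insert (axis_pt 0) (\<Union>S)) \<le> t + 1" "finite (\<Union>S)" by auto
  let ?Y = "insert (axis_pt 0) (\<Union>S)"
  have "\<not> W \<subseteq> ?Y"
    using card_mono[of ?Y W] S(6,7) Suc.prems by auto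
  then obtain w where w: "w \<in> cluster d \<omega>" "w \<notin> ?Y" using W(2) by blast
  obtain y z where yz: "y \<in> ?Y" "z \<notin> ?Y" "adj d y z" "\<omega> {y, z}"
    by (rule cluster_exit[OF w(1) _ w(2)]) blast+
  let ?e = "{y, z}"
  obtain e0 where e0: "e0 \<in> insert root_edge S" "y \<in> e0" using yz(1) by blast
  have old: "(root_edge, e) \<in> (restr (near d) (insert root_edge (insert ?e S)))\<^sup>*" if "e \<in> insert root_edge S" for e
    by (rule restr_mono[of "insert root_edge S"]) (use S(5) that in auto)
  have "near d e0 ?e" using e0(2) by (rule near_shared) simp
  then have "(e0, ?e) \<in> restr (near d) (insert root_edge (insert ?e S))" using e0(1) by auto
  then have new: "(root_edge, ?e) \<in> (restr (near d) (insert root_edge (insert ?e S)))\<^sup>*"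
    using old[OF e0(1)] by (rule rtrancl_into_rtrancl[rotated])
  have "?e \<notin> S" using yz(2) by auto
  moreover have "insert (axis_pt 0) (\<Union>(insert ?e S)) = insert z ?Y" using yz(1) by auto
  ultimately show ?case
    using S yz new old by (intro exI[of _ "insert ?e S"]) (auto simp: card_insert_if)
qed

text \<open>If \<open>k\<close> is not good, layer \<open>k\<close> or \<open>k + 1\<close> has two
  cluster vertices, and each such layer accounts for at most two values of \<open>k\<close>. With
  more than half of the \<open>n + 1\<close> values bad, at least a quarter of \<open>n + 1\<close>
  layers have a second vertex; hence the factor 5/4 in the number of tree edges.\<close>

lemma singleton_layers_or_animal:
  fixes n :: nat
  assumes d: "0 < d" and x: "axis_pt (int n + 1) \<in> cluster d \<omega>"
    and few: "\<not> n + 1 \<le> 2 * card {k. k \<le> n \<and> (\<exists>u v. \<forall>y\<in>cluster d \<omega>.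
      (y 0 = int k \<longrightarrow> y = u) \<and> (y 0 = int k + 1 \<longrightarrow> y = v))}"
  obtains M where "4 * M \<ge> 5 * (n + 1)" "edge_animal d True M \<omega>"
proof -
  let ?C = "cluster d \<omega>"
  define G where "G = {k. k \<le> n \<and> (\<exists>u v. \<forall>y\<in>?C. (y 0 = int k \<longrightarrow> y = u) \<and> (y 0 = int k + 1 \<longrightarrow> y = v))}"
  define ml where "ml = {j. j \<le> n + 1 \<and> (\<exists>a\<in>?C. \<exists>b\<in>?C. a \<noteq> b \<and> a 0 = int j \<and> b 0 = int j)}"
  have fin: "finite ml" "finite G" unfolding ml_def G_def by auto
  have "k \<in> ml \<or> k + 1 \<in> ml" if k: "k \<le> n" "k \<notin> G" for k
  proof (rule ccontr)
    assume "\<not> (k \<in> ml \<or> k + 1 \<in> ml)"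
    then have "\<exists>u. \<forall>y\<in>?C. y 0 = int k \<longrightarrow> y = u" "\<exists>v. \<forall>y\<in>?C. y 0 = int (k + 1) \<longrightarrow> y = v"
      using k(1) unfolding ml_def by (simp, metis)+
    then have "k \<in> G" using k(1) unfolding G_def by (simp add: add.commute) metis
    then show False using k by simp
  qed
  then have "{..n} - G \<subseteq> ml \<union> (\<lambda>j. j - 1) ` ml" by (force intro: image_eqI[of _ _ "_ + 1"])
  then have "card ({..n} - G) \<le> card (ml \<union> (\<lambda>j. j - 1) ` ml)" using fin by (intro card_mono) auto
  also have "\<dots> \<le> card ml + card ml"
    using card_Un_le[of ml "(\<lambda>j. j - 1) ` ml"] card_image_le[OF fin(1), of "\<lambda>j. j - 1"] by linarith
  finally have "card ({..n} - G) \<le> 2 * card ml" by simp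
  moreover have "card ({..n} - G) = n + 1 - card G"
    using fin(2) by (subst card_Diff_subset) (auto simp: G_def)
  moreover have "2 * card G < n + 1" using few unfolding G_def by simp
  ultimately have ml: "4 * card ml \<ge> n + 1" by linarith
  have "\<forall>j\<in>{..n + 1}. \<exists>a\<in>?C. a 0 = int j"
  proof
    fix j assume "j \<in> {..n + 1}"
    then have "int j \<le> axis_pt (int n + 1) 0" by simp
    then show "\<exists>a\<in>?C. a 0 = int j" using cluster_layer[OF x, of "int j"] by auto
  qed
  then obtain a where a: "\<And>j. j \<le> n + 1 \<Longrightarrow> a j \<in> ?C \<and> a j 0 = int j"
    by (metis atMost_iff)
  have "\<forall>j\<in>ml. \<exists>b\<in>?C. b 0 = int j \<and> b \<noteq> a j" unfolding ml_def by auto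
  then obtain b where b: "\<And>j. j \<in> ml \<Longrightarrow> b j \<in> ?C \<and> b j 0 = int j \<and> b j \<noteq> a j" by metis
  define W where "W = a ` {..n + 1} \<union> b ` ml"
  have inj: "inj_on a {..n + 1}" "inj_on b ml"
    using a b unfolding inj_on_def by (metis atMost_iff of_nat_eq_iff)+
  have disj: "a ` {..n + 1} \<inter> b ` ml = {}"
  proof -
    have "a i \<noteq> b j" if "i \<le> n + 1" "j \<in> ml" for i j
      using a[OF that(1)] b[OF that(2)] by (metis of_nat_eq_iff)
    then show ?thesis by auto
  qed
  have W: "finite W" "W \<subseteq> ?C" "card W = n + 2 + card ml"
  proof -
    show "finite W" "W \<subseteq> ?C" unfolding W_def using fin a b by auto
    show "card W = n + 2 + card ml"
      unfolding W_def using fin disj inj by (simp add: card_Un_disjoint card_image)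
  qed
  define M where "M = n + 1 + card ml"
  have "M < card W" using W(3) unfolding M_def by simp
  from cluster_tree[OF d W(1,2) this] obtain S where S: "finite S" "S \<subseteq> lattice_edges d" "card S = M"
    "\<forall>e\<in>S. \<omega> e" "\<forall>e\<in>insert root_edge S. (root_edge, e) \<in> (restr (near d) (insert root_edge S))\<^sup>*"
    by blast
  have "M \<le> card {e \<in> insert root_edge S. \<omega> e = True}"
    unfolding S(3)[symmetric] using S(1,4) by (intro card_mono) auto
  moreover have "card (insert root_edge S) \<le> 4 * M"
    using card_insert_le_m1[of "M + 1" S root_edge] S(1,3) unfolding M_def by (simp add: card_insert_if)
  moreover have "root_edge \<in> lattice_edges d" using adj_axis[OF d, of 0] by simp
  ultimately have "edge_animal d True M \<omega>"
    unfolding edge_animal_def using S by (intro exI[of _ "insert root_edge S"]) auto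
  then show thesis using that[of M] ml unfolding M_def by simp
qed

lemma two_point_ge:
  assumes d: "0 < d" and p: "0 \<le> p" "p \<le> 1"
  shows "p ^ n \<le> two_point d p n"
proof -
  interpret P: prob_space "percolation d p" by (rule prob_space_percolation)
  define T where "T = (\<lambda>j. {axis_pt (int j), axis_pt (int j + 1)}) ` {..<n}"
  have T: "finite T" "T \<subseteq> lattice_edges d" unfolding T_def using adj_axis[OF d] by auto
  have "card T \<le> n" unfolding T_def using card_image_le[of "{..<n}"] by fastforce
  then have "p ^ n \<le> pmf (bernoulli_pmf p) True ^ card T" using p by (simp add: power_decreasing)
  also have "\<dots> = measure (percolation d p) {\<omega> \<in> space (percolation d p). \<forall>e\<in>T. \<omega> e = True}"
    by (rule measure_cylinder_const[OF T, symmetric])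
  also have "\<dots> \<le> two_point d p n"
    unfolding two_point_def connection_event_iff
  proof (rule P.finite_measure_mono)
    show "{\<omega> \<in> space (percolation d p). axis_pt (int n) \<in> cluster d \<omega>} \<in> P.events"
      using sets_connection_event[of d p n] unfolding connection_event_iff .
    have "axis_pt (int j) \<in> cluster d \<omega>" if "\<forall>e\<in>T. \<omega> e = True" "j \<le> n" for \<omega> j
      using that(2)
    proof (induction j)
      case (Suc j)
      then have "{axis_pt (int j), axis_pt (int j + 1)} \<in> T" unfolding T_def by auto
      then show ?case using Suc that(1) cluster_step[OF _ adj_axis[OF d], of "int j" \<omega>] by (simp add: add.commute)
    qed (simp add: axis_0_cluster)
    then show "{\<omega> \<in> space (percolation d p). \<forall>e\<in>T. \<omega> e = True} \<subseteq>
        {\<omega> \<in> space (percolation d p). axis_pt (int n) \<in> cluster d \<omega>}" by blast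
  qed
  finally show ?thesis .
qed

text \<open>The first summand comes from layers that can be contracted, the second from large open
  animals. \<open>M\<close> is the smallest integer not below 5/4 of \<open>n + 1\<close>.\<close>

lemma two_point_Suc_le:
  assumes d: "0 < d" and small: "animal_const d * p \<le> 1 / 2" and p: "0 \<le> p" "p \<le> 1"
    and M: "4 * M \<ge> 5 * (n + 1)" "\<And>M'. 4 * M' \<ge> 5 * (n + 1) \<Longrightarrow> M \<le> M'"
  shows "two_point d p (n + 1) \<le> 2 * (p * two_point d p n) + 2 * (animal_const d * p) ^ M"
proof -
  let ?P = "percolation d p"
  interpret P: prob_space ?P by (rule prob_space_percolation)
  have pt: "pmf (bernoulli_pmf p) True = p" using p by simp
  \<comment> \<open>\<open>z\<close> is the only vertex of layer \<open>k\<close> that the origin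
    reaches from the left. This makes the pieces disjoint for different \<open>z\<close> and names
    the extra edge between \<open>z\<close> and \<open>up z\<close>.\<close>
  define T where "T k z = {\<omega> \<in> space ?P. axis_pt (int n) \<in> cluster d \<omega>} \<inter>
    {\<omega> \<in> space ?P. \<forall>y\<in>lattice_vertices d. y 0 = k \<longrightarrow> ((axis_pt 0, y) \<in> (left_adjacency d k \<omega>)\<^sup>* \<longleftrightarrow> y = z)}" for k z
  define Z where "Z k = {z \<in> lattice_vertices d. z 0 = k}" for k :: int
  define D where "D k = {\<omega> \<in> space ?P. \<exists>z\<in>Z (int k).
    (\<lambda>e\<in>lattice_edges d. \<omega> (expand (int k) e)) \<in> T (int k) z \<and> \<omega> {z, up z} = True}" for k :: nat
  define conn where "conn m = connection_event d p origin (axis_point m)" for m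
  have conn: "conn m \<in> sets ?P" for m unfolding conn_def by (rule sets_connection_event)
  have T_sets: "T k z \<in> sets ?P" for k z
  proof -
    have "{\<omega> \<in> space ?P. \<forall>y\<in>lattice_vertices d. y 0 = k \<longrightarrow> ((axis_pt 0, y) \<in> (left_adjacency d k \<omega>)\<^sup>* \<longleftrightarrow> y = z)} =
      space ?P - (\<Union>y\<in>Z k. {\<omega> \<in> space ?P. ((axis_pt 0, y) \<in> (left_adjacency d k \<omega>)\<^sup>*) = (y \<noteq> z)})"
      unfolding Z_def by blast
    also have "\<dots> \<in> sets ?P"
    proof (intro sets.compl_sets sets.countable_UN' image_subsetI)
      show "countable (Z k)" unfolding Z_def by (rule countable_subset[OF _ countable_vertices]) auto
      show "{\<omega> \<in> space ?P. ((axis_pt 0, y) \<in> (left_adjacency d k \<omega>)\<^sup>*) = (y \<noteq> z)} \<in> sets ?P" for y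
        using sets.compl_sets[OF sets_left_connected[of d p "axis_pt 0" y k]] sets_left_connected[of d p "axis_pt 0" y k]
        by (cases "y = z") (auto simp: set_diff_eq)
    qed
    finally show ?thesis using conn[of n] unfolding T_def conn_def connection_event_iff by auto
  qed
  have DD: "D k \<in> sets ?P \<and> measure ?P (D k) \<le> pmf (bernoulli_pmf p) True * measure ?P (conn n)" for k
    unfolding D_def
  proof (rule measure_contraction_le[OF inj_expand])
    show "expand (int k) ` lattice_edges d \<subseteq> lattice_edges d" using expand_edge[OF d] by auto
    show "{z, up z} \<in> lattice_edges d - expand (int k) ` lattice_edges d" if "z \<in> Z (int k)" for z
      using that adj_self_up[OF d, of z] not_in_expand[of "{z, up z}" "int k"] unfolding Z_def by auto
    show "countable (Z (int k))" unfolding Z_def by (rule countable_subset[OF _ countable_vertices]) auto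
    show "disjoint_family_on (T (int k)) (Z (int k))"
      unfolding disjoint_family_on_def T_def Z_def by blast
    show "(\<Union>z\<in>Z (int k). T (int k) z) \<subseteq> conn n"
      unfolding T_def conn_def connection_event_iff by blast
    show "T (int k) z \<in> sets ?P" for z by (rule T_sets)
    show "conn n \<in> sets ?P" by (rule conn)
  qed
  have M1: "1 \<le> M" using M(1) by (cases M) auto
  obtain U where U: "U \<in> sets ?P"
    "\<And>\<omega> c. \<omega> \<in> space ?P \<Longrightarrow> c \<ge> M \<Longrightarrow> edge_animal d True c \<omega> \<Longrightarrow> \<omega> \<in> U"
    "measure ?P U \<le> 2 * (animal_const d * pmf (bernoulli_pmf p) True) ^ M"
    by (rule large_edge_animal_prob[OF M1, of d p True]) (use d small pt in auto)
  have "P.prob (conn (n + 1)) \<le> 2 * (pmf (bernoulli_pmf p) True * measure ?P (conn n)) + P.prob U"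
  proof (rule P.markov_counting[OF conn U(1) conjunct1[OF DD] conjunct2[OF DD]])
    fix \<omega> assume "\<omega> \<in> conn (n + 1)"
    then have \<omega>: "\<omega> \<in> space ?P" "axis_pt (int n + 1) \<in> cluster d \<omega>"
      unfolding conn_def connection_event_iff by (auto simp: add.commute)
    let ?G = "{k. k \<le> n \<and> (\<exists>u v. \<forall>y\<in>cluster d \<omega>. (y 0 = int k \<longrightarrow> y = u) \<and> (y 0 = int k + 1 \<longrightarrow> y = v))}"
    show "\<omega> \<in> U \<or> n + 1 \<le> 2 * card {k. k \<le> n \<and> \<omega> \<in> D k}"
    proof (cases "n + 1 \<le> 2 * card ?G")
      case True
      have "?G \<subseteq> {k. k \<le> n \<and> \<omega> \<in> D k}"
      proof
        fix k assume "k \<in> ?G"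
        then obtain u v where k: "k \<le> n" and
          uv: "\<And>y. y \<in> cluster d \<omega> \<Longrightarrow> y 0 = int k \<Longrightarrow> y = u" "\<And>y. y \<in> cluster d \<omega> \<Longrightarrow> y 0 = int k + 1 \<Longrightarrow> y = v"
          by blast
        have kk: "0 \<le> int k" "int k \<le> int n" using k by auto
        note cs = contract_singleton_layers[where u = u and v = v, OF d kk \<omega>(2)]
        have c: "axis_pt (int n) \<in> cluster d (contract d (int k) \<omega>)" "\<omega> {u, up u}" "u 0 = int k"
            "u \<in> lattice_vertices d"
          by (rule cs; erule (1) uv)+
        have c5: "((axis_pt 0, y) \<in> (left_adjacency d (int k) (contract d (int k) \<omega>))\<^sup>*) = (y = u)"
            if "y 0 = int k" for y
          by (rule cs(5)) (erule (1) uv | rule that)+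
        have "contract d (int k) \<omega> \<in> T (int k) u"
          unfolding T_def
        proof (intro IntI CollectI conjI ballI impI)
          show "axis_pt (int n) \<in> cluster d (contract d (int k) \<omega>)" by (rule c(1))
          show "((axis_pt 0, y) \<in> (left_adjacency d (int k) (contract d (int k) \<omega>))\<^sup>*) = (y = u)"
            if "y 0 = int k" for y
            by (rule c5[of y, OF that])
        qed (rule contract_space)+
        moreover have "u \<in> Z (int k)" using c(3,4) by (simp add: Z_def)
        moreover have "\<omega> {u, up u} = True" using c(2) by simp
        ultimately have "\<exists>z\<in>Z (int k). contract d (int k) \<omega> \<in> T (int k) z \<and> \<omega> {z, up z} = True"
          by blast
        then have "\<omega> \<in> D k"
          using \<omega>(1) unfolding D_def contract_def by (intro CollectI conjI)
        then show "k \<in> {k. k \<le> n \<and> \<omega> \<in> D k}" using k by simp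
      qed
      then have "card ?G \<le> card {k. k \<le> n \<and> \<omega> \<in> D k}" by (intro card_mono) auto
      then show ?thesis using True by linarith
    next
      case False
      then obtain M' where "4 * M' \<ge> 5 * (n + 1)" "edge_animal d True M' \<omega>"
        by (rule singleton_layers_or_animal[OF d \<omega>(2)])
      then show ?thesis using U(2)[OF \<omega>(1)] M(2) by blast
    qed
  qed
  then show ?thesis using U(3) unfolding two_point_def conn_def pt by linarith
qed

lemma two_point_strict_decreasing:
  assumes d: "0 < d"
  shows "\<exists>p'::real. 0 < p' \<and> p' \<le> 1 \<and> (\<forall>p n. 0 < p \<and> p < p' \<longrightarrow> two_point d p n > two_point d p (n + 1))"
proof -
  let ?A = "animal_const d"
  have A: "?A \<ge> 1" using animal_const_ge_1 d by simp
  \<comment> \<open>\<open>?A ^ 5 * p < 1\<close> makes \<open>(?A * p) ^ M\<close> at most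
    \<open>p ^ (n + 1)\<close>, hence at most p \<tau>(n). The sum is then at most 4 p \<tau>(n),
    and the factor 4 in the denominator yields 4 p < 1.\<close>
  define p' where "p' = 1 / (4 * ?A ^ 5)"
  have A5: "1 \<le> ?A ^ 5" "?A \<le> ?A ^ 5" using A by (auto simp: one_le_power self_le_power)
  have "0 < ?A ^ 5" using A5(1) by linarith
  then have p'01: "0 < p'" "p' \<le> 1" unfolding p'_def using A5(1) by (simp_all add: divide_le_eq)
  moreover have "two_point d p n > two_point d p (n + 1)" if p: "0 < p" "p < p'" for p n
  proof -
    have p5: "?A ^ 5 * p < 1 / 4" using p(2) \<open>0 < ?A ^ 5\<close> unfolding p'_def by (simp add: pos_less_divide_eq mult_ac)
    have "1 * p \<le> ?A ^ 5 * p" by (rule mult_right_mono[OF A5(1)]) (use p in simp)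
    then have p4: "p < 1 / 4" using p5 by simp
    have "?A * p \<le> ?A ^ 5 * p" by (rule mult_right_mono[OF A5(2)]) (use p in simp)
    then have "?A * p \<le> 1 / 4" using p5 by linarith
    moreover have "0 \<le> ?A * p" using A p by simp
    ultimately have Ap: "?A * p \<le> 1 / 4" "0 \<le> ?A * p" by simp_all
    define M where "M = (LEAST M. 4 * M \<ge> 5 * (n + 1))"
    have M: "4 * M \<ge> 5 * (n + 1)" unfolding M_def by (rule LeastI[of _ "5 * (n + 1)"]) simp
    have M': "M \<le> M'" if "4 * M' \<ge> 5 * (n + 1)" for M' unfolding M_def using that by (rule Least_le)
    have le: "two_point d p (n + 1) \<le> 2 * (p * two_point d p n) + 2 * (?A * p) ^ M"
      by (rule two_point_Suc_le[OF d _ _ _ M M']) (use Ap p p4 in auto)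
    \<comment> \<open>Fourth powers turn the exponent 5/4 into the integer inequality
      \<open>4 * M \<ge> 5 * (n + 1)\<close>.\<close>
    have "((?A * p) ^ M) ^ 4 \<le> (p ^ (n + 1)) ^ 4"
    proof -
      have "((?A * p) ^ M) ^ 4 = (?A * p) ^ (4 * M)" by (simp add: power_mult[symmetric] mult.commute)
      also have "\<dots> \<le> (?A * p) ^ (5 * (n + 1))" using M Ap by (intro power_decreasing) auto
      also have "\<dots> = (?A ^ 5 * p) ^ (n + 1) * p ^ (4 * (n + 1))"
      proof -
        have "(?A * p) ^ (5 * (n + 1)) = ((?A * p) ^ 5) ^ (n + 1)" by (rule power_mult)
        also have "(?A * p) ^ 5 = (?A ^ 5 * p) * p ^ 4" by (simp add: power_mult_distrib eval_nat_numeral)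
        also have "(\<dots>) ^ (n + 1) = (?A ^ 5 * p) ^ (n + 1) * p ^ (4 * (n + 1))"
          by (simp only: power_mult_distrib power_mult)
        finally show ?thesis .
      qed
      also have "\<dots> \<le> 1 * p ^ (4 * (n + 1))"
        using p5 p A by (intro mult_right_mono power_le_one) auto
      also have "1 * p ^ (4 * (n + 1)) = (p ^ (n + 1)) ^ 4"
        by (simp only: power_mult[symmetric] mult_1 mult.commute)
      finally show ?thesis .
    qed
    moreover have "(p ^ (n + 1)) ^ 4 < ((?A * p) ^ M) ^ 4" if "p ^ (n + 1) < (?A * p) ^ M"
      using that p by (intro power_strict_mono) auto
    ultimately have "(?A * p) ^ M \<le> p ^ (n + 1)" by (meson not_le)
    also have "\<dots> \<le> p * two_point d p n" using two_point_ge[OF d, of p n] p p4 by simp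
    finally have "two_point d p (n + 1) \<le> 4 * p * two_point d p n" using le by simp
    moreover have "0 < two_point d p n"
      using two_point_ge[OF d, of p n] p p4 zero_less_power[OF p(1), of n] by linarith
    then have "4 * p * two_point d p n < two_point d p n" using p4 by simp
    ultimately show ?thesis by simp
  qed
  ultimately show ?thesis by blast
qed

subsection \<open>Closed animals around finite clusters\<close>

lemma bd_compl: "bd d (lattice_vertices d - B) = bd d B"
proof -
  have "e \<in> bd d (lattice_vertices d - B) \<longleftrightarrow> e \<in> bd d B" if "e \<in> lattice_edges d" for e
  proof -
    obtain x y where "e = {x, y}" "adj d x y" "x \<in> lattice_vertices d" "y \<in> lattice_vertices d"
      using \<open>e \<in> lattice_edges d\<close> by (rule edgeE)
    then show ?thesis by (auto simp: bd_iff)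
  qed
  moreover have "e \<in> lattice_edges d" if "e \<in> bd d X" for e X using that unfolding bd_def by simp
  ultimately show ?thesis by (intro set_eqI) blast
qed

lemma finite_bd: "finite H \<Longrightarrow> finite (bd d H)"
proof -
  assume "finite H"
  moreover have "bd d H \<subseteq> (\<Union>x\<in>H. (\<lambda>y. {x, y}) ` {y. adj d x y})"
  proof
    fix e assume "e \<in> bd d H"
    then obtain x y where "e = {x, y}" "adj d x y" "x \<in> H" by (rule bdE)
    then show "e \<in> (\<Union>x\<in>H. (\<lambda>y. {x, y}) ` {y. adj d x y})" by auto
  qed
  ultimately show ?thesis using nbrs_le by (auto intro: finite_subset)
qed

lemma outside_component:
  assumes "d \<ge> 2" "0 \<le> R" "A \<inter> outside_box d R = {}" "v \<in> outside_box d R"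
  shows "v \<in> component d A (axis_pt (R + 1))"
  by (rule component_path[OF component_self outside_connected[OF assms(1,2,4)]]) (use assms(3) in auto)

lemma axis_outside: "0 < d \<Longrightarrow> 0 \<le> R \<Longrightarrow> axis_pt (R + 1) \<in> outside_box d R"
  unfolding outside_box_def by (auto intro!: exI[of _ 0])

text \<open>Applied to the preimage \<open>K\<close> of a contracted cluster: it lies inside the
  filled cluster, so the outer component of the cluster is contained in the outer component of
  \<open>K\<close>.\<close>

lemma component_mono:
  assumes "component d A y \<inter> K = {}"
  shows "component d A y \<subseteq> component d K y"
proof
  fix v assume "v \<in> component d A y"
  then have "(y, v) \<in> (restr (adj d) (lattice_vertices d - A))\<^sup>*" unfolding component_def by simp
  then show "v \<in> component d K y"
  proof (induction rule: rtrancl_induct)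
    case base
    show ?case by (rule component_self)
  next
    case (step u w)
    then have u: "u \<in> component d A y" unfolding component_def by simp
    moreover have uw: "adj d u w" "u \<notin> A" "w \<notin> A" using step.hyps(2) by auto
    ultimately have "w \<in> component d A y" by (rule component_step)
    then show ?case using component_step[OF step.IH uw(1)] u assms by blast
  qed
qed

text \<open>The crossing edge ties a cut set to the first axis and thereby to the root edge.\<close>

lemma axis_crossing:
  assumes "0 < d" "i \<le> j" "(axis_pt i \<in> B) \<noteq> (axis_pt j \<in> B)"
  obtains t where "i \<le> t" "t < j" "{axis_pt t, axis_pt (t + 1)} \<in> bd d B"
proof -
  have "(axis_pt i \<in> B) \<noteq> (axis_pt j \<in> B) \<longrightarrow> (\<exists>t. i \<le> t \<and> t < j \<and> {axis_pt t, axis_pt (t + 1)} \<in> bd d B)"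
    using assms(2)
  proof (induction j rule: int_ge_induct)
    case (step j)
    show ?case
    proof
      assume ne: "(axis_pt i \<in> B) \<noteq> (axis_pt (j + 1) \<in> B)"
      show "\<exists>t. i \<le> t \<and> t < j + 1 \<and> {axis_pt t, axis_pt (t + 1)} \<in> bd d B"
      proof (cases "(axis_pt j \<in> B) = (axis_pt (j + 1) \<in> B)")
        case True
        then have "\<exists>t. i \<le> t \<and> t < j \<and> {axis_pt t, axis_pt (t + 1)} \<in> bd d B" using step.IH ne by blast
        then show ?thesis by (meson zless_add1_eq)
      next
        case False
        then have "{axis_pt j, axis_pt (j + 1)} \<in> bd d B" using adj_axis[OF assms(1)] by (simp add: bd_iff)
        then show ?thesis using step.hyps by (intro exI[of _ j]) simp
      qed
    qed
  qed simp
  then show thesis using that assms(3) by blast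
qed

section \<open>Boundary edges within one layer\<close>

definition layer_edges :: "nat \<Rightarrow> int \<Rightarrow> (nat \<Rightarrow> int) set set" where
  "layer_edges d j = {e \<in> lattice_edges d. \<forall>v\<in>e. v 0 = j}"

lemma ray_exit:
  assumes H: "H \<inter> outside_box d R = {}" "v \<in> H" "H \<subseteq> lattice_vertices d" and i: "i < d" and s: "\<bar>s :: int\<bar> = 1"
  obtains t :: nat where "v(i := v i + s * int t) \<in> H" "v(i := v i + s * int (t + 1)) \<notin> H"
proof -
  define a where "a t = v(i := v i + s * int t)" for t :: nat
  define T where "T = nat (\<bar>v i\<bar> + \<bar>R\<bar> + 1)"
  have "int T = \<bar>v i\<bar> + \<bar>R\<bar> + 1" unfolding T_def by simp
  then have "\<bar>v i + s * int T\<bar> > R" using s by (auto simp: abs_if split: if_splits)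
  then have "a T \<in> outside_box d R" unfolding a_def outside_box_def using H i by auto
  then have ex: "\<exists>t. a t \<notin> H" using H(1) by blast
  define t0 where "t0 = (LEAST t. a t \<notin> H)"
  have t0: "a t0 \<notin> H" unfolding t0_def using ex by (rule LeastI_ex)
  moreover have "a 0 \<in> H" unfolding a_def using H by simp
  ultimately obtain t where t: "t0 = Suc t" by (metis not0_implies_Suc)
  have "a t \<in> H" using not_less_Least[of t "\<lambda>t. a t \<notin> H"] t unfolding t0_def by auto
  then show thesis using that[of t] t0 t unfolding a_def by simp
qed

text \<open>From \<open>v\<close> send rays in both senses along each of the directions 1 to
  \<open>d - 1\<close>; they stay in layer \<open>j\<close> and each leaves \<open>H\<close> through
  a boundary edge. The edges differ because each varies in one direction only, and for a fixed
  direction the two lie on opposite sides of \<open>v\<close>.\<close>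

lemma card_layer_boundary:
  assumes H: "H \<inter> outside_box d R = {}" "finite H" "H \<subseteq> lattice_vertices d" and v: "v \<in> H" "v 0 = j"
  shows "2 * (d - 1) \<le> card (bd d H \<inter> layer_edges d j)"
proof -
  define sg where "sg b = (if b then 1 else - 1 :: int)" for b
  have sg: "\<bar>sg b\<bar> = 1" for b unfolding sg_def by simp
  have "\<exists>t :: nat. v(i := v i + sg b * int t) \<in> H \<and> v(i := v i + sg b * int (t + 1)) \<notin> H" if "i < d" for i b
    by (rule ray_exit[OF H(1) v(1) H(3) that sg[of b]]) blast
  then obtain t :: "nat \<Rightarrow> bool \<Rightarrow> nat" where t: "\<And>i b. i < d \<Longrightarrow> v(i := v i + sg b * int (t i b)) \<in> H \<and>
      v(i := v i + sg b * int (t i b + 1)) \<notin> H"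
    by metis
  define f where "f = (\<lambda>(i, b). {v(i := v i + sg b * int (t i b)), v(i := v i + sg b * int (t i b + 1))})"
  have "f ` ({1..<d} \<times> UNIV) \<subseteq> bd d H \<inter> layer_edges d j"
  proof
    fix e assume "e \<in> f ` ({1..<d} \<times> UNIV)"
    then obtain i b where i: "1 \<le> i" "i < d" and e: "e = f (i, b)" by auto
    let ?x = "v(i := v i + sg b * int (t i b))" and ?y = "v(i := v i + sg b * int (t i b + 1))"
    have "?y = ?x(i := ?x i + sg b)" by (auto simp: algebra_simps)
    moreover have "?x \<in> lattice_vertices d" using t[OF i(2)] H(3) by blast
    ultimately have "adj d ?x ?y" using adj_upd[OF i(2) _ sg, of ?x b] by metis
    then show "e \<in> bd d H \<inter> layer_edges d j"
      using t[OF i(2), of b] i v(2) unfolding e f_def layer_edges_def by (auto simp: bd_iff)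
  qed
  then have "card (f ` ({1..<d} \<times> UNIV)) \<le> card (bd d H \<inter> layer_edges d j)"
    using finite_bd[OF H(2)] by (intro card_mono) auto
  moreover have "inj_on f ({1..<d} \<times> UNIV)"
  proof (rule inj_onI)
    fix q q' assume q: "q \<in> {1..<d} \<times> (UNIV :: bool set)" "q' \<in> {1..<d} \<times> (UNIV :: bool set)" "f q = f q'"
    obtain i b i' b' where ib: "q = (i, b)" "q' = (i', b')" by (cases q, cases q') auto
    have coords: "(\<lambda>x. x i) ` f q = (\<lambda>x. x i) ` f q'" using q(3) by simp
    have fq: "(\<lambda>x. x i) ` f q = {v i + sg b * int (t i b), v i + sg b * int (t i b + 1)}"
      unfolding ib f_def by simp
    have ii: "i = i'"
    proof (rule ccontr)
      assume "i \<noteq> i'"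
      then have "(\<lambda>x. x i) ` f q' = {v i}" unfolding ib f_def by simp
      then have "v i + sg b * int (t i b) = v i + sg b * int (t i b + 1)" using coords fq by (metis insert_iff singletonD)
      then show False unfolding sg_def by (auto split: if_splits)
    qed
    have "(\<lambda>x. x i) ` f q' = {v i + sg b' * int (t i b'), v i + sg b' * int (t i b' + 1)}"
      unfolding ib f_def ii by simp
    then have "{v i + sg b * int (t i b), v i + sg b * int (t i b + 1)} =
        {v i + sg b' * int (t i b'), v i + sg b' * int (t i b' + 1)}" using coords fq by metis
    then have "b = b'" unfolding sg_def by (cases b; cases b') (auto simp: doubleton_eq_iff)
    then show "q = q'" using ib ii by simp
  qed
  ultimately show ?thesis by (simp add: card_image card_cartesian_product mult.commute)
qed

definition top_vertex :: "int \<Rightarrow> (nat \<Rightarrow> int) set \<Rightarrow> nat \<Rightarrow> int" where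
  "top_vertex k A = (SOME u. u \<in> A \<and> u 0 = k \<and> (\<forall>w\<in>A. w 0 = k \<longrightarrow> w 1 \<le> u 1))"

text \<open>The edge lies in the deleted layer \<open>k + 1\<close> and is a function of
  \<open>k\<close> and the contracted cluster \<open>A\<close> alone. It starts from the upper copy
  of a vertex that is highest in direction 1 within layer \<open>k\<close>, so the ray beyond it
  misses the preimage of \<open>A\<close> and the edge borders the outer component.\<close>

definition top_edge :: "int \<Rightarrow> (nat \<Rightarrow> int) set \<Rightarrow> (nat \<Rightarrow> int) set" where
  "top_edge k A = {up (top_vertex k A), (up (top_vertex k A))(1 := up (top_vertex k A) 1 + 1)}"

lemma top_vertex:
  assumes "finite A" "u \<in> A" "u 0 = k"
  shows "top_vertex k A \<in> A" "top_vertex k A 0 = k" "\<And>w. w \<in> A \<Longrightarrow> w 0 = k \<Longrightarrow> w 1 \<le> top_vertex k A 1"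
proof -
  let ?N = "(\<lambda>u. u 1) ` {u \<in> A. u 0 = k}"
  have N: "finite ?N" "?N \<noteq> {}" using assms by auto
  then obtain u where "u \<in> A" "u 0 = k" "u 1 = Max ?N" using Max_in[OF N] by force
  then have "\<exists>u. u \<in> A \<and> u 0 = k \<and> (\<forall>w\<in>A. w 0 = k \<longrightarrow> w 1 \<le> u 1)"
    using N by (intro exI[of _ u]) (auto intro!: Max_ge)
  then have "top_vertex k A \<in> A \<and> top_vertex k A 0 = k \<and> (\<forall>w\<in>A. w 0 = k \<longrightarrow> w 1 \<le> top_vertex k A 1)"
    unfolding top_vertex_def by (rule someI_ex)
  then show "top_vertex k A \<in> A" "top_vertex k A 0 = k" "\<And>w. w \<in> A \<Longrightarrow> w 0 = k \<Longrightarrow> w 1 \<le> top_vertex k A 1"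
    by auto
qed

lemma collapse_eq:
  "collapse k w = collapse k y \<Longrightarrow> w = y \<or> (w 0 = k \<and> y = up w) \<or> (y 0 = k \<and> w = up y)"
proof -
  assume eq: "collapse k w = collapse k y"
  consider "w 0 \<le> k" "y 0 \<le> k" | "w 0 \<le> k" "y 0 > k" | "w 0 > k" "y 0 \<le> k" | "w 0 > k" "y 0 > k" by linarith
  then show ?thesis
  proof cases
    case 2
    then have w: "w = down y" using eq unfolding collapse_def by simp
    then have "w 0 = k" using 2 by simp
    moreover have "y = up w" using w by simp
    ultimately show ?thesis by blast
  next
    case 3
    then have w: "y = down w" using eq unfolding collapse_def by simp
    then have "y 0 = k" using 3 by simp
    moreover have "w = up y" using w by simp
    ultimately show ?thesis by blast
  next
    case 4
    then have "down w = down y" using eq unfolding collapse_def by simp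
    then show ?thesis by (metis up_down)
  qed (use eq in \<open>auto simp: collapse_def\<close>)
qed

text \<open>\<open>B\<close> is the unbounded component of the complement of the cluster, \<open>H\<close> the filled cluster,
  and \<open>- m\<close> the last position before the negative first axis leaves \<open>H\<close> for the first time.\<close>

locale finite_cluster =
  fixes d :: nat and \<omega> :: configuration and n :: nat and R :: int and B H :: "(nat \<Rightarrow> int) set" and m :: nat
  assumes d2: "d \<ge> 2" and fin: "finite (cluster d \<omega>)" and x: "axis_pt (int n + 1) \<in> cluster d \<omega>"
    and R: "0 \<le> R" "cluster d \<omega> \<inter> outside_box d R = {}"
    and B: "B = component d (cluster d \<omega>) (axis_pt (R + 1))"
    and H: "H = lattice_vertices d - B"
    and m: "m = (LEAST t. axis_pt (- int (t + 1)) \<notin> H)"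
begin

lemma d0: "0 < d"
  using d2 by simp

abbreviation C :: "(nat \<Rightarrow> int) set" where "C \<equiv> cluster d \<omega>"

lemma far: "axis_pt (R + 1) \<in> lattice_vertices d - C"
  using axis_outside[OF d0 R(1)] R(2) unfolding outside_box_def by blast

lemma B_sub: "B \<subseteq> lattice_vertices d - C"
  unfolding B by (rule component_sub[OF far])

lemma C_sub_H: "C \<subseteq> H"
  using cluster_sub[OF d0] B_sub unfolding H by blast

lemma H_sub: "H \<subseteq> lattice_vertices d"
  unfolding H by blast

lemma H_outside: "H \<inter> outside_box d R = {}"
  using outside_component[OF d2 R] unfolding H B by blast

lemma finite_H: "finite H"
  by (rule finite_subset[OF _ finite_box[of d R]]) (use H_outside H_sub in blast)

lemma bd_H: "bd d H = bd d B"
  unfolding H by (rule bd_compl)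

lemma bd_H_closed: "e \<in> bd d H \<Longrightarrow> \<not> \<omega> e"
proof
  assume "e \<in> bd d H" "\<omega> e"
  obtain a b where "e = {a, b}" "adj d a b" "a \<in> C" "b \<notin> C"
    using \<open>e \<in> bd d H\<close> unfolding bd_H B by (rule component_bdE[OF far])
  then show False using cluster_step[of a d \<omega> b] \<open>\<omega> e\<close> by simp
qed

lemma H_step: "a \<in> H \<Longrightarrow> adj d a b \<Longrightarrow> \<omega> {a, b} \<Longrightarrow> b \<in> H"
  using bd_H_closed[of "{a, b}"] by (auto simp: bd_iff)

lemma bd_H_connected: "e \<in> bd d H \<Longrightarrow> e' \<in> bd d H \<Longrightarrow> (e, e') \<in> (restr (near d) (bd d H))\<^sup>*"
  unfolding bd_H B
  by (rule component_boundary_connected[OF far cluster_sub[OF d0] axis_0_cluster cluster_connected])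

lemma axis_exit: "axis_pt (- int (m + 1)) \<notin> H" "\<And>t. t \<le> m \<Longrightarrow> axis_pt (- int t) \<in> H"
proof -
  let ?Q = "\<lambda>t. axis_pt (- int (t + 1)) \<notin> H"
  have "axis_pt (- int (nat (R + 1) + 1)) \<in> outside_box d R"
    using R(1) d0 unfolding outside_box_def by (auto intro!: exI[of _ 0])
  then have "?Q (nat (R + 1))" using H_outside by blast
  then show "?Q m" unfolding m by (rule LeastI)
  fix t assume "t \<le> m"
  show "axis_pt (- int t) \<in> H"
  proof (cases t)
    case 0
    then show ?thesis using axis_0_cluster[of d \<omega>] C_sub_H by auto
  next
    case (Suc t')
    then have "\<not> ?Q t'" using \<open>t \<le> m\<close> unfolding m by (intro not_less_Least) simp
    then show ?thesis using Suc by simp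
  qed
qed

lemma H_layer:
  assumes "- int m \<le> j" "j \<le> int n + 1"
  obtains v where "v \<in> H" "v 0 = j"
proof (cases "j \<le> 0")
  case True
  then have "axis_pt (- int (nat (- j))) \<in> H" using assms by (intro axis_exit) simp
  then show thesis using True that[of "axis_pt j"] by simp
next
  case False
  then obtain w where "w \<in> C" "w 0 = j" using cluster_layer[OF x, of j] assms by auto
  then show thesis using that C_sub_H by blast
qed

text \<open>If contracting layer \<open>k\<close> destroys the connection, the preimage \<open>K\<close> of the contracted cluster
  has a boundary component whose open edges all lie in layer \<open>k + 1\<close>; shifting them down gives
  closed edges of the same component that do not belong to the outer boundary of the cluster.\<close>

lemma cut_set:
  fixes k :: int
  assumes k: "0 \<le> k" "k \<le> int n"
    and long: "\<And>u. u 0 = k \<Longrightarrow> {u, up u} \<notin> bd d H"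
    and nondel: "finite (cluster d (contract d k \<omega>)) \<Longrightarrow> axis_pt (int n) \<in> cluster d (contract d k \<omega>) \<Longrightarrow>
      \<omega> (top_edge k (cluster d (contract d k \<omega>)))"
  shows "\<exists>P. finite P \<and> P \<subseteq> lattice_edges d \<and> (\<forall>e\<in>P. \<forall>e'\<in>P. (e, e') \<in> (restr (near d) P)\<^sup>*) \<and>
    (\<exists>j. - int m - 1 \<le> j \<and> j \<le> int n \<and> {axis_pt j, axis_pt (j + 1)} \<in> P) \<and>
    (\<forall>e\<in>P. \<omega> e \<longrightarrow> down ` e \<in> P \<and> \<not> \<omega> (down ` e)) \<and>
    (\<exists>g\<in>P. g \<in> layer_edges d k \<and> \<not> \<omega> g \<and> g \<notin> bd d H)"
proof -
  let ?C' = "cluster d (contract d k \<omega>)"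
  define K where "K = {v \<in> lattice_vertices d. collapse k v \<in> ?C'}"
  \<comment> \<open>Without vertical boundary edges over layer \<open>k\<close>, \<open>H\<close>
    looks the same in layers \<open>k\<close> and \<open>k + 1\<close>; it is therefore a union of
    fibres of \<open>collapse k\<close>.\<close>
  have slice: "u \<in> H \<longleftrightarrow> up u \<in> H" if "u \<in> lattice_vertices d" "u 0 = k" for u
    using long[of u, OF that(2)] adj_self_up[OF d0 that(1)] by (auto simp: bd_iff)
  have same: "w \<in> H" if "y \<in> H" "w \<in> lattice_vertices d" "collapse k w = collapse k y" for w y
    using collapse_eq[OF that(3)] slice[of w] slice[of y] that H_sub by blast
  \<comment> \<open>A path in the contracted cluster lifts to open steps, which cannot leave
    \<open>H\<close> because its boundary is closed, and jumps within fibres, which cannot leave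
    \<open>H\<close> by \<open>same\<close>.\<close>
  have K_H: "K \<subseteq> H"
  proof -
    have "\<forall>v\<in>lattice_vertices d. collapse k v = a \<longrightarrow> v \<in> H" if "a \<in> ?C'" for a
      using that
    proof (induction rule: cluster_induct)
      case base
      have "axis_pt 0 \<in> H" using axis_0_cluster C_sub_H by blast
      then show ?case using same[of "axis_pt 0"] collapse_axis(2)[OF k(1)] by metis
    next
      case (step a b)
      obtain y w where yw: "adj d y w" "\<omega> {y, w}" "collapse k y = a" "collapse k w = b"
        by (rule contract_lift[OF d0 step.hyps(2,3)])
      then have "y \<in> H" using step.IH adj_vertices[OF yw(1)] by blast
      then have "w \<in> H" using H_step yw by blast
      then show ?case using same[of w] yw(4) by metis
    qed
    then show ?thesis unfolding K_def by blast
  qed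
  have K_V: "K \<subseteq> lattice_vertices d" and K_fin: "finite K"
    using K_H H_sub finite_H finite_subset by blast+
  have K_0: "axis_pt 0 \<in> K"
    unfolding K_def using d0 collapse_axis(2)[OF k(1)] axis_0_cluster by simp
  have K_down: "v \<in> K \<longleftrightarrow> down v \<in> K" if "v 0 = k + 1" "v \<in> lattice_vertices d" for v
  proof -
    have "down v \<in> lattice_vertices d" using that(2) d0 by (simp add: down_def)
    moreover have "collapse k v = collapse k (down v)" using that(1) by (simp add: collapse_def)
    ultimately show ?thesis using that(2) unfolding K_def by simp
  qed
  have K_same: "(y, w) \<in> (restr (adj d) K)\<^sup>*" if "y \<in> K" "w \<in> K" "collapse k w = collapse k y" for y w
  proof -
    have "w = y \<or> adj d y w"
      using collapse_eq[OF that(3)] adj_self_up[OF d0] adj_sym that(1,2) K_V by blast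
    then show ?thesis using that by auto
  qed
  have K_conn: "(axis_pt 0, v) \<in> (restr (adj d) K)\<^sup>*" if "v \<in> K" for v
  proof -
    have "\<forall>v\<in>K. collapse k v = a \<longrightarrow> (axis_pt 0, v) \<in> (restr (adj d) K)\<^sup>*" if "a \<in> ?C'" for a
      using that
    proof (induction rule: cluster_induct)
      case base
      show ?case
      proof (intro ballI impI)
        fix v assume v: "v \<in> K" "collapse k v = axis_pt 0"
        show "(axis_pt 0, v) \<in> (restr (adj d) K)\<^sup>*"
          by (rule K_same[OF K_0 v(1)]) (simp only: v(2) collapse_axis(2)[OF k(1)])
      qed
    next
      case (step a b)
      obtain y w where yw: "adj d y w" "\<omega> {y, w}" "collapse k y = a" "collapse k w = b"
        by (rule contract_lift[OF d0 step.hyps(2,3)])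
      then have yK: "y \<in> K" and wK: "w \<in> K"
        using adj_vertices[OF yw(1)] step.hyps(1,4) unfolding K_def by simp_all
      then have "(axis_pt 0, y) \<in> (restr (adj d) K)\<^sup>*" using step.IH yw(3) by blast
      moreover have "(y, w) \<in> restr (adj d) K" using yK wK yw(1) by simp
      ultimately have "(axis_pt 0, w) \<in> (restr (adj d) K)\<^sup>*" by (rule rtrancl_into_rtrancl)
      show ?case
      proof (intro ballI impI)
        fix v assume v: "v \<in> K" "collapse k v = b"
        have "(w, v) \<in> (restr (adj d) K)\<^sup>*" by (rule K_same[OF wK v(1)]) (simp only: v(2) yw(4))
        with \<open>(axis_pt 0, w) \<in> (restr (adj d) K)\<^sup>*\<close> show "(axis_pt 0, v) \<in> (restr (adj d) K)\<^sup>*"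
          by (rule rtrancl_trans)
      qed
    qed
    then show ?thesis using that unfolding K_def by blast
  qed
  \<comment> \<open>An open edge leaving \<open>K\<close> cannot survive contraction, and a vertical
    edge over layer \<open>k\<close> joins two vertices of one fibre. Only the edges inside layer
    \<open>k + 1\<close> remain.\<close>
  have K_bd: "a 0 = k + 1 \<and> b 0 = k + 1" if "adj d a b" "a \<in> K" "b \<notin> K" "\<omega> {a, b}" for a b
  proof (rule ccontr)
    assume nb: "\<not> (a 0 = k + 1 \<and> b 0 = k + 1)"
    have "collapse k b \<notin> ?C'" "collapse k a \<in> ?C'"
      using that adj_vertices(2)[OF that(1)] unfolding K_def by auto
    moreover then have "collapse k a \<noteq> collapse k b" by metis
    ultimately show False
      using contract_open[OF d0 that(1) nb, of \<omega>] that(4) cluster_step[of "collapse k a"] by blast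
  qed
  have cut: ?thesis
    if y: "y \<in> lattice_vertices d - K" and f: "\<exists>e\<in>bd d (component d K y). \<omega> e"
      and ax: "- int m - 1 \<le> i" "i \<le> j" "j \<le> int n + 1"
        "(axis_pt i \<in> component d K y) \<noteq> (axis_pt j \<in> component d K y)" for y i j
  proof -
    define P where "P = bd d (component d K y)"
    have open_down: "down ` e \<in> P \<and> \<not> \<omega> (down ` e) \<and> down ` e \<in> layer_edges d k \<and> down ` e \<notin> bd d H"
      if e: "e \<in> P" "\<omega> e" for e
    proof -
      obtain a b where ab: "e = {a, b}" "adj d a b" "a \<in> K" "b \<in> component d K y" "b \<notin> K"
        using e(1) unfolding P_def by (rule component_bdE[OF y])
      have V: "a \<in> lattice_vertices d" "b \<in> lattice_vertices d" using adj_vertices[OF ab(2)] by auto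
      have k1: "a 0 = k + 1" "b 0 = k + 1" using K_bd[OF ab(2,3,5)] e(2) ab(1) by auto
      have dn: "down a \<in> K" "down b \<notin> K" using K_down k1 V ab by auto
      have adj': "adj d (down a) (down b)" by (rule adj_down[OF d0 ab(2)])
      have "adj d b (down b)"
        using adj_self_up[OF d0 adj_vertices(2)[OF adj']] adj_sym by simp
      then have "down b \<in> component d K y" by (rule component_step[OF ab(4) _ ab(5) dn(2)])
      moreover have "down a \<notin> component d K y" using component_sub[OF y] dn(1) by blast
      ultimately have inP: "{down a, down b} \<in> P" unfolding P_def using adj' by (simp add: bd_iff)
      have cl: "\<not> \<omega> {down a, down b}"
        using K_bd[OF adj' dn] k1 by auto
      \<comment> \<open>The open edge keeps both ends in \<open>H\<close>, hence also the ends of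
        the shifted edge. This is what makes the shifted edge a new closed edge, not one of the
        outer boundary.\<close>
      have "a \<in> H" using ab(3) K_H by blast
      moreover then have "b \<in> H" using H_step ab(1,2) e(2) by blast
      ultimately have "down a \<in> H" "down b \<in> H"
        using slice[of "down a"] slice[of "down b"] adj_vertices[OF adj'] k1 by auto
      then have "{down a, down b} \<notin> bd d H" by (simp add: bd_iff)
      then show ?thesis using inP cl adj' k1 unfolding ab(1) layer_edges_def by simp
    qed
    obtain e where e: "e \<in> P" "\<omega> e" using f unfolding P_def by blast
    obtain t where t: "i \<le> t" "t < j" "{axis_pt t, axis_pt (t + 1)} \<in> P"
      using axis_crossing[OF d0 ax(2,4)] unfolding P_def by blast
    have "P \<subseteq> bd d K"
    proof
      fix e assume "e \<in> P"
      then obtain a b where "e = {a, b}" "adj d a b" "a \<in> K" "b \<notin> K"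
        unfolding P_def by (rule component_bdE[OF y])
      then show "e \<in> bd d K" by (simp add: bd_iff)
    qed
    then have "finite P" using finite_bd[OF K_fin] by (rule finite_subset)
    moreover have "P \<subseteq> lattice_edges d" unfolding P_def bd_def by blast
    moreover have "(e, e') \<in> (restr (near d) P)\<^sup>*" if "e \<in> P" "e' \<in> P" for e e'
      unfolding P_def by (rule component_boundary_connected[OF y K_V K_0]) (use K_conn that in \<open>simp_all add: P_def\<close>)
    moreover have "\<forall>e\<in>P. \<omega> e \<longrightarrow> down ` e \<in> P \<and> \<not> \<omega> (down ` e)" using open_down by blast
    moreover have "\<exists>g\<in>P. g \<in> layer_edges d k \<and> \<not> \<omega> g \<and> g \<notin> bd d H"
      using open_down[OF e] by blast
    moreover have "- int m - 1 \<le> t" "t \<le> int n" using t(1,2) ax(1,3) by linarith+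
    ultimately show ?thesis
      using t(3) by (intro exI[of _ P]) blast
  qed
  show ?thesis
  proof (cases "axis_pt (int n) \<in> ?C'")
    case False
    \<comment> \<open>The connection was lost, so \<open>K\<close> contains the origin but not the
      far end point. The actual open path enters the component of the end point, which provides the
      open boundary edge.\<close>
    have xK: "axis_pt (int n + 1) \<notin> K"
      using False collapse_axis(1)[OF k(2)] unfolding K_def by simp
    have y: "axis_pt (int n + 1) \<in> lattice_vertices d - K" using xK d0 by simp
    let ?D = "component d K (axis_pt (int n + 1))"
    have ends: "axis_pt (int n + 1) \<in> ?D" "axis_pt 0 \<notin> ?D"
      using component_self component_sub[OF y] K_0 by blast+
    obtain u v where uv: "u \<notin> ?D" "v \<in> ?D" "adj d u v" "\<omega> {u, v}"
      by (rule cluster_exit[OF x, of "- ?D"]) (use ends in auto)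
    then have "{u, v} \<in> bd d ?D" by (simp add: bd_iff)
    then show ?thesis using cut[OF y _, of 0 "int n + 1"] uv(4) ends by auto
  next
    case True
    have "?C' \<subseteq> collapse k ` K"
    proof
      fix a assume a: "a \<in> ?C'"
      then have aV: "a \<in> lattice_vertices d" using cluster_sub[OF d0] by blast
      show "a \<in> collapse k ` K"
      proof (cases "a 0 \<le> k")
        case True
        then show ?thesis using a aV unfolding K_def by (intro image_eqI[of _ _ a]) (auto simp: collapse_def)
      next
        case False
        then have "collapse k (up a) = a" by (simp add: collapse_def)
        moreover have "up a \<in> lattice_vertices d" using aV d0 by (simp add: up_def)
        ultimately show ?thesis using a unfolding K_def by (intro image_eqI[of _ _ "up a"]) auto
      qed
    qed
    then have C'_fin: "finite ?C'" using K_fin finite_surj by blast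
    obtain u0 where "u0 \<in> ?C'" "u0 0 = k" using cluster_layer[OF True, of k] k by auto
    note top = top_vertex[OF C'_fin this]
    define u where "u = top_vertex k ?C'"
    define a where "a = up u"
    define b where "b = a(1 := a 1 + 1)"
    have te: "top_edge k ?C' = {a, b}" unfolding top_edge_def a_def b_def u_def by simp
    have uV: "u \<in> lattice_vertices d" using top(1) cluster_sub[OF d0] unfolding u_def by blast
    have aV: "a \<in> lattice_vertices d" using uV d0 unfolding a_def up_def by simp
    have above: "a(1 := s) \<in> lattice_vertices d - K" if "s \<ge> a 1 + 1" for s
    proof -
      have "collapse k (a(1 := s)) = u(1 := s)"
        using top(2) unfolding collapse_def a_def u_def up_def down_def by auto
      moreover have "u(1 := s) \<notin> ?C'"
        using top(3)[of "u(1 := s)"] top(2) that unfolding a_def u_def up_def by auto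
      ultimately show ?thesis using aV d2 unfolding K_def by auto
    qed
    \<comment> \<open>The connection survives, so \<open>nondel\<close> makes the top edge open. The
      ray from \<open>b\<close> in direction 1 avoids \<open>K\<close> until it is outside the box;
      hence the top edge belongs to the boundary of the unbounded component.\<close>
    let ?y = "axis_pt (R + 1)" and ?D = "component d K (axis_pt (R + 1))"
    have K_out: "K \<inter> outside_box d R = {}" using K_H H_outside by blast
    have y: "?y \<in> lattice_vertices d - K"
      using axis_outside[OF d0 R(1)] K_out unfolding outside_box_def by blast
    have aK: "a \<in> K"
      using aV top(1,2) unfolding K_def collapse_def a_def u_def by simp
    have bD: "b \<in> ?D"
    proof -
      define s where "s = max (a 1 + 1) (R + 1)"
      have "(a(1 := a 1 + 1), a(1 := s)) \<in> (restr (adj d) (lattice_vertices d - K))\<^sup>*"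
        by (rule line_path) (use above d2 in \<open>auto simp: s_def\<close>)
      then have path: "(a(1 := s), b) \<in> (restr (adj d) (lattice_vertices d - K))\<^sup>*"
        unfolding b_def by (rule restr_sym[rotated]) (rule adj_sym)
      have "a(1 := s) \<in> outside_box d R"
        using aV d2 unfolding outside_box_def s_def by (auto intro!: exI[of _ 1])
      then have "a(1 := s) \<in> ?D" by (rule outside_component[OF d2 R(1) K_out])
      then show ?thesis by (rule component_path[OF _ path]) blast
    qed
    have "adj d a b" unfolding b_def using d2 aV by (intro adj_upd) auto
    moreover have "a \<notin> ?D" using aK component_sub[OF y] by blast
    ultimately have "{a, b} \<in> bd d ?D" using bD by (simp add: bd_iff)
    moreover have "\<omega> {a, b}" using nondel[OF C'_fin True] te by simp
    moreover have "axis_pt 0 \<notin> ?D" using K_0 component_sub[OF y] by blast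
    \<comment> \<open>The outer component is met already at the first point where the negative axis
      leaves \<open>H\<close>. The crossing thus lies within the axis segment of controlled length,
      however far the cluster extends.\<close>
    moreover have "axis_pt (- int m - 1) \<in> ?D"
    proof -
      have "B \<subseteq> ?D" unfolding B by (rule component_mono) (use K_H in \<open>auto simp: H B\<close>)
      moreover have "- int m - 1 = - int (m + 1)" by simp
      then have "axis_pt (- int m - 1) \<in> B"
        using axis_exit(1) axis_in_vertices[OF d0, of "- int (m + 1)"] unfolding H by (metis DiffI)
      ultimately show ?thesis by blast
    qed
    ultimately show ?thesis using cut[OF y, of "- int m - 1" 0] by auto
  qed
qed

end

section \<open>Assembling a closed animal from the outer boundary and the cut sets\<close>

context finite_cluster
begin

definition uncontractible :: "nat set" where
  "uncontractible = {k. k \<le> n \<and> (finite (cluster d (contract d (int k) \<omega>)) \<longrightarrow>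
    axis_pt (int n) \<in> cluster d (contract d (int k) \<omega>) \<longrightarrow>
    \<omega> (top_edge (int k) (cluster d (contract d (int k) \<omega>))))}"

text \<open>The animal is the outer boundary, one cut set per uncontractible layer and a segment of
  the first axis that joins them to the root. Each cut set brings a closed edge not among those
  already counted in its layer.\<close>

lemma closed_animal:
  obtains c where "edge_animal d False c \<omega>" "2 * (d - 1) * (n + 2) + card uncontractible \<le> c"
proof -
  let ?G = "bd d H"
  \<comment> \<open>Each edge is assigned to its lowest layer. The classes are disjoint, and a
    vertical edge over layer \<open>k\<close> can be counted as a further edge of class
    \<open>k\<close> besides those inside the layer.\<close>
  define lo where "lo j = {e \<in> lattice_edges d. (\<exists>v\<in>e. v 0 = j) \<and> (\<forall>v\<in>e. j \<le> v 0)}" for j :: int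
  have lo_disj: "lo i \<inter> lo j = {}" if "i \<noteq> j" for i j
  proof (rule ccontr)
    assume "lo i \<inter> lo j \<noteq> {}"
    then obtain e where "e \<in> lo i" "e \<in> lo j" by blast
    then obtain u v where "u \<in> e" "u 0 = i" "v \<in> e" "v 0 = j" "j \<le> u 0" "i \<le> v 0" unfolding lo_def by blast
    then show False using that by simp
  qed
  have layer_lo: "layer_edges d j \<subseteq> lo j" for j
  proof
    fix e assume e: "e \<in> layer_edges d j"
    then have "e \<in> lattice_edges d" unfolding layer_edges_def by simp
    then obtain x y where "e = {x, y}" by (rule edgeE)
    then show "e \<in> lo j" using e unfolding layer_edges_def lo_def by auto
  qed
  have exit_bd: "{axis_pt (- int (m + 1)), axis_pt (- int (m + 1) + 1)} \<in> ?G"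
    using axis_exit(1) axis_exit(2)[of m] adj_axis[OF d0, of "- int (m + 1)"] by (auto simp: bd_iff)
  define cutset where "cutset k P g \<longleftrightarrow> finite P \<and> P \<subseteq> lattice_edges d \<and>
      (\<forall>e\<in>P. \<forall>e'\<in>P. (e, e') \<in> (restr (near d) P)\<^sup>*) \<and>
      (\<exists>j. - int m - 1 \<le> j \<and> j \<le> int n \<and> {axis_pt j, axis_pt (j + 1)} \<in> P) \<and>
      (\<forall>e\<in>P. \<omega> e \<longrightarrow> down ` e \<in> P \<and> \<not> \<omega> (down ` e)) \<and>
      g \<in> P \<and> g \<in> lo (int k) \<and> \<not> \<omega> g \<and> g \<notin> ?G \<inter> layer_edges d (int k)" for k P g
  have ex: "\<exists>P g. cutset k P g"
    if k: "k \<in> uncontractible" for k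
  proof (cases "\<exists>u. u 0 = int k \<and> {u, up u} \<in> ?G")
    case True
    \<comment> \<open>A vertical boundary edge over layer \<open>k\<close> is itself the extra
      closed edge, so the outer boundary can serve as the cut set.\<close>
    then obtain u where u: "u 0 = int k" "{u, up u} \<in> ?G" by blast
    from exit_bd have 1: "\<exists>j. - int m - 1 \<le> j \<and> j \<le> int n \<and> {axis_pt j, axis_pt (j + 1)} \<in> ?G"
      by (intro exI[of _ "- int (m + 1)"]) auto
    have 2: "{u, up u} \<in> lo (int k)" "{u, up u} \<notin> layer_edges d (int k)"
      using u unfolding lo_def layer_edges_def bd_def by auto
    have 3: "finite ?G" "?G \<subseteq> lattice_edges d" using finite_bd[OF finite_H] unfolding bd_def by auto
    have "cutset k ?G {u, up u}"
      unfolding cutset_def using 1 2 3 bd_H_connected bd_H_closed u(2) by simp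
    then show ?thesis by blast
  next
    case False
    have kk: "0 \<le> int k" "int k \<le> int n" using k unfolding uncontractible_def by auto
    have long: "{u, up u} \<notin> ?G" if "u 0 = int k" for u
      using False that by blast
    have nondel: "\<omega> (top_edge (int k) (cluster d (contract d (int k) \<omega>)))"
      if "finite (cluster d (contract d (int k) \<omega>))" "axis_pt (int n) \<in> cluster d (contract d (int k) \<omega>)"
      using k that unfolding uncontractible_def by blast
    have "\<exists>P. finite P \<and> P \<subseteq> lattice_edges d \<and> (\<forall>e\<in>P. \<forall>e'\<in>P. (e, e') \<in> (restr (near d) P)\<^sup>*) \<and>
      (\<exists>j. - int m - 1 \<le> j \<and> j \<le> int n \<and> {axis_pt j, axis_pt (j + 1)} \<in> P) \<and>
      (\<forall>e\<in>P. \<omega> e \<longrightarrow> down ` e \<in> P \<and> \<not> \<omega> (down ` e)) \<and>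
      (\<exists>g\<in>P. g \<in> layer_edges d (int k) \<and> \<not> \<omega> g \<and> g \<notin> ?G)"
      by (rule cut_set[OF kk]) (erule long, erule (1) nondel)
    then obtain P where P: "finite P" "P \<subseteq> lattice_edges d" "\<forall>e\<in>P. \<forall>e'\<in>P. (e, e') \<in> (restr (near d) P)\<^sup>*"
      "\<exists>j. - int m - 1 \<le> j \<and> j \<le> int n \<and> {axis_pt j, axis_pt (j + 1)} \<in> P"
      "\<forall>e\<in>P. \<omega> e \<longrightarrow> down ` e \<in> P \<and> \<not> \<omega> (down ` e)"
      "\<exists>g\<in>P. g \<in> layer_edges d (int k) \<and> \<not> \<omega> g \<and> g \<notin> ?G"
      by (elim exE) (elim conjE, rule that)
    from P(6) obtain g where g: "g \<in> P" "g \<in> layer_edges d (int k)" "\<not> \<omega> g" "g \<notin> ?G" by blast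
    have "g \<in> lo (int k)" "g \<notin> ?G \<inter> layer_edges d (int k)" using g layer_lo[of "int k"] by auto
    with P(1-5) g(1,3) have "cutset k P g" unfolding cutset_def by (intro conjI)
    then show ?thesis by blast
  qed
  have "\<exists>P g. \<forall>k\<in>uncontractible. cutset k (P k) (g k)"
    using ex by metis
  then obtain P g where "\<And>k. k \<in> uncontractible \<Longrightarrow> cutset k (P k) (g k)" by blast
  note Pg = this[unfolded cutset_def]
  have P_fin: "finite (P k)" and P_edges: "P k \<subseteq> lattice_edges d"
    and P_axis: "\<exists>j. - int m - 1 \<le> j \<and> j \<le> int n \<and> {axis_pt j, axis_pt (j + 1)} \<in> P k"
    and g_P: "g k \<in> P k" and g_lo: "g k \<in> lo (int k)" and g_closed: "\<not> \<omega> (g k)"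
    and g_new: "g k \<notin> ?G \<inter> layer_edges d (int k)"
    if "k \<in> uncontractible" for k
    using Pg[OF that] by simp_all
  have P_conn: "(e, e') \<in> (restr (near d) (P k))\<^sup>*" if "k \<in> uncontractible" "e \<in> P k" "e' \<in> P k" for k e e'
    using Pg[OF that(1)] that(2,3) by simp
  have P_down: "down ` e \<in> P k \<and> \<not> \<omega> (down ` e)" if "k \<in> uncontractible" "e \<in> P k" "\<omega> e" for k e
    using Pg[OF that(1)] that(2,3) by simp
  have fU: "finite uncontractible" unfolding uncontractible_def by simp
  define Ax where "Ax = (\<lambda>j. {axis_pt j, axis_pt (j + 1)}) ` {- int m - 1..int n}"
  define S where "S = ?G \<union> (\<Union>k\<in>uncontractible. P k) \<union> Ax"
  define Cl where "Cl = {e \<in> S. \<omega> e = False}"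
  have G_fin: "finite ?G" by (rule finite_bd[OF finite_H])
  have S_fin: "finite S" unfolding S_def Ax_def using G_fin fU P_fin by auto
  then have Cl_fin: "finite Cl" unfolding Cl_def by simp
  have Ax_edges: "Ax \<subseteq> lattice_edges d" unfolding Ax_def using adj_axis[OF d0] by blast
  have S_edges: "S \<subseteq> lattice_edges d" unfolding S_def using P_edges Ax_edges by (auto simp: bd_def dest: subsetD)
  have G_Cl: "?G \<subseteq> Cl" unfolding Cl_def S_def using bd_H_closed by blast
  have axS: "{axis_pt j, axis_pt (j + 1)} \<in> S" if "- int m - 1 \<le> j" "j \<le> int n" for j
    unfolding S_def Ax_def using that by auto
  have root: "root_edge \<in> S" using axS[of 0] by simp
  have ax_step: "({axis_pt j, axis_pt (j + 1)}, {axis_pt (j + 1), axis_pt (j + 1 + 1)}) \<in> restr (near d) S"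
    if "- int m - 1 \<le> j" "j + 1 \<le> int n" for j
    using axS[of j] axS[of "j + 1"] that by (auto simp: near_def)
  have ax_conn: "({axis_pt i, axis_pt (i + 1)}, {axis_pt j, axis_pt (j + 1)}) \<in> (restr (near d) S)\<^sup>*"
    if "- int m - 1 \<le> i" "i \<le> j" "j \<le> int n" for i j
    using that(2,3)
  proof (induction j rule: int_ge_induct)
    case (step j)
    then have "({axis_pt i, axis_pt (i + 1)}, {axis_pt j, axis_pt (j + 1)}) \<in> (restr (near d) S)\<^sup>*" by simp
    moreover have "({axis_pt j, axis_pt (j + 1)}, {axis_pt (j + 1), axis_pt (j + 1 + 1)}) \<in> restr (near d) S"
      by (rule ax_step) (use step that(1) in auto)
    ultimately show ?case by (rule rtrancl_into_rtrancl)
  qed simp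
  have ax_root: "(root_edge, {axis_pt j, axis_pt (j + 1)}) \<in> (restr (near d) S)\<^sup>*"
    if "- int m - 1 \<le> j" "j \<le> int n" for j
  proof (cases "0 \<le> j")
    case True
    then show ?thesis using ax_conn[of 0 j] that by simp
  next
    case False
    then have "({axis_pt j, axis_pt (j + 1)}, root_edge) \<in> (restr (near d) S)\<^sup>*"
      using ax_conn[of j 0] that by simp
    then show ?thesis by (rule restr_sym[rotated]) (rule near_sym)
  qed
  have piece: "(root_edge, e) \<in> (restr (near d) S)\<^sup>*"
    if "e \<in> Q" "Q \<subseteq> S" "\<And>e e'. e \<in> Q \<Longrightarrow> e' \<in> Q \<Longrightarrow> (e, e') \<in> (restr (near d) Q)\<^sup>*"
      "- int m - 1 \<le> j" "j \<le> int n" "{axis_pt j, axis_pt (j + 1)} \<in> Q" for e Q j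
    using ax_root[OF that(4,5)] restr_mono[OF that(2) that(3)[OF that(6,1)]] by (rule rtrancl_trans)
  have conn: "(root_edge, e) \<in> (restr (near d) S)\<^sup>*" if e: "e \<in> S" for e
  proof -
    consider "e \<in> ?G" | k where "k \<in> uncontractible" "e \<in> P k" | j where "- int m - 1 \<le> j" "j \<le> int n" "e = {axis_pt j, axis_pt (j + 1)}"
      using e unfolding S_def Ax_def by auto
    then show ?thesis
    proof cases
      case 1
      show ?thesis
      proof (rule piece[OF 1 _ _ _ _ exit_bd])
        show "?G \<subseteq> S" unfolding S_def by blast
        show "(e, e') \<in> (restr (near d) ?G)\<^sup>*" if "e \<in> ?G" "e' \<in> ?G" for e e'
          using that by (rule bd_H_connected)
      qed auto
    next
      case 2
      obtain j where j: "- int m - 1 \<le> j" "j \<le> int n" "{axis_pt j, axis_pt (j + 1)} \<in> P k" using P_axis[OF 2(1)] by blast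
      have "P k \<subseteq> S" using 2(1) unfolding S_def by blast
      from 2(2) this P_conn[OF 2(1)] j show ?thesis by (rule piece)
    next
      case 3
      then show ?thesis using ax_root by simp
    qed
  qed
  define c where "c = card Cl"
  \<comment> \<open>Every open edge of a cut set is the upward shift of a closed edge of
    \<open>S\<close>. The axis edges, open or closed, are bounded by the layers that contain a
    closed boundary edge.\<close>
  have upper: "card S \<le> 4 * c"
  proof -
    have "S \<subseteq> Cl \<union> (`) up ` Cl \<union> Ax"
    proof
      fix e assume e: "e \<in> S"
      show "e \<in> Cl \<union> (`) up ` Cl \<union> Ax"
      proof (cases "e \<in> Ax \<or> \<not> \<omega> e")
        case True
        then show ?thesis using e unfolding Cl_def by blast
      next
        case False
        then obtain k where k: "k \<in> uncontractible" "e \<in> P k"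
          using e bd_H_closed unfolding S_def by blast
        then have "down ` e \<in> P k" "\<not> \<omega> (down ` e)" using P_down[OF k] False by blast+
        then have "down ` e \<in> Cl" using k(1) unfolding Cl_def S_def by blast
        moreover have "e = up ` (down ` e)" by (simp add: image_image)
        ultimately show ?thesis by blast
      qed
    qed
    then have "card S \<le> card (Cl \<union> (`) up ` Cl \<union> Ax)"
      using Cl_fin by (intro card_mono) (auto simp: Ax_def)
    also have "\<dots> \<le> card Cl + card ((`) up ` Cl) + card Ax"
      using card_Un_le[of "Cl \<union> (`) up ` Cl" Ax] card_Un_le[of Cl "(`) up ` Cl"] by linarith
    also have "card ((`) up ` Cl) \<le> card Cl" using Cl_fin by (rule card_image_le)
    also have "card Ax \<le> card {- int m - 1..int n}" unfolding Ax_def by (rule card_image_le) simp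
    \<comment> \<open>From edges to layers: the axis edge starting at \<open>j\<close> is matched
      with layer \<open>j + 1\<close>, and the filled cluster meets all layers from
      \<open>- m\<close> to \<open>n + 1\<close>.\<close>
    also have "card {- int m - 1..int n} = card {- int m..int n + 1}" by simp
    also have "\<dots> \<le> card Cl"
    proof -
      have "\<exists>e. e \<in> ?G \<inter> layer_edges d j" if j: "j \<in> {- int m..int n + 1}" for j
      proof -
        obtain v where v: "v \<in> H" "v 0 = j" by (rule H_layer[of j]) (use j in auto)
        have "0 < card (?G \<inter> layer_edges d j)"
          using card_layer_boundary[OF H_outside finite_H H_sub v] d2 by linarith
        then show ?thesis by (auto simp: card_gt_0_iff)
      qed
      then obtain h where h: "\<And>j. j \<in> {- int m..int n + 1} \<Longrightarrow> h j \<in> ?G \<inter> layer_edges d j" by metis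
      have "inj_on h {- int m..int n + 1}"
      proof (rule inj_onI)
        fix i j assume ij: "i \<in> {- int m..int n + 1}" "j \<in> {- int m..int n + 1}" "h i = h j"
        have "h i \<in> lo i" "h j \<in> lo j" using h[OF ij(1)] h[OF ij(2)] layer_lo by blast+
        then show "i = j" using lo_disj[of i j] ij(3) by auto
      qed
      moreover have "h ` {- int m..int n + 1} \<subseteq> Cl" using h G_Cl by blast
      ultimately show ?thesis using Cl_fin by (rule card_inj_on_le)
    qed
    finally show ?thesis unfolding c_def by simp
  qed
  have lower: "2 * (d - 1) * (n + 2) + card uncontractible \<le> c"
  proof -
    define X where "X j = (?G \<inter> layer_edges d (int j)) \<union> (if j \<in> uncontractible then {g j} else {})" for j
    have X_fin: "finite (X j)" for j unfolding X_def using G_fin by auto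
    have X_card: "2 * (d - 1) + (if j \<in> uncontractible then 1 else 0) \<le> card (X j)" if j: "j \<le> n + 1" for j
    proof -
      obtain v where v: "v \<in> H" "v 0 = int j" by (rule H_layer[of "int j"]) (use j in auto)
      have "2 * (d - 1) \<le> card (?G \<inter> layer_edges d (int j))"
        by (rule card_layer_boundary[OF H_outside finite_H H_sub v])
      then show ?thesis using g_new[of j] G_fin unfolding X_def by (simp add: card_insert_if)
    qed
    have X_lo: "X j \<subseteq> lo (int j)" for j using layer_lo[of "int j"] g_lo[of j] unfolding X_def by auto
    have X_Cl: "X j \<subseteq> Cl" for j
    proof -
      have "g j \<in> Cl" if "j \<in> uncontractible"
        using g_P[OF that] g_closed[OF that] that unfolding Cl_def S_def by blast
      then show ?thesis using G_Cl unfolding X_def by auto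
    qed
    have sum: "(\<Sum>j\<le>n + 1. (if j \<in> uncontractible then 1 else 0 :: nat)) = card uncontractible"
    proof -
      have "uncontractible \<subseteq> {..n + 1}" unfolding uncontractible_def by auto
      then have "(\<Sum>j\<le>n + 1. (if j \<in> uncontractible then 1 else 0)) = (\<Sum>j\<in>uncontractible. 1 :: nat)"
        by (intro sum.mono_neutral_cong_right) auto
      then show ?thesis by (simp only: card_eq_sum)
    qed
    have "2 * (d - 1) * (n + 2) + card uncontractible = (\<Sum>j\<le>n + 1. 2 * (d - 1) + (if j \<in> uncontractible then 1 else 0))"
      by (subst sum.distrib) (simp only: sum, simp)
    also have "\<dots> \<le> (\<Sum>j\<le>n + 1. card (X j))" using X_card by (intro sum_mono) simp
    also have "\<dots> = card (\<Union>j\<le>n + 1. X j)"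
    proof (rule card_UN_disjoint[symmetric])
      have "X i \<inter> X j = {}" if "i \<noteq> j" for i j
        using X_lo[of i] X_lo[of j] lo_disj[of "int i" "int j"] that by auto
      then show "\<forall>i\<in>{..n + 1}. \<forall>j\<in>{..n + 1}. i \<noteq> j \<longrightarrow> X i \<inter> X j = {}" by blast
    qed (use X_fin in auto)
    also have "\<dots> \<le> card Cl" using X_Cl Cl_fin by (intro card_mono) auto
    finally show ?thesis unfolding c_def .
  qed
  have "edge_animal d False c \<omega>"
    unfolding edge_animal_def
    by (rule exI[of _ S]) (use S_fin S_edges root conn upper in \<open>simp add: c_def Cl_def\<close>)
  then show thesis using that lower by blast
qed

end

subsection \<open>Large \<open>p\<close>\<close>

lemma truncated_eq:
  "0 < d \<Longrightarrow> connection_event d p origin (axis_point n) \<inter> finite_cluster_event d p =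
    {\<omega> \<in> space (percolation d p). axis_pt (int n) \<in> cluster d \<omega> \<and> finite (cluster d \<omega>)}"
  unfolding connection_event_iff by (auto simp: finite_cluster_event_iff)

lemma sets_truncated:
  "0 < d \<Longrightarrow> connection_event d p origin (axis_point n) \<inter> finite_cluster_event d p \<in> sets (percolation d p)"
  using sets_connection_event sets_finite_cluster_event by blast

text \<open>The straight segment is open and its entire edge boundary closed, so the cluster is
  exactly the segment. The exponent counts \<open>2 * (d - 1)\<close> sideways edges at each of the
  \<open>n + 1\<close> vertices and the two edges prolonging the segment.\<close>

lemma truncated_two_point_ge:
  assumes d: "d \<ge> 1" and p: "0 \<le> p" "p \<le> 1"
  shows "p ^ n * (1 - p) ^ (2 * (d - 1) * (n + 1) + 2) \<le> truncated_two_point d p n"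
proof -
  let ?P = "percolation d p"
  have d0: "0 < d" using d by simp
  interpret P: prob_space ?P by (rule prob_space_percolation)
  define seg where "seg = (\<lambda>j. axis_pt (int j)) ` {..n}"
  define Op where "Op = (\<lambda>j. {axis_pt (int j), axis_pt (int j + 1)}) ` {..<n}"
  define L where "L = 2 * (d - 1) * (n + 1) + 2"
  have seg_fin: "finite seg" unfolding seg_def by simp
  have Op: "finite Op" "Op \<subseteq> lattice_edges d" unfolding Op_def using adj_axis[OF d0] by auto
  have Op_card: "card Op \<le> n" unfolding Op_def using card_image_le[of "{..<n}"] by fastforce
  have Op_bd: "Op \<inter> bd d seg = {}"
  proof -
    have "{axis_pt (int j), axis_pt (int j + 1)} \<notin> bd d seg" if "j < n" for j
      using that unfolding bd_iff seg_def by (auto simp: image_iff intro: bexI[of _ "Suc j"] simp: add.commute)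
    then show ?thesis unfolding Op_def by blast
  qed
  have bd_card: "card (bd d seg) \<le> L"
  proof -
    define F where "F = (\<lambda>(j, i, s). {axis_pt (int j), (axis_pt (int j))(i := s)}) ` ({..n} \<times> {1..<d} \<times> {1, - 1})"
    have "bd d seg \<subseteq> F \<union> {{axis_pt (- 1), axis_pt 0}, {axis_pt (int n), axis_pt (int n + 1)}}"
    proof
      fix e assume "e \<in> bd d seg"
      then obtain x y where e: "e = {x, y}" "adj d x y" "x \<in> seg" "y \<notin> seg" by (rule bdE)
      obtain j where j: "j \<le> n" "x = axis_pt (int j)" using e(3) unfolding seg_def by auto
      obtain i s where s: "i < d" "s \<in> {1, - 1}" "y = x(i := x i + s)" using e(2) unfolding adj_iff by blast
      show "e \<in> F \<union> {{axis_pt (- 1), axis_pt 0}, {axis_pt (int n), axis_pt (int n + 1)}}"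
      proof (cases "i = 0")
        case False
        then have "y = (axis_pt (int j))(i := s)" using s j by simp
        then show ?thesis using e(1) j s False unfolding F_def by (auto intro!: image_eqI[of _ _ "(j, i, s)"])
      next
        case True
        then have y: "y = axis_pt (int j + s)" using s(3) j(2) by (auto simp: axis_pt_def)
        have "\<not> (0 \<le> int j + s \<and> int j + s \<le> int n)"
        proof
          assume "0 \<le> int j + s \<and> int j + s \<le> int n"
          then have "y = axis_pt (int (nat (int j + s)))" "nat (int j + s) \<le> n" using y by auto
          then show False using e(4) unfolding seg_def by blast
        qed
        then consider "j = 0" "s = - 1" | "j = n" "s = 1" using s(2) j(1) by auto
        then show ?thesis using e(1) j(2) y by cases auto
      qed
    qed
    then have "card (bd d seg) \<le> card (F \<union> {{axis_pt (- 1), axis_pt 0}, {axis_pt (int n), axis_pt (int n + 1)}})"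
      by (intro card_mono) (auto simp: F_def)
    also have "\<dots> \<le> card F + card {{axis_pt (- 1), axis_pt 0}, {axis_pt (int n), axis_pt (int n + 1)}}"
      by (rule card_Un_le)
    also have "\<dots> \<le> card F + 2" by (intro add_left_mono) (simp add: card_insert_if)
    also have "card F \<le> card ({..n} \<times> {1..<d} \<times> {1, - 1 :: int})"
      unfolding F_def by (rule card_image_le) simp
    also have "\<dots> = 2 * (d - 1) * (n + 1)" by (simp add: card_cartesian_product)
    finally show ?thesis unfolding L_def by simp
  qed
  define T where "T = Op \<union> bd d seg"
  have T: "finite T" "T \<subseteq> lattice_edges d" unfolding T_def using Op finite_bd[OF seg_fin] by (auto simp: bd_def)
  have "p ^ n * (1 - p) ^ L \<le> p ^ card Op * (1 - p) ^ card (bd d seg)"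
    using p Op_card bd_card by (intro mult_mono power_decreasing) auto
  also have "\<dots> = (\<Prod>e\<in>Op. pmf (bernoulli_pmf p) (e \<in> Op)) * (\<Prod>e\<in>bd d seg. pmf (bernoulli_pmf p) (e \<in> Op))"
  proof -
    have "(\<Prod>e\<in>bd d seg. pmf (bernoulli_pmf p) (e \<in> Op)) = (\<Prod>e\<in>bd d seg. 1 - p)"
    proof (intro prod.cong refl)
      fix e assume "e \<in> bd d seg"
      then have "e \<notin> Op" using Op_bd by blast
      then show "pmf (bernoulli_pmf p) (e \<in> Op) = 1 - p" using p by simp
    qed
    then show ?thesis using p by simp
  qed
  also have "\<dots> = (\<Prod>e\<in>T. pmf (bernoulli_pmf p) (e \<in> Op))"
    unfolding T_def using Op(1) finite_bd[OF seg_fin] Op_bd by (intro prod.union_disjoint[symmetric])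
  also have "\<dots> = measure ?P {\<omega> \<in> space ?P. \<forall>e\<in>T. \<omega> e = (e \<in> Op)}"
    by (rule measure_cylinder[OF T, symmetric])
  also have "\<dots> \<le> truncated_two_point d p n"
    unfolding truncated_two_point_def
  proof (rule P.finite_measure_mono[OF _ sets_truncated[OF d0]])
    show "{\<omega> \<in> space ?P. \<forall>e\<in>T. \<omega> e = (e \<in> Op)} \<subseteq> connection_event d p origin (axis_point n) \<inter> finite_cluster_event d p"
    proof
      fix \<omega> assume \<omega>: "\<omega> \<in> {\<omega> \<in> space ?P. \<forall>e\<in>T. \<omega> e = (e \<in> Op)}"
      then have op: "\<omega> e" if "e \<in> Op" for e using that unfolding T_def by blast
      have cl: "\<not> \<omega> e" if "e \<in> bd d seg" for e using that \<omega> Op_bd unfolding T_def by blast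
      have "axis_pt (int j) \<in> cluster d \<omega>" if "j \<le> n" for j
        using that
      proof (induction j)
        case (Suc j)
        then have "{axis_pt (int j), axis_pt (int j + 1)} \<in> Op" unfolding Op_def by auto
        then show ?case using Suc op cluster_step[OF _ adj_axis[OF d0], of "int j" \<omega>] by (simp add: add.commute)
      qed (simp add: axis_0_cluster)
      then have "axis_pt (int n) \<in> cluster d \<omega>" by simp
      moreover have "cluster d \<omega> \<subseteq> seg"
      proof
        fix w assume w: "w \<in> cluster d \<omega>"
        have 0: "axis_pt 0 \<in> seg" unfolding seg_def by (intro image_eqI[of _ _ 0]) auto
        show "w \<in> seg"
        proof (rule ccontr)
          assume "w \<notin> seg"
          then obtain y z where "y \<in> seg" "z \<notin> seg" "adj d y z" "\<omega> {y, z}"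
            by (rule cluster_exit[OF w 0])
          then show False using cl[of "{y, z}"] by (simp add: bd_iff)
        qed
      qed
      then have "finite (cluster d \<omega>)" using seg_fin by (rule finite_subset)
      ultimately show "\<omega> \<in> connection_event d p origin (axis_point n) \<inter> finite_cluster_event d p"
        using \<omega> unfolding truncated_eq[OF d0] by blast
    qed
  qed
  finally show ?thesis unfolding L_def .
qed

text \<open>In \<open>M\<close>, the first term counts boundary edges in the layers 0 to
  \<open>n + 1\<close>. The second is half of \<open>n + 1\<close> rounded up, a lower bound for the
  number of uncontractible layers when fewer than half can be contracted.\<close>

lemma truncated_two_point_Suc_le:
  fixes n :: nat
  assumes d: "d \<ge> 2" and small: "animal_const d * (1 - p) \<le> 1 / 2" and p: "0 \<le> p" "p \<le> 1"
  defines "M \<equiv> 2 * (d - 1) * (n + 2) + (n + 2) div 2"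
  shows "truncated_two_point d p (n + 1) \<le>
    2 * ((1 - p) * truncated_two_point d p n) + 2 * (animal_const d * (1 - p)) ^ M"
proof -
  let ?P = "percolation d p"
  interpret P: prob_space ?P by (rule prob_space_percolation)
  have d0: "0 < d" using d by simp
  have pf: "pmf (bernoulli_pmf p) False = 1 - p" using p by simp
  define tr where "tr m = connection_event d p origin (axis_point m) \<inter> finite_cluster_event d p" for m
  have tr: "tr m \<in> sets ?P" for m unfolding tr_def by (rule sets_truncated[OF d0])
  define T where "T A = {\<omega> \<in> space ?P. cluster d \<omega> = A}" for A
  \<comment> \<open>The pieces are indexed by the whole contracted cluster, so
    \<open>top_edge\<close> is fixed on each. Finiteness of the clusters keeps the index set
    countable; a vertex in layer \<open>k\<close> guarantees that the top vertex exists.\<close>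
  define Z where "Z k = {A. finite A \<and> A \<subseteq> lattice_vertices d \<and> axis_pt (int n) \<in> A \<and> (\<exists>u\<in>A. u 0 = k)}" for k :: int
  define D where "D k = {\<omega> \<in> space ?P. \<exists>A\<in>Z (int k).
    (\<lambda>e\<in>lattice_edges d. \<omega> (expand (int k) e)) \<in> T A \<and> \<omega> (top_edge (int k) A) = False}" for k :: nat
  have DD: "D k \<in> sets ?P \<and> measure ?P (D k) \<le> pmf (bernoulli_pmf p) False * measure ?P (tr n)" for k
    unfolding D_def
  proof (rule measure_contraction_le[OF inj_expand])
    show "expand (int k) ` lattice_edges d \<subseteq> lattice_edges d" using expand_edge[OF d0] by auto
    show "top_edge (int k) A \<in> lattice_edges d - expand (int k) ` lattice_edges d" if A: "A \<in> Z (int k)" for A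
    proof -
      obtain u where "finite A" "u \<in> A" "u 0 = int k" using A unfolding Z_def by blast
      note top = top_vertex[OF this]
      define a where "a = up (top_vertex (int k) A)"
      have "a \<in> lattice_vertices d" using top(1) A d0 unfolding a_def Z_def up_def by auto
      then have "adj d a (a(1 := a 1 + 1))" using d by (intro adj_upd) auto
      moreover have "a 0 = int k + 1" using top(2) unfolding a_def by simp
      then have "{a, a(1 := a 1 + 1)} \<notin> expand (int k) ` lattice_edges d" by (intro not_in_expand) auto
      ultimately show ?thesis unfolding top_edge_def a_def by blast
    qed
    show "countable (Z (int k))"
      unfolding Z_def by (rule countable_subset[OF _ countable_Collect_finite_subset[OF countable_vertices[of d]]]) auto
    show "disjoint_family_on T (Z (int k))" unfolding disjoint_family_on_def T_def by blast
    show "(\<Union>A\<in>Z (int k). T A) \<subseteq> tr n" unfolding T_def Z_def tr_def truncated_eq[OF d0] by blast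
    show "T A \<in> sets ?P" for A unfolding T_def by (rule sets_cluster_eq[OF d0])
    show "tr n \<in> sets ?P" by (rule tr)
  qed
  have M1: "1 \<le> M" unfolding M_def by simp
  obtain U where U: "U \<in> sets ?P"
    "\<And>\<omega> c. \<omega> \<in> space ?P \<Longrightarrow> c \<ge> M \<Longrightarrow> edge_animal d False c \<omega> \<Longrightarrow> \<omega> \<in> U"
    "measure ?P U \<le> 2 * (animal_const d * pmf (bernoulli_pmf p) False) ^ M"
    by (rule large_edge_animal_prob[OF M1, of d p False]) (use d small pf in auto)
  have "P.prob (tr (n + 1)) \<le> 2 * (pmf (bernoulli_pmf p) False * measure ?P (tr n)) + P.prob U"
  proof (rule P.markov_counting[OF tr U(1) conjunct1[OF DD] conjunct2[OF DD]])
    fix \<omega> assume "\<omega> \<in> tr (n + 1)"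
    then have \<omega>: "\<omega> \<in> space ?P" "axis_pt (int n + 1) \<in> cluster d \<omega>" "finite (cluster d \<omega>)"
      unfolding tr_def truncated_eq[OF d0] by (auto simp: add.commute)
    obtain R where R: "0 \<le> R" "cluster d \<omega> \<inter> outside_box d R = {}" by (rule finite_imp_bounded[OF \<omega>(3)])
    interpret finite_cluster d \<omega> n R "component d (cluster d \<omega>) (axis_pt (R + 1))"
      "lattice_vertices d - component d (cluster d \<omega>) (axis_pt (R + 1))"
      "LEAST t. axis_pt (- int (t + 1)) \<notin> lattice_vertices d - component d (cluster d \<omega>) (axis_pt (R + 1))"
      by unfold_locales (use d \<omega> R in auto)
    show "\<omega> \<in> U \<or> n + 1 \<le> 2 * card {k. k \<le> n \<and> \<omega> \<in> D k}"
    proof (cases "n + 1 \<le> 2 * card {k. k \<le> n \<and> \<omega> \<in> D k}")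
      case False
      have "k \<in> uncontractible" if k: "k \<le> n" "\<omega> \<notin> D k" for k
      proof -
        let ?C' = "cluster d (contract d (int k) \<omega>)"
        have "\<omega> (top_edge (int k) ?C')" if C': "finite ?C'" "axis_pt (int n) \<in> ?C'"
        proof -
          obtain u where "u \<in> ?C'" "u 0 = int k" using cluster_layer[OF C'(2), of "int k"] k(1) by auto
          then have "?C' \<in> Z (int k)" using C' cluster_sub[OF d0] unfolding Z_def by blast
          moreover have "contract d (int k) \<omega> \<in> T ?C'" unfolding T_def using contract_space by simp
          ultimately show ?thesis using k(2) \<omega>(1) unfolding D_def contract_def by blast
        qed
        then show ?thesis using k(1) unfolding uncontractible_def by blast
      qed
      then have "{..n} - {k. k \<le> n \<and> \<omega> \<in> D k} \<subseteq> uncontractible" by auto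
      then have "card ({..n} - {k. k \<le> n \<and> \<omega> \<in> D k}) \<le> card uncontractible"
        by (rule card_mono[rotated]) (simp add: uncontractible_def)
      moreover have "card ({..n} - {k. k \<le> n \<and> \<omega> \<in> D k}) = n + 1 - card {k. k \<le> n \<and> \<omega> \<in> D k}"
        by (subst card_Diff_subset) auto
      ultimately have "(n + 2) div 2 \<le> card uncontractible" using False by linarith
      then show ?thesis using closed_animal U(2)[OF \<omega>(1)] unfolding M_def by (metis add_left_mono order.trans)
    qed blast
  qed
  then show ?thesis using U(3) unfolding truncated_two_point_def tr_def pf by linarith
qed

lemma truncated_two_point_strict_decreasing:
  assumes d: "d \<ge> 2"
  shows "\<exists>p''::real. 0 \<le> p'' \<and> p'' < 1 \<and>
    (\<forall>p n. p'' < p \<and> p < 1 \<longrightarrow> truncated_two_point d p n > truncated_two_point d p (n + 1))"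
proof -
  let ?A = "animal_const d"
  have A: "?A \<ge> 1" using animal_const_ge_1 d by simp
  \<comment> \<open>The exponent stems from \<open>L + N \<le> (4 * d + 1) * N\<close>: the animal
    constant, raised to the number of all edges, is absorbed by the \<open>N\<close> surplus
    edges.\<close>
  define a where "a = ?A ^ (4 * d + 1)"
  have a: "1 \<le> a" "?A \<le> a" unfolding a_def by (rule one_le_power[OF A], rule self_le_power[OF A]) simp
  \<comment> \<open>With q = 1 - p this gives q and a q at most 1/32; the two summands are then at
    most 2/32 and 2/8 of the truncated function at \<open>n\<close>.\<close>
  define p'' where "p'' = 1 - 1 / (32 * a)"
  have "0 \<le> p''" "p'' < 1" unfolding p''_def using a(1) by (simp_all add: divide_le_eq)
  moreover have "truncated_two_point d p n > truncated_two_point d p (n + 1)" if p: "p'' < p" "p < 1" for p n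
  proof -
    define q where "q = 1 - p"
    have q: "0 < q" "a * q \<le> 1 / 32"
    proof -
      show "0 < q" using p unfolding q_def by simp
      have "q \<le> 1 / (32 * a)" using p unfolding q_def p''_def by simp
      then show "a * q \<le> 1 / 32" using a(1) by (simp add: le_divide_eq mult_ac)
    qed
    have "1 * q \<le> a * q" "?A * q \<le> a * q" using a q(1) by (intro mult_right_mono; simp)+
    then have q32: "q \<le> 1 / 32" and Aq: "?A * q \<le> 1 / 32" using q(2) by linarith+
    have Aq0: "0 \<le> ?A * q" using A q(1) by simp
    define N where "N = (n + 2) div 2"
    define L where "L = 2 * (d - 1) * (n + 1) + 2"
    define M where "M = 2 * (d - 1) * (n + 2) + N"
    have N: "1 \<le> N" "n + 1 \<le> 2 * N" unfolding N_def by auto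
    obtain d' where d': "d = Suc (Suc d')" using d by (metis Suc_1 Suc_le_D add_2_eq_Suc le_Suc_ex)
    \<comment> \<open>The additional layer in \<open>M\<close> contributes
      \<open>2 * (d - 1)\<close> edges, which pays for the two end edges in \<open>L\<close> because
      \<open>d \<ge> 2\<close>.\<close>
    have LM: "L + N \<le> M" unfolding L_def M_def d' by (simp add: algebra_simps)
    have LN: "L + N \<le> (4 * d + 1) * N"
    proof -
      have "2 * (d - 1) * (n + 1) \<le> 2 * (d - 1) * (2 * N)" using N(2) by (rule mult_le_mono2)
      then have "L \<le> 4 * (d - 1) * N + 2 * N" using N(1) unfolding L_def by (simp add: mult.assoc)
      also have "\<dots> \<le> 4 * d * N" unfolding d' by (simp add: algebra_simps)
      finally show ?thesis by (simp add: algebra_simps)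
    qed
    have le: "truncated_two_point d p (n + 1) \<le> 2 * (q * truncated_two_point d p n) + 2 * (?A * q) ^ M"
      using truncated_two_point_Suc_le[OF d, of p n] Aq q32 p(2) unfolding q_def M_def N_def by simp
    have "(?A * q) ^ M \<le> (?A * q) ^ (L + N)" using Aq Aq0 LM by (intro power_decreasing) auto
    also have "\<dots> = ?A ^ (L + N) * (q ^ L * q ^ N)" by (simp add: power_mult_distrib power_add)
    also have "\<dots> \<le> ?A ^ ((4 * d + 1) * N) * (q ^ L * q ^ N)"
      using A LN q(1) by (intro mult_right_mono power_increasing) auto
    also have "\<dots> = q ^ L * (a * q) ^ N"
      unfolding a_def power_mult_distrib power_mult by (rule mult.left_commute)
    also have "\<dots> \<le> q ^ L * (1 / 32) ^ N"
      using q a(1) by (intro mult_left_mono power_mono) auto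
    \<comment> \<open>Since \<open>n + 1 \<le> 2 * N\<close>, the factor \<open>(1 / 4) ^ N\<close>
      is at most \<open>(1 / 2) ^ n\<close>, hence at most \<open>p ^ n\<close>, which pays for the
      open edges of the straight segment. The other factor leaves 1/8.\<close>
    also have "(1 / 32 :: real) ^ N = (1 / 8) ^ N * (1 / 4) ^ N"
      by (simp flip: power_mult_distrib)
    also have "q ^ L * ((1 / 8) ^ N * (1 / 4) ^ N) \<le> q ^ L * ((1 / 8) * p ^ n)"
    proof (intro mult_left_mono mult_mono)
      show "(1 / 8 :: real) ^ N \<le> 1 / 8" using power_decreasing[of 1 N "1 / 8 :: real"] N(1) by simp
      have "(1 / 4 :: real) ^ N = (1 / 2) ^ (2 * N)" by (simp add: power_mult power2_eq_square)
      also have "\<dots> \<le> (1 / 2) ^ n" using N(2) by (intro power_decreasing) auto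
      also have "\<dots> \<le> p ^ n" using q32 unfolding q_def by (intro power_mono) auto
      finally show "(1 / 4) ^ N \<le> p ^ n" .
    qed (use q(1) in auto)
    also have "\<dots> = (1 / 8) * (p ^ n * q ^ L)" by simp
    also have "p ^ n * q ^ L \<le> truncated_two_point d p n"
      unfolding q_def L_def using d q32 p(2) by (intro truncated_two_point_ge) (auto simp: q_def)
    finally have "(?A * q) ^ M \<le> (1 / 8) * truncated_two_point d p n" by simp
    moreover have pos: "0 < truncated_two_point d p n"
    proof -
      have "0 < p ^ n * q ^ L" using q(1) q32 unfolding q_def by simp
      also have "\<dots> \<le> truncated_two_point d p n"
        unfolding q_def L_def using d q32 p(2) by (intro truncated_two_point_ge) (auto simp: q_def)
      finally show ?thesis .
    qed
    moreover have "q * truncated_two_point d p n \<le> (1 / 32) * truncated_two_point d p n"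
      using q32 pos by (intro mult_right_mono) auto
    ultimately show ?thesis using le by linarith
  qed
  ultimately show ?thesis by blast
qed

theorem theorem1:
  fixes d :: nat
  assumes "d \<ge> 2"
  shows "(\<exists>p'::real. 0 < p' \<and> p' \<le> 1 \<and>
            (\<forall>p n. 0 < p \<and> p < p' \<and> n \<ge> 1 \<longrightarrow> two_point d p n > two_point d p (n + 1))) \<and>
         (\<exists>p''::real. 0 \<le> p'' \<and> p'' < 1 \<and>
            (\<forall>p n. p'' < p \<and> p < 1 \<and> n \<ge> 1 \<longrightarrow>
               truncated_two_point d p n > truncated_two_point d p (n + 1)))"
proof
  show "\<exists>p'::real. 0 < p' \<and> p' \<le> 1 \<and>
      (\<forall>p n. 0 < p \<and> p < p' \<and> n \<ge> 1 \<longrightarrow> two_point d p n > two_point d p (n + 1))"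
    using two_point_strict_decreasing[of d] assms by fastforce
  show "\<exists>p''::real. 0 \<le> p'' \<and> p'' < 1 \<and>
      (\<forall>p n. p'' < p \<and> p < 1 \<and> n \<ge> 1 \<longrightarrow>
         truncated_two_point d p n > truncated_two_point d p (n + 1))"
    using truncated_two_point_strict_decreasing[OF assms] by blast
qed

end
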